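(* Let $\theta$ be an inner function. If $\varphi\in H^\infty$ and $\bar\theta\varphi\in\overline{H^\infty}$, then $\sigma(D_\varphi^\theta)=\operatorname{clos}\varphi(\mathbb D)$, the closure of $\varphi(\mathbb D)$ in $\mathbb C$.
   Context: $L^2=L^2(\mathbb T)$, $\mathbb T$ the unit circle; $H^2$, $H^\infty$ are the Hardy spaces of the unit disk $\mathbb D$, viewed also as spaces of boundary functions on $\mathbb T$; $\overline{H^\infty}$ is the set of complex conjugates on $\mathbb T$ of functions in $H^\infty$. For an inner function $\theta$, $K_\theta=H^2\ominus\theta H^2$, $(K_\theta)^\perp=L^2\ominus K_\theta$, and $Q_\theta$ is the orthogonal projection of $L^2$ onto $(K_\theta)^\perp$. For $\varphi\in L^\infty(\mathbb T)$, $D_\varphi^{\theta}\colon (K_\theta)^\perp\to(K_\theta)^\perp$ is the dual truncated Toeplitz operator $D_\varphi^{\theta}f=Q_\theta(\varphi f)$, and $\sigma$ denotes the spectrum. *)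

theory Defs
  imports "HOL-Analysis.Analysis"
begin

section \<open>The Hilbert space \<open>L\<^sup>2\<close> of the unit circle\<close>

text \<open>Normalized arc length, as a probability measure whose underlying space is the unit circle.
  Functions on the circle have type \<^typ>\<open>complex \<Rightarrow> complex\<close>; only their values on
  \<^term>\<open>sphere (0::complex) 1\<close> matter for measurability, integrals and \<open>AE\<close> over this measure.\<close>

definition circle :: "complex measure" where
  "circle = distr (uniform_measure lborel {0..<2 * pi}) (restrict_space borel (sphere 0 1)) cis"

definition square_integrable :: "(complex \<Rightarrow> complex) \<Rightarrow> bool" where
  "square_integrable f \<longleftrightarrow>
     f \<in> borel_measurable circle \<and> integrable circle (\<lambda>\<zeta>. (norm (f \<zeta>))\<^sup>2)"

definition l2_eq :: "(complex \<Rightarrow> complex) \<Rightarrow> (complex \<Rightarrow> complex) \<Rightarrow> bool" where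
  "l2_eq f g \<longleftrightarrow> square_integrable f \<and> square_integrable g \<and> (AE \<zeta> in circle. f \<zeta> = g \<zeta>)"

lemma square_integrable_zero: "square_integrable (\<lambda>_. 0)"
  by (simp add: square_integrable_def)

lemma square_integrable_scale:
  assumes "square_integrable f" shows "square_integrable (\<lambda>\<zeta>. c * f \<zeta>)"
  using assms by (auto simp: square_integrable_def norm_mult power_mult_distrib)

lemma square_integrable_add:
  assumes f: "square_integrable f" and g: "square_integrable g"
  shows "square_integrable (\<lambda>\<zeta>. f \<zeta> + g \<zeta>)"
proof -
  have m: "f \<in> borel_measurable circle" "g \<in> borel_measurable circle"
    using assms by (auto simp: square_integrable_def)
  have "integrable circle (\<lambda>\<zeta>. 2 * (norm (f \<zeta>))\<^sup>2 + 2 * (norm (g \<zeta>))\<^sup>2)"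
    using assms by (auto simp: square_integrable_def)
  then have "integrable circle (\<lambda>\<zeta>. (norm (f \<zeta> + g \<zeta>))\<^sup>2)"
  proof (rule Bochner_Integration.integrable_bound)
    show "(\<lambda>\<zeta>. (norm (f \<zeta> + g \<zeta>))\<^sup>2) \<in> borel_measurable circle"
      using m by measurable
    have "(norm (a + b))\<^sup>2 \<le> 2 * (norm a)\<^sup>2 + 2 * (norm b)\<^sup>2" for a b :: complex
    proof -
      have "(norm (a + b))\<^sup>2 \<le> (norm a + norm b)\<^sup>2"
        by (intro power_mono norm_triangle_ineq norm_ge_zero)
      also have "\<dots> \<le> 2 * (norm a)\<^sup>2 + 2 * (norm b)\<^sup>2"
        using sum_squares_bound[of "norm a" "norm b"] by (simp add: power2_sum)
      finally show ?thesis .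
    qed
    then show "AE \<zeta> in circle.
        norm ((norm (f \<zeta> + g \<zeta>))\<^sup>2) \<le> norm (2 * (norm (f \<zeta>))\<^sup>2 + 2 * (norm (g \<zeta>))\<^sup>2)"
      by simp
  qed
  with m show ?thesis by (simp add: square_integrable_def)
qed

lemma square_integrable_mult_cnj:
  assumes f: "square_integrable f" and g: "square_integrable g"
  shows "integrable circle (\<lambda>\<zeta>. f \<zeta> * cnj (g \<zeta>))"
proof -
  have m: "f \<in> borel_measurable circle" "g \<in> borel_measurable circle"
    using assms by (auto simp: square_integrable_def)
  have "integrable circle (\<lambda>\<zeta>. (norm (f \<zeta>))\<^sup>2 + (norm (g \<zeta>))\<^sup>2)"
    using assms by (auto simp: square_integrable_def)
  then show ?thesis
  proof (rule Bochner_Integration.integrable_bound)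
    show "(\<lambda>\<zeta>. f \<zeta> * cnj (g \<zeta>)) \<in> borel_measurable circle"
      using m by (intro borel_measurable_times borel_measurable_continuous_on[where f=cnj])
        (auto intro: continuous_intros)
    have "norm (a * cnj b) \<le> (norm a)\<^sup>2 + (norm b)\<^sup>2" for a b :: complex
    proof -
      have "2 * (norm a * norm b) \<le> (norm a)\<^sup>2 + (norm b)\<^sup>2"
        using sum_squares_bound[of "norm a" "norm b"] by (simp add: mult.assoc)
      moreover have "0 \<le> norm a * norm b" by simp
      ultimately show ?thesis by (simp only: norm_mult complex_mod_cnj)
    qed
    then show "AE \<zeta> in circle.
        norm (f \<zeta> * cnj (g \<zeta>)) \<le> norm ((norm (f \<zeta>))\<^sup>2 + (norm (g \<zeta>))\<^sup>2)"
      by simp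
  qed
qed

lemma part_equivp_l2_eq: "part_equivp l2_eq"
proof (rule part_equivpI)
  show "\<exists>f. l2_eq f f"
    using square_integrable_zero by (auto simp: l2_eq_def)
  show "symp l2_eq"
    by (auto simp: symp_def l2_eq_def elim: AE_mp)
  show "transp l2_eq"
    unfolding transp_def l2_eq_def by (auto elim!: AE_mp)
qed

quotient_type l2 = "complex \<Rightarrow> complex" / partial: l2_eq
  by (rule part_equivp_l2_eq)

instantiation l2 :: real_vector
begin

lift_definition zero_l2 :: l2 is "\<lambda>_. 0"
  by (simp add: l2_eq_def square_integrable_zero)

lift_definition plus_l2 :: "l2 \<Rightarrow> l2 \<Rightarrow> l2" is "\<lambda>f g \<zeta>. f \<zeta> + g \<zeta>"
  by (auto simp: l2_eq_def square_integrable_add elim!: AE_mp)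

lift_definition uminus_l2 :: "l2 \<Rightarrow> l2" is "\<lambda>f \<zeta>. - f \<zeta>"
  using square_integrable_scale[where c = "-1"] by (auto simp: l2_eq_def elim!: AE_mp)

lift_definition minus_l2 :: "l2 \<Rightarrow> l2 \<Rightarrow> l2" is "\<lambda>f g \<zeta>. f \<zeta> - g \<zeta>"
  using square_integrable_add[OF _ square_integrable_scale[where c = "-1"]]
  by (auto simp: l2_eq_def elim!: AE_mp)

lift_definition scaleR_l2 :: "real \<Rightarrow> l2 \<Rightarrow> l2" is "\<lambda>r f \<zeta>. complex_of_real r * f \<zeta>"
  by (auto simp: l2_eq_def square_integrable_scale elim!: AE_mp)

instance
proof
  fix a b c :: l2 and r s :: real
  show "a + b + c = a + (b + c)"
    by transfer (auto simp: l2_eq_def add.assoc intro: square_integrable_add)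
  show "a + b = b + a"
    by transfer (auto simp: l2_eq_def add.commute intro: square_integrable_add)
  show "0 + a = a"
    by transfer (auto simp: l2_eq_def)
  show "- a + a = 0"
    by transfer (auto simp: l2_eq_def square_integrable_zero)
  show "a - b = a + - b"
    by transfer (use square_integrable_add[OF _ square_integrable_scale[where c = "-1"]]
      in \<open>auto simp: l2_eq_def\<close>)
  show "r *\<^sub>R (a + b) = r *\<^sub>R a + r *\<^sub>R b"
    by transfer (auto simp: l2_eq_def distrib_left
      intro!: square_integrable_add square_integrable_scale)
  show "(r + s) *\<^sub>R a = r *\<^sub>R a + s *\<^sub>R a"
    by transfer (auto simp: l2_eq_def distrib_right
      intro!: square_integrable_add square_integrable_scale)
  show "r *\<^sub>R s *\<^sub>R a = (r * s) *\<^sub>R a"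
    by transfer (auto simp: l2_eq_def mult.assoc
      intro!: square_integrable_scale)
  show "1 *\<^sub>R a = a"
    by transfer (auto simp: l2_eq_def)
qed

end

lift_definition cscale :: "complex \<Rightarrow> l2 \<Rightarrow> l2" (infixr "*\<^sub>c" 75) is "\<lambda>c f \<zeta>. c * f \<zeta>"
  by (auto simp: l2_eq_def square_integrable_scale elim!: AE_mp)

lift_definition cinner :: "l2 \<Rightarrow> l2 \<Rightarrow> complex" is
  "\<lambda>f g. LINT \<zeta>|circle. f \<zeta> * cnj (g \<zeta>)"
proof -
  fix f f' g g'
  assume eq: "l2_eq f f'" "l2_eq g g'"
  then have "AE \<zeta> in circle. f \<zeta> = f' \<zeta>" "AE \<zeta> in circle. g \<zeta> = g' \<zeta>"
    by (auto simp: l2_eq_def)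
  then have ae: "AE \<zeta> in circle. f \<zeta> * cnj (g \<zeta>) = f' \<zeta> * cnj (g' \<zeta>)"
    by eventually_elim simp
  have "integrable circle (\<lambda>\<zeta>. f \<zeta> * cnj (g \<zeta>))" "integrable circle (\<lambda>\<zeta>. f' \<zeta> * cnj (g' \<zeta>))"
    using eq by (auto simp: l2_eq_def intro: square_integrable_mult_cnj)
  then show "(LINT \<zeta>|circle. f \<zeta> * cnj (g \<zeta>)) = (LINT \<zeta>|circle. f' \<zeta> * cnj (g' \<zeta>))"
    using ae by (intro integral_cong_AE borel_measurable_integrable)
qed

lemma cinner_add_left: "cinner (f + g) h = cinner f h + cinner g h"
  by transfer (auto simp: l2_eq_def distrib_right square_integrable_mult_cnj)

lemma cinner_cscale_left: "cinner (c *\<^sub>c f) h = c * cinner f h"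
  by transfer (auto simp: l2_eq_def mult.assoc square_integrable_mult_cnj)

lemma scaleR_eq_cscale: "r *\<^sub>R f = complex_of_real r *\<^sub>c f"
  by transfer (auto simp: l2_eq_def square_integrable_scale)

lemma cinner_commute: "cinner f g = cnj (cinner g f)"
proof transfer
  fix f g
  have "cnj (LINT \<zeta>|circle. g \<zeta> * cnj (f \<zeta>)) = (LINT \<zeta>|circle. cnj (g \<zeta> * cnj (f \<zeta>)))"
    by (rule Bochner_Integration.integral_cnj[symmetric])
  then show "(LINT \<zeta>|circle. f \<zeta> * cnj (g \<zeta>)) = cnj (LINT \<zeta>|circle. g \<zeta> * cnj (f \<zeta>))"
    by (simp only: complex_cnj_mult complex_cnj_cnj mult.commute)
qed

lemma cinner_self: "cinner f f = complex_of_real (LINT \<zeta>|circle. (norm (rep_l2 f \<zeta>))\<^sup>2)"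
  unfolding cinner.rep_eq by (simp add: complex_norm_square[symmetric] flip: of_real_power)

lemma square_integrable_rep: "square_integrable (rep_l2 f)"
  using Quotient3_rel_rep[OF Quotient3_l2, of f f] by (simp add: l2_eq_def)

lemma cinner_self_eq_0_iff: "cinner f f = 0 \<longleftrightarrow> f = 0"
proof
  assume "cinner f f = 0"
  then have "(LINT \<zeta>|circle. (norm (rep_l2 f \<zeta>))\<^sup>2) = 0"
    by (simp add: cinner_self)
  then have "AE \<zeta> in circle. (norm (rep_l2 f \<zeta>))\<^sup>2 = 0"
    using square_integrable_rep[of f]
    by (subst (asm) integral_nonneg_eq_0_iff_AE) (auto simp: square_integrable_def)
  then have "l2_eq (rep_l2 f) (\<lambda>_. 0)"
    using square_integrable_rep[of f] by (auto simp: l2_eq_def square_integrable_zero elim!: AE_mp)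
  then have "abs_l2 (rep_l2 f) = abs_l2 (\<lambda>_. 0)"
    using Quotient3_rel[OF Quotient3_l2] by blast
  then show "f = 0"
    by (simp add: Quotient3_abs_rep[OF Quotient3_l2] zero_l2_def)
next
  assume "f = 0"
  then show "cinner f f = 0" using cinner_add_left[of 0 0 0] by simp
qed

instantiation l2 :: real_inner
begin

definition inner_l2 :: "l2 \<Rightarrow> l2 \<Rightarrow> real" where "inner_l2 f g = Re (cinner f g)"
definition norm_l2 :: "l2 \<Rightarrow> real" where "norm_l2 f = sqrt (inner f f)"
definition sgn_l2 :: "l2 \<Rightarrow> l2" where "sgn_l2 f = f /\<^sub>R norm f"
definition dist_l2 :: "l2 \<Rightarrow> l2 \<Rightarrow> real" where "dist_l2 f g = norm (f - g)"
definition uniformity_l2 :: "(l2 \<times> l2) filter" where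
  "uniformity_l2 = (INF e\<in>{0<..}. principal {(f, g). dist f g < e})"
definition open_l2 :: "l2 set \<Rightarrow> bool" where
  "open_l2 U \<longleftrightarrow> (\<forall>f\<in>U. eventually (\<lambda>(f', g). f' = f \<longrightarrow> g \<in> U) uniformity)"

instance
proof
  fix f g h :: l2 and r :: real
  show "inner f g = inner g f"
    unfolding inner_l2_def by (subst cinner_commute) simp
  show "inner (f + g) h = inner f h + inner g h"
    by (simp add: inner_l2_def cinner_add_left)
  show "inner (r *\<^sub>R f) g = r * inner f g"
    by (simp add: inner_l2_def scaleR_eq_cscale cinner_cscale_left)
  show "0 \<le> inner f f"
    by (simp add: inner_l2_def cinner_self)
  show "inner f f = 0 \<longleftrightarrow> f = 0"
    unfolding cinner_self_eq_0_iff[symmetric] by (simp add: inner_l2_def cinner_self)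
qed (simp_all add: norm_l2_def sgn_l2_def dist_l2_def uniformity_l2_def open_l2_def)

end

text \<open>Multiplication by \<open>\<psi> \<in> L\<^sup>\<infinity>\<close>. For \<open>\<psi>\<close> that is not essentially bounded the product may fail to be
  square integrable, and the value is then meaningless.\<close>

definition mult_op :: "(complex \<Rightarrow> complex) \<Rightarrow> l2 \<Rightarrow> l2" where
  "mult_op \<psi> f = abs_l2 (\<lambda>\<zeta>. \<psi> \<zeta> * rep_l2 f \<zeta>)"

definition ortho_compl :: "l2 set \<Rightarrow> l2 set" where
  "ortho_compl A = {f. \<forall>g\<in>A. cinner f g = 0}"

definition ortho_proj :: "l2 set \<Rightarrow> l2 \<Rightarrow> l2" where
  "ortho_proj M f = (THE g. g \<in> M \<and> f - g \<in> ortho_compl M)"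


section \<open>Bounded operators on a closed subspace and their spectrum\<close>

definition bounded_operator_on :: "l2 set \<Rightarrow> (l2 \<Rightarrow> l2) \<Rightarrow> bool" where
  "bounded_operator_on M T \<longleftrightarrow>
     (\<forall>f\<in>M. T f \<in> M) \<and>
     (\<forall>f\<in>M. \<forall>g\<in>M. T (f + g) = T f + T g) \<and>
     (\<forall>c. \<forall>f\<in>M. T (c *\<^sub>c f) = c *\<^sub>c T f) \<and>
     (\<exists>C. \<forall>f\<in>M. norm (T f) \<le> C * norm f)"

definition spectrum_on :: "l2 set \<Rightarrow> (l2 \<Rightarrow> l2) \<Rightarrow> complex set" where
  "spectrum_on M T = {\<mu>. \<not> (\<exists>S. bounded_operator_on M S \<and>
     (\<forall>f\<in>M. S (T f - \<mu> *\<^sub>c f) = f \<and> T (S f) - \<mu> *\<^sub>c S f = f))}"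


section \<open>Hardy spaces and boundary functions\<close>

definition hardy_inf :: "(complex \<Rightarrow> complex) set" where
  "hardy_inf = {F. F holomorphic_on ball 0 1 \<and> bounded (F ` ball 0 1)}"

definition hardy_two :: "(complex \<Rightarrow> complex) set" where
  "hardy_two = {F. F holomorphic_on ball 0 1 \<and>
     (\<exists>C. \<forall>r\<in>{0..<1}. (LINT \<zeta>|circle. (norm (F (complex_of_real r * \<zeta>)))\<^sup>2) \<le> C)}"

text \<open>\<open>f\<close> is (a representative of) the boundary function of \<open>F\<close>: the radial limits of \<open>F\<close> exist
  almost everywhere and agree with \<open>f\<close>. By Fatou's theorem every function in the Hardy spaces above
  has a boundary function; it is unique up to null sets.\<close>

definition boundary_function :: "(complex \<Rightarrow> complex) \<Rightarrow> (complex \<Rightarrow> complex) \<Rightarrow> bool" where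
  "boundary_function F f \<longleftrightarrow> f \<in> borel_measurable circle \<and>
     (AE \<zeta> in circle. ((\<lambda>r. F (complex_of_real r * \<zeta>)) \<longlongrightarrow> f \<zeta>) (at_left 1))"

definition H2 :: "l2 set" where
  "H2 = {f. \<exists>F\<in>hardy_two. boundary_function F (rep_l2 f)}"

definition Hinf :: "(complex \<Rightarrow> complex) set" where
  "Hinf = {f. \<exists>F\<in>hardy_inf. boundary_function F f}"

definition conj_Hinf :: "(complex \<Rightarrow> complex) set" where
  "conj_Hinf = {h. \<exists>f\<in>Hinf. \<forall>\<zeta>. h \<zeta> = cnj (f \<zeta>)}"

definition inner_function :: "(complex \<Rightarrow> complex) \<Rightarrow> bool" where
  "inner_function \<theta> \<longleftrightarrow> \<theta> \<in> hardy_inf \<and>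
     (\<exists>f. boundary_function \<theta> f \<and> (AE \<zeta> in circle. norm (f \<zeta>) = 1))"


section \<open>Model spaces and dual truncated Toeplitz operators\<close>

text \<open>The arguments \<open>\<theta>\<close> and \<open>\<phi>\<close> in this section are functions on the circle, that is, boundary
  functions; the constructions depend on them only up to null sets.\<close>

definition model_space :: "(complex \<Rightarrow> complex) \<Rightarrow> l2 set" where
  "model_space \<theta> = H2 \<inter> ortho_compl (mult_op \<theta> ` H2)"

definition model_perp :: "(complex \<Rightarrow> complex) \<Rightarrow> l2 set" where
  "model_perp \<theta> = ortho_compl (model_space \<theta>)"

definition dual_tto :: "(complex \<Rightarrow> complex) \<Rightarrow> (complex \<Rightarrow> complex) \<Rightarrow> l2 \<Rightarrow> l2" where
  "dual_tto \<theta> \<phi> f = ortho_proj (model_perp \<theta>) (mult_op \<phi> f)"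

end

theory Submission
  imports Defs "HOL-Complex_Analysis.Cauchy_Integral_Formula"
begin

text \<open>
  Write \<open>N\<close> for the orthogonal complement of \<open>H\<^sup>2\<close> in \<open>L\<^sup>2\<close>. Then \<open>(K\<^sub>\<theta>)\<^sup>\<bottom> = N \<oplus> \<theta> H\<^sup>2\<close>, and under the hypotheses
  the dual truncated Toeplitz operator is diagonal in this decomposition (\<open>dual_tto_decomposition\<close>). Indeed \<open>\<phi>\<close>
  maps \<open>\<theta> H\<^sup>2\<close> to itself. If \<open>g\<close> is in \<open>N\<close>, then \<open>cnj \<theta> \<phi> g\<close> is in \<open>N\<close>, because \<open>cnj \<theta> \<phi>\<close> is conjugate analytic; so
  \<open>\<langle>\<phi> g, \<theta> k\<rangle> = \<langle>cnj \<theta> \<phi> g, k\<rangle> = 0\<close> for all \<open>k\<close> in \<open>H\<^sup>2\<close>. The part of \<open>\<phi> g\<close> in \<open>H\<^sup>2\<close> therefore belongs to \<open>K\<^sub>\<theta>\<close> and is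
  projected away. The operator acts on \<open>g + \<theta> h\<close> as the dual Toeplitz operator of \<open>\<phi>\<close> on \<open>g\<close> and as
  multiplication by \<open>\<phi>\<close> on \<open>h\<close>.

  If \<open>\<mu>\<close> is not in the closure of \<open>\<phi>(ball 0 1)\<close>, then \<open>1 / (\<phi> - \<mu>)\<close> is bounded and analytic, and its two diagonal blocks
  invert those of \<open>\<phi> - \<mu>\<close> (\<open>dual_toeplitz_inverse\<close>). Conversely, for \<open>w\<close> in the disc the Cauchy kernel
  \<open>1 / (\<zeta> - w)\<close> lies in \<open>N\<close> and is an eigenvector with eigenvalue \<open>\<phi>(w)\<close> (\<open>dual_toeplitz_eigenvector\<close>). Near such
  eigenvalues resolvents have large norm, so the closure of \<open>\<phi>(ball 0 1)\<close> is in the spectrum too.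

  The analytic foundation is that \<open>L\<^sup>2\<close> splits as \<open>H\<^sup>2 \<oplus> N\<close> when \<open>H\<^sup>2\<close> is described by radial limits
  (\<open>riesz_decomposition\<close>). For this, a power series \<open>F\<close> with square summable coefficients \<open>a\<close> must have radial
  limits almost everywhere, which follows from the maximal inequality
  \<open>\<integral> sup\<^sub>r \<bar>F(r \<zeta>)\<bar>\<^sup>2 \<le> C \<Sum>\<bar>a\<^sub>n\<bar>\<^sup>2\<close> (\<open>radial_maximal_inequality\<close>) applied to the tails of the series. The inequality is
  proved by duality: with a measurable choice of radius \<open>\<rho>(\<zeta>)\<close>, the
  operator \<open>A : a \<mapsto> F(\<rho>(\<zeta>) \<zeta>)\<close> has \<open>A A\<^sup>*\<close> with kernel \<open>1 / (1 - \<rho>(\<zeta>) \<rho>(\<eta>) \<zeta> cnj \<eta>)\<close>, whose real part is positive and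
  at most a constant times the sum of the kernels with \<open>\<rho>(\<eta>)\<close> or \<open>\<rho>(\<zeta>)\<close> replaced by 1. For nonnegative functions
  \<open>g\<close> this bounds the square norm of \<open>A\<^sup>* g\<close> by a constant times the product of the norms of \<open>A\<^sup>* g\<close> and \<open>g\<close>.
\<close>

section \<open>Integration on the circle\<close>

lemma borel_measurable_cis [measurable]: "cis \<in> borel_measurable borel"
  by (simp add: borel_measurable_continuous_onI continuous_on_cis continuous_on_id)

lemma cis_measurable [measurable]:
  "cis \<in> uniform_measure lborel {0..<2*pi} \<rightarrow>\<^sub>M restrict_space borel (sphere 0 1)"
  using borel_measurable_cis
  by (intro measurable_restrict_space2) (auto cong: measurable_cong_sets)

lemma space_circle [simp]: "space circle = sphere 0 1"
  by (simp add: circle_def space_restrict_space)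

lemma sets_circle [simp, measurable_cong]: "sets circle = sets (restrict_space borel (sphere 0 1))"
  by (simp add: circle_def)

lemma measure_space_circle: "emeasure circle (space circle) = 1"
proof -
  have "cis -` sphere 0 1 \<inter> UNIV = UNIV" by auto
  then show ?thesis unfolding space_circle
    by (simp add: circle_def emeasure_distr space_restrict_space  sets_restrict_space_iff)
qed

interpretation circle: finite_measure circle
  by standard (simp add: measure_space_circle del: space_circle)

lemma measure_circle_1 [simp]: "measure circle (sphere 0 1) = 1"
  using measure_space_circle by (simp add: measure_def)

lemma borel_measurable_circle:
  assumes "f \<in> borel_measurable borel" shows "f \<in> borel_measurable circle"
  using measurable_restrict_space1[OF assms, of "sphere 0 1"] 
  by (subst measurable_cong_sets[OF sets_circle refl])

lemma borel_measurable_circle_id [measurable]: "(\<lambda>\<zeta>. \<zeta>) \<in> borel_measurable circle"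
  by (rule borel_measurable_circle) (rule measurable_ident_sets[OF refl])

lemma borel_measurable_circle_cnj [measurable (raw)]:
  assumes "f \<in> borel_measurable M" shows "(\<lambda>x. cnj (f x)) \<in> borel_measurable M"
  using assms by (rule measurable_compose) (simp add: borel_measurable_continuous_onI continuous_on_cnj continuous_on_id)

lemma integrable_circle_bounded:
  fixes f :: "complex \<Rightarrow> 'a :: {banach, second_countable_topology}"
  assumes "f \<in> borel_measurable circle" "\<And>\<zeta>. norm \<zeta> = 1 \<Longrightarrow> norm (f \<zeta>) \<le> B"
  shows "integrable circle f"
  using assms by (intro circle.integrable_const_bound[of _ B] AE_I2) auto

text \<open>The primitive \<open>cis t ^ n / (\<i> n)\<close> is periodic; everything about Fourier series below rests on this.\<close>

lemma integral_circle_power: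
  assumes "n \<noteq> 0" shows "(LINT \<zeta>|circle. \<zeta> ^ n) = 0"
proof -
  have "(LINT \<zeta>|circle. \<zeta> ^ n) = (LINT t|uniform_measure lborel {0..<2*pi}. cis t ^ n)"
    unfolding circle_def
    by (subst integral_distr) (auto intro!: measurable_restrict_space1 borel_measurable_power)
  also have "\<dots> = (LINT t|density lborel (\<lambda>t. ennreal (indicator {0..<2*pi} t / (2*pi))). cis t ^ n)"
    by (simp add: uniform_measure_def divide_ennreal ennreal_indicator[symmetric])
  also have "\<dots> = (LINT t|lborel. (indicator {0..<2*pi} t / (2*pi)) *\<^sub>R cis t ^ n)"
    by (intro integral_density) auto
  also have "\<dots> = (LINT t|lborel. (indicator {0..2*pi} t *\<^sub>R cis t ^ n)) / (2*pi)"
  proof -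
    have "AE t in lborel. t \<noteq> 2 * pi" by (rule AE_lborel_singleton)
    then have "(LINT t|lborel. (indicator {0..<2*pi} t / (2*pi)) *\<^sub>R cis t ^ n)
       = (LINT t|lborel. (indicator {0..2*pi} t *\<^sub>R cis t ^ n) / (2*pi))"
      by (intro integral_cong_AE) (auto simp: scaleR_conv_of_real elim!: eventually_mono split: split_indicator)
    then show ?thesis by simp
  qed
  also have "(LINT t|lborel. (indicator {0..2*pi} t *\<^sub>R cis t ^ n)) = 
     cis (2*pi) ^ n / (\<i> * n) - cis 0 ^ n / (\<i> * n)"
  proof (rule integral_FTC_Icc)
    fix t :: real
    have "((\<lambda>t. exp (n * (\<i> * complex_of_real t)) / (\<i> * n)) has_vector_derivative
       exp (n * (\<i> * t))) (at t within {0..2*pi})"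
      using assms
      by (auto intro!: derivative_eq_intros has_vector_derivative_real_field simp: field_simps)
    then show "((\<lambda>t. cis t ^ n / (\<i> * n)) has_vector_derivative cis t ^ n) (at t within {0..2*pi})"
      by (simp add: cis_conv_exp exp_of_nat_mult)
  qed (auto intro!: continuous_intros continuous_on_cis)
  finally show ?thesis by simp
qed

lemma integral_circle_power_cnj:
  "(LINT \<zeta>|circle. \<zeta> ^ n * cnj \<zeta> ^ m) = (if n = m then 1 else 0)"
proof -
  have 1: "z * cnj z = 1" if "norm z = 1" for z using that by (simp add: complex_norm_square[symmetric])
  have 2: "z ^ n * cnj z ^ m = (if n = m then 1 else if n > m then z ^ (n - m) else cnj (z ^ (m - n)))"
    if "norm z = 1" for z
  proof (cases "n \<ge> m")
    case True
    have "z ^ n * cnj z ^ m = z ^ (n - m) * (z * cnj z) ^ m"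
      using True by (simp add: power_mult_distrib flip: power_add mult.assoc)
    then show ?thesis using True 1[OF that] by auto
  next
    case False
    have "z ^ n * cnj z ^ m = cnj z ^ (m - n) * (z * cnj z) ^ n"
      using False by (simp add: power_mult_distrib mult_ac flip: power_add)
    then show ?thesis using False 1[OF that] by auto
  qed
  have "(LINT \<zeta>|circle. \<zeta> ^ n * cnj \<zeta> ^ m) =
     (LINT \<zeta>|circle. (if n = m then 1 else if n > m then \<zeta> ^ (n - m) else cnj (\<zeta> ^ (m - n))))"
    using 2 by (intro Bochner_Integration.integral_cong) auto
  also have "\<dots> = (if n = m then 1 else 0)"
    using integral_circle_power[of "n - m"] integral_circle_power[of "m - n"]
    by (cases n m rule: linorder_cases) (simp_all del: complex_cnj_power)
  finally show ?thesis .
qed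

section \<open>Fourier coefficients and Bessel's inequality\<close>

text \<open>Every interchange of a power series with an integral over the circle has a dominating series of
  this form, since the series is only evaluated on a disc of radius \<open>R < 1\<close>.\<close>

lemma sums_integral_geometric:
  fixes f :: "nat \<Rightarrow> complex \<Rightarrow> complex"
  assumes meas: "\<And>n. f n \<in> borel_measurable circle" and G: "integrable circle G"
    and bound: "\<And>n \<zeta>. norm \<zeta> = 1 \<Longrightarrow> norm (f n \<zeta>) \<le> G \<zeta> * R ^ n"
    and R: "0 \<le> R" "R < 1"
    and s: "\<And>\<zeta>. norm \<zeta> = 1 \<Longrightarrow> (\<lambda>n. f n \<zeta>) sums s \<zeta>"
  shows "integrable circle s" "(\<lambda>n. LINT \<zeta>|circle. f n \<zeta>) sums (LINT \<zeta>|circle. s \<zeta>)"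
proof -
  have int: "integrable circle (f n)" for n
  proof (rule Bochner_Integration.integrable_bound)
    show "integrable circle (\<lambda>\<zeta>. G \<zeta> * R ^ n)" using G by simp
    show "AE \<zeta> in circle. norm (f n \<zeta>) \<le> norm (G \<zeta> * R ^ n)"
      using bound by (intro AE_I2) (auto intro!: order_trans[OF bound])
  qed (rule meas)
  have sumR: "summable (\<lambda>n. c * R ^ n)" for c :: real
    using R by (intro summable_mult summable_geometric) auto
  have sum: "AE \<zeta> in circle. summable (\<lambda>n. norm (f n \<zeta>))"
    using bound by (intro AE_I2 summable_comparison_test'[OF sumR]) auto
  have "norm (LINT \<zeta>|circle. norm (f n \<zeta>)) \<le> (LINT \<zeta>|circle. G \<zeta>) * R ^ n" for n
  proof -
    have "(LINT \<zeta>|circle. norm (f n \<zeta>)) \<le> (LINT \<zeta>|circle. G \<zeta> * R ^ n)"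
      using bound int G by (intro integral_mono) auto
    then show ?thesis by simp
  qed
  then have sum2: "summable (\<lambda>n. LINT \<zeta>|circle. norm (f n \<zeta>))"
    by (intro summable_comparison_test'[OF sumR])
  have eq: "s \<zeta> = (\<Sum>n. f n \<zeta>)" if "\<zeta> \<in> space circle" for \<zeta>
    using s[of \<zeta>] that by (simp add: sums_iff)
  have "integrable circle (\<lambda>\<zeta>. \<Sum>n. f n \<zeta>)"
       "(\<lambda>n. LINT \<zeta>|circle. f n \<zeta>) sums (LINT \<zeta>|circle. (\<Sum>n. f n \<zeta>))"
    by (rule integrable_suminf sums_integral; fact int sum sum2)+
  moreover have "(LINT \<zeta>|circle. (\<Sum>n. f n \<zeta>)) = (LINT \<zeta>|circle. s \<zeta>)"
    using eq by (intro Bochner_Integration.integral_cong) auto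
  moreover have "integrable circle (\<lambda>\<zeta>. \<Sum>n. f n \<zeta>) = integrable circle s"
    using eq by (intro Bochner_Integration.integrable_cong) auto
  ultimately show "integrable circle s" "(\<lambda>n. LINT \<zeta>|circle. f n \<zeta>) sums (LINT \<zeta>|circle. s \<zeta>)"
    by simp_all
qed

text \<open>The index is a natural number because the coefficients of nonnegative index determine the projection to \<open>H\<^sup>2\<close>.\<close>

definition fourier_coeff :: "(complex \<Rightarrow> complex) \<Rightarrow> nat \<Rightarrow> complex" where
  "fourier_coeff f n = (LINT \<zeta>|circle. f \<zeta> * cnj \<zeta> ^ n)"

lemma square_integrable_integrable:
  assumes "square_integrable f" shows "integrable circle f"
proof -
  have "square_integrable (\<lambda>_. 1)" by (simp add: square_integrable_def)
  from square_integrable_mult_cnj[OF assms this] show ?thesis by simp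
qed

lemma square_integrable_bounded:
  assumes "f \<in> borel_measurable circle" "AE \<zeta> in circle. norm (f \<zeta>) \<le> B"
  shows "square_integrable f"
  unfolding square_integrable_def
proof
  show "integrable circle (\<lambda>\<zeta>. (norm (f \<zeta>))\<^sup>2)"
    using assms by (intro circle.integrable_const_bound[of _ "B\<^sup>2"])
      (auto elim!: eventually_mono intro!: power_mono)
qed (rule assms)

lemma square_integrable_power: "square_integrable (\<lambda>\<zeta>. \<zeta> ^ n)"
  by (rule square_integrable_bounded[where B = 1]) (auto simp: norm_power)

lemma square_integrable_mult_power:
  assumes "square_integrable f" shows "integrable circle (\<lambda>\<zeta>. f \<zeta> * cnj \<zeta> ^ n)"
  using square_integrable_mult_cnj[OF assms square_integrable_power[of n]] by simp

text \<open>The partial Fourier sum \<open>p\<close> has the same pairing with \<open>f\<close> as with itself, so the square norm of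
  \<open>f - p\<close> is the difference of the two sides.\<close>

lemma Bessel_inequality_circle:
  assumes f: "square_integrable f"
  shows "(\<Sum>n<N. (norm (fourier_coeff f n))\<^sup>2) \<le> (LINT \<zeta>|circle. (norm (f \<zeta>))\<^sup>2)"
proof -
  let ?c = "fourier_coeff f"
  define p where "p \<zeta> = (\<Sum>n<N. ?c n * \<zeta> ^ n)" for \<zeta>
  have p: "square_integrable p" unfolding p_def
    by (induction N) (auto intro!: square_integrable_zero square_integrable_add
      square_integrable_scale square_integrable_power)
  have *: "(LINT \<zeta>|circle. h \<zeta> * cnj (p \<zeta>)) = (\<Sum>n<N. cnj (?c n) * fourier_coeff h n)"
    if h: "square_integrable h" for h
  proof -
    have "(LINT \<zeta>|circle. h \<zeta> * cnj (p \<zeta>)) = (LINT \<zeta>|circle. (\<Sum>n<N. cnj (?c n) * (h \<zeta> * cnj \<zeta> ^ n)))"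
      by (simp add: p_def sum_distrib_left mult_ac)
    also have "\<dots> = (\<Sum>n<N. cnj (?c n) * fourier_coeff h n)"
      using h by (subst Bochner_Integration.integral_sum)
        (auto simp: fourier_coeff_def intro!: square_integrable_mult_power)
    finally show ?thesis .
  qed
  have cp: "fourier_coeff p m = ?c m" if "m < N" for m
  proof -
    have "fourier_coeff p m = (LINT \<zeta>|circle. (\<Sum>n<N. ?c n * (\<zeta> ^ n * cnj \<zeta> ^ m)))"
      unfolding p_def fourier_coeff_def[of _ m] by (simp only: sum_distrib_right mult.assoc)
    also have "\<dots> = (\<Sum>n<N. ?c n * (if n = m then 1 else 0))"
      by (subst Bochner_Integration.integral_sum)
         (auto simp: integral_circle_power_cnj intro!: integrable_mult_right 
            square_integrable_mult_power square_integrable_power)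
    also have "\<dots> = ?c m" using that by (simp add: if_distrib cong: if_cong)
    finally show ?thesis .
  qed
  have sq: "z * cnj z = complex_of_real ((norm z)\<^sup>2)" for z by (simp only: complex_norm_square)
  have ff: "(LINT \<zeta>|circle. h \<zeta> * cnj (h \<zeta>)) = complex_of_real (LINT \<zeta>|circle. (norm (h \<zeta>))\<^sup>2)" for h
    unfolding sq by (rule integral_complex_of_real)
  let ?S = "\<Sum>n<N. (norm (?c n))\<^sup>2"
  have fp: "(LINT \<zeta>|circle. f \<zeta> * cnj (p \<zeta>)) = complex_of_real ?S"
    unfolding *[OF f] by (simp add: mult.commute[of "cnj _"] sq)
  have pp: "(LINT \<zeta>|circle. p \<zeta> * cnj (p \<zeta>)) = complex_of_real ?S"
    unfolding *[OF p] by (simp add: mult.commute[of "cnj _"] sq cp)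
  have pf: "(LINT \<zeta>|circle. p \<zeta> * cnj (f \<zeta>)) = complex_of_real ?S"
  proof -
    have "(LINT \<zeta>|circle. p \<zeta> * cnj (f \<zeta>)) = (LINT \<zeta>|circle. cnj (f \<zeta> * cnj (p \<zeta>)))"
      by (simp add: mult.commute)
    also have "\<dots> = cnj (LINT \<zeta>|circle. f \<zeta> * cnj (p \<zeta>))"
      by (rule Bochner_Integration.integral_cnj)
    finally show ?thesis using fp by simp
  qed
  have "complex_of_real (LINT \<zeta>|circle. (norm (f \<zeta> - p \<zeta>))\<^sup>2)
     = (LINT \<zeta>|circle. f \<zeta> * cnj (f \<zeta>) - f \<zeta> * cnj (p \<zeta>) - p \<zeta> * cnj (f \<zeta>) + p \<zeta> * cnj (p \<zeta>))"
    unfolding ff[symmetric] by (simp add: algebra_simps)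
  also have "\<dots> = (LINT \<zeta>|circle. f \<zeta> * cnj (f \<zeta>)) - complex_of_real ?S"
    using f p by (simp add: square_integrable_mult_cnj fp pp pf del: of_real_sum)
  also have "\<dots> = complex_of_real ((LINT \<zeta>|circle. (norm (f \<zeta>))\<^sup>2) - ?S)"
    unfolding ff by simp
  finally have "(LINT \<zeta>|circle. (norm (f \<zeta> - p \<zeta>))\<^sup>2) = (LINT \<zeta>|circle. (norm (f \<zeta>))\<^sup>2) - ?S"
    by (simp only: of_real_eq_iff)
  moreover have "0 \<le> (LINT \<zeta>|circle. (norm (f \<zeta> - p \<zeta>))\<^sup>2)" by simp
  ultimately show ?thesis by linarith
qed

lemma Bessel_summable:
  assumes f: "square_integrable f"
  shows "summable (\<lambda>n. (norm (fourier_coeff f n))\<^sup>2)"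
    and "(\<Sum>n. (norm (fourier_coeff f n))\<^sup>2) \<le> (LINT \<zeta>|circle. (norm (f \<zeta>))\<^sup>2)"
proof -
  show "summable (\<lambda>n. (norm (fourier_coeff f n))\<^sup>2)"
    using Bessel_inequality_circle[OF f]
    by (intro bounded_imp_summable[where B = "LINT \<zeta>|circle. (norm (f \<zeta>))\<^sup>2"])
       (simp_all only: lessThan_Suc_atMost[symmetric] zero_le_power2)
  then show "(\<Sum>n. (norm (fourier_coeff f n))\<^sup>2) \<le> (LINT \<zeta>|circle. (norm (f \<zeta>))\<^sup>2)"
    using Bessel_inequality_circle[OF f] by (intro suminf_le_const)
qed

section \<open>The radial maximal inequality\<close>

text \<open>The right-hand side is one plus the Poisson kernel, hence positive; kernels at
  different radii are compared in this form.\<close>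

lemma Re_szego_kernel:
  assumes "norm z < 1"
  shows "2 * Re (1 / (1 - z)) = 1 + (1 - (norm z)\<^sup>2) / (norm (1 - z))\<^sup>2"
proof -
  have "(norm (1 - z))\<^sup>2 \<noteq> 0" using assms by auto
  moreover have "2 * (1 - Re z) = (norm (1 - z))\<^sup>2 + (1 - (norm z)\<^sup>2)"
    unfolding cmod_power2 by (simp add: power2_eq_square algebra_simps)
  ultimately have "2 * (1 - Re z) / (norm (1 - z))\<^sup>2 = 1 + (1 - (norm z)\<^sup>2) / (norm (1 - z))\<^sup>2"
    by (simp only: add_divide_distrib) simp
  moreover have "Re (1 / (1 - z)) = (1 - Re z) / (norm (1 - z))\<^sup>2"
    by (simp add: Re_divide cmod_power2)
  ultimately show ?thesis by simp
qed

text \<open>At radius \<open>r s\<close> the kernel is comparable with the kernel at the smaller of the two radii, because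
  \<open>1 - r s\<close> lies between \<open>1 - s\<close> and \<open>1 - s\<^sup>2\<close>. This is the only geometric input of the maximal inequality.\<close>

lemma Re_szego_kernel_le:
  fixes r s :: real and w :: complex
  assumes w: "norm w = 1" and rs: "0 \<le> s" "s \<le> r" "r \<le> 1" "s < 1"
  shows "Re (1 / (1 - r * s * w)) \<le> 8 * Re (1 / (1 - s * w))"
proof -
  have n: "norm (s * w) = s" "norm (r * s * w) = r * s" using w rs by (auto simp: norm_mult)
  have rs1: "r * s \<le> s" using rs by (simp add: mult_left_le_one_le)
  have d: "norm (1 - s * w) \<noteq> 0" "norm (1 - r * s * w) \<noteq> 0" 
    using n rs rs1 by (auto simp del: norm_mult norm_of_real)
  have "1 - s * w = (1 - r * s * w) - of_real (s * (1 - r)) * w"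
    by (simp add: algebra_simps)
  then have "norm (1 - s * w) \<le> norm (1 - r * s * w) + norm (of_real (s * (1 - r)) * w)"
    by (metis norm_triangle_ineq4)
  also have "norm (of_real (s * (1 - r)) * w) = s * (1 - r)"
    using rs w by (simp add: norm_mult del: of_real_mult of_real_diff)
  also have "s * (1 - r) \<le> 1 - r * s" using rs by (simp add: algebra_simps)
  also have "1 - r * s \<le> norm (1 - r * s * w)"
    using norm_triangle_ineq2[of 1 "r * s * w"] n by simp
  finally have 1: "norm (1 - s * w) \<le> 2 * norm (1 - r * s * w)" by simp
  have "1 - (r * s)\<^sup>2 \<le> 1 - (s * s)\<^sup>2"
    using rs by (intro diff_left_mono power_mono mult_mono) auto
  also have "\<dots> = (1 - s\<^sup>2) * (1 + s\<^sup>2)" by (simp add: power2_eq_square algebra_simps)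
  also have "\<dots> \<le> (1 - s\<^sup>2) * 2"
    using rs by (intro mult_left_mono) (auto simp: power_le_one)
  finally have 2: "1 - (r * s)\<^sup>2 \<le> 2 * (1 - s\<^sup>2)" by simp
  have s0: "0 \<le> 1 - s\<^sup>2" using rs by (simp add: power_le_one)
  have "(1 - (r * s)\<^sup>2) / (norm (1 - r * s * w))\<^sup>2 \<le> 2 * (1 - s\<^sup>2) / (norm (1 - r * s * w))\<^sup>2"
    using 2 by (intro divide_right_mono) auto
  also have "\<dots> \<le> 2 * (1 - s\<^sup>2) / ((norm (1 - s * w))\<^sup>2 / 4)"
  proof (intro divide_left_mono)
    show "(norm (1 - s * w))\<^sup>2 / 4 \<le> (norm (1 - r * s * w))\<^sup>2"
      using power_mono[OF 1, of 2] by (simp add: power_mult_distrib)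
  qed (use s0 d in auto)
  finally have "(1 - (r * s)\<^sup>2) / (norm (1 - r * s * w))\<^sup>2 \<le> 8 * ((1 - s\<^sup>2) / (norm (1 - s * w))\<^sup>2)"
    by simp
  moreover have "2 * Re (1 / (1 - r * s * w)) = 1 + (1 - (r * s)\<^sup>2) / (norm (1 - r * s * w))\<^sup>2"
    using Re_szego_kernel[of "r * s * w"] n rs1 rs by simp
  moreover have "2 * Re (1 / (1 - s * w)) = 1 + (1 - s\<^sup>2) / (norm (1 - s * w))\<^sup>2"
    using Re_szego_kernel[of "s * w"] n rs by simp
  ultimately show ?thesis by linarith
qed

text \<open>Expanding the kernel into its geometric series turns the double integral into a pairing of
  two coefficient sequences. The three cases needed later are \<open>\<sigma> = \<tau> = \<rho>\<close>, \<open>\<sigma> = \<rho>, \<tau> = 1\<close> and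
  \<open>\<sigma> = 1, \<tau> = \<rho>\<close>.\<close>

lemma integral_szego_kernel:
  fixes g \<sigma> \<tau> :: "complex \<Rightarrow> real" and k :: "complex \<Rightarrow> complex \<Rightarrow> complex"
  assumes [measurable]: "g \<in> borel_measurable circle" "\<sigma> \<in> borel_measurable circle" 
      "\<tau> \<in> borel_measurable circle"
    and g: "\<And>\<zeta>. norm \<zeta> = 1 \<Longrightarrow> \<bar>g \<zeta>\<bar> \<le> B"
    and \<sigma>\<tau>: "\<And>\<zeta>. 0 \<le> \<sigma> \<zeta>" "\<And>\<zeta>. \<sigma> \<zeta> \<le> 1" "\<And>\<zeta>. 0 \<le> \<tau> \<zeta>" "\<And>\<zeta>. \<tau> \<zeta> \<le> 1"
    and R: "\<And>\<zeta> \<eta>. \<sigma> \<zeta> * \<tau> \<eta> \<le> R" "R < 1"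
  defines "k \<equiv> \<lambda>\<zeta> \<eta>. 1 / (1 - complex_of_real (\<sigma> \<zeta> * \<tau> \<eta>) * (\<zeta> * cnj \<eta>))"
  shows "\<And>\<zeta>. norm \<zeta> = 1 \<Longrightarrow> integrable circle (\<lambda>\<eta>. g \<eta> * k \<zeta> \<eta>)"
    and "integrable circle (\<lambda>\<zeta>. g \<zeta> * (LINT \<eta>|circle. g \<eta> * k \<zeta> \<eta>))"
    and "(\<lambda>n. (LINT \<zeta>|circle. g \<zeta> * (\<sigma> \<zeta> * \<zeta>) ^ n) * (LINT \<eta>|circle. g \<eta> * (\<tau> \<eta> * cnj \<eta>) ^ n))
       sums (LINT \<zeta>|circle. g \<zeta> * (LINT \<eta>|circle. g \<eta> * k \<zeta> \<eta>))"
proof -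
  have R0: "0 \<le> R" using mult_nonneg_nonneg[OF \<sigma>\<tau>(1,3)] R(1) order_trans by blast
  have intg: "integrable circle (\<lambda>\<zeta>. \<bar>g \<zeta>\<bar>)"
    using g by (intro integrable_circle_bounded[of _ B]) auto
  let ?\<beta> = "\<lambda>n. LINT \<eta>|circle. g \<eta> * (\<tau> \<eta> * cnj \<eta>) ^ n"
  let ?w = "\<lambda>\<zeta> \<eta>. complex_of_real (\<sigma> \<zeta> * \<tau> \<eta>) * (\<zeta> * cnj \<eta>)"
  have w: "norm (?w \<zeta> \<eta>) \<le> R" if "norm \<zeta> = 1" "norm \<eta> = 1" for \<zeta> \<eta>
    using that \<sigma>\<tau> R by (simp add: norm_mult)
  have inner: "integrable circle (\<lambda>\<eta>. g \<eta> * k \<zeta> \<eta>)"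
    "(\<lambda>n. (\<sigma> \<zeta> * \<zeta>) ^ n * ?\<beta> n) sums (LINT \<eta>|circle. g \<eta> * k \<zeta> \<eta>)"
    if \<zeta>: "norm \<zeta> = 1" for \<zeta> :: complex
  proof -
    note * = sums_integral_geometric[where f = "\<lambda>n \<eta>. g \<eta> * ?w \<zeta> \<eta> ^ n" and G = "\<lambda>\<eta>. \<bar>g \<eta>\<bar>" and R = R
        and s = "\<lambda>\<eta>. g \<eta> * k \<zeta> \<eta>"]
    have 1: "norm (complex_of_real (g \<eta>) * ?w \<zeta> \<eta> ^ n) \<le> \<bar>g \<eta>\<bar> * R ^ n" if "norm \<eta> = 1" for \<eta> n
      unfolding norm_mult norm_power norm_of_real
      using w[OF \<zeta> that] by (intro mult_left_mono power_mono) (auto simp: norm_mult abs_mult)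
    have 2: "(\<lambda>n. g \<eta> * ?w \<zeta> \<eta> ^ n) sums (g \<eta> * k \<zeta> \<eta>)" if "norm \<eta> = 1" for \<eta>
      unfolding k_def using w[OF \<zeta> that] R(2) by (intro sums_mult geometric_sums) auto
    show "integrable circle (\<lambda>\<eta>. g \<eta> * k \<zeta> \<eta>)"
      by (rule *(1)) (use 1 2 R R0 intg in auto)
    have "(\<lambda>n. LINT \<eta>|circle. g \<eta> * ?w \<zeta> \<eta> ^ n) sums (LINT \<eta>|circle. g \<eta> * k \<zeta> \<eta>)"
      by (rule *(2)) (use 1 2 R R0 intg in auto)
    also have "(\<lambda>n. LINT \<eta>|circle. g \<eta> * ?w \<zeta> \<eta> ^ n) = (\<lambda>n. (\<sigma> \<zeta> * \<zeta>) ^ n * ?\<beta> n)"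
      by (subst integral_mult_right_zero[symmetric]) (simp add: power_mult_distrib mult_ac)
    finally show "(\<lambda>n. (\<sigma> \<zeta> * \<zeta>) ^ n * ?\<beta> n) sums (LINT \<eta>|circle. g \<eta> * k \<zeta> \<eta>)" .
  qed
  then show "\<And>\<zeta>. norm \<zeta> = 1 \<Longrightarrow> integrable circle (\<lambda>\<eta>. g \<eta> * k \<zeta> \<eta>)" by simp
  let ?I = "LINT \<eta>|circle. \<bar>g \<eta>\<bar>"
  have nb: "norm ((\<sigma> \<zeta> * \<zeta>) ^ n * ?\<beta> n) \<le> ?I * R ^ n" if \<zeta>: "norm \<zeta> = 1" for \<zeta> :: complex and n
  proof -
    have "(\<sigma> \<zeta> * \<zeta>) ^ n * ?\<beta> n = (LINT \<eta>|circle. g \<eta> * ?w \<zeta> \<eta> ^ n)"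
      by (subst integral_mult_right_zero[symmetric]) (simp add: power_mult_distrib mult_ac)
    also have "norm \<dots> \<le> (LINT \<eta>|circle. \<bar>g \<eta>\<bar> * R ^ n)"
    proof (rule order_trans[OF integral_norm_bound integral_mono])
      show "norm (complex_of_real (g \<eta>) * ?w \<zeta> \<eta> ^ n) \<le> \<bar>g \<eta>\<bar> * R ^ n" if "\<eta> \<in> space circle" for \<eta>
        unfolding norm_mult norm_power norm_of_real
        using w[OF \<zeta>, of \<eta>] that by (intro mult_left_mono power_mono) (auto simp: norm_mult abs_mult)
      have "norm (complex_of_real (g \<eta>) * ?w \<zeta> \<eta> ^ n) \<le> B * R ^ n" if "norm \<eta> = 1" for \<eta>
        unfolding norm_mult norm_power norm_of_real
        using w[OF \<zeta> that] g[OF that] R0 by (intro mult_mono power_mono) (auto simp: norm_mult abs_mult)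
      then show "integrable circle (\<lambda>\<eta>. norm (g \<eta> * ?w \<zeta> \<eta> ^ n))"
        by (intro integrable_norm integrable_circle_bounded[where B = "B * R ^ n"]) auto
    qed (use intg in auto)
    also have "\<dots> = ?I * R ^ n" by simp
    finally show ?thesis .
  qed
  note * = sums_integral_geometric[where f = "\<lambda>n \<zeta>. g \<zeta> * ((\<sigma> \<zeta> * \<zeta>) ^ n * ?\<beta> n)" and G = "\<lambda>\<zeta>. \<bar>g \<zeta>\<bar> * ?I" 
      and R = R and s = "\<lambda>\<zeta>. g \<zeta> * (LINT \<eta>|circle. g \<eta> * k \<zeta> \<eta>)"]
  have 1: "norm (complex_of_real (g \<zeta>) * ((\<sigma> \<zeta> * \<zeta>) ^ n * ?\<beta> n)) \<le> (\<bar>g \<zeta>\<bar> * ?I) * R ^ n" 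
    if "norm \<zeta> = 1" for \<zeta> :: complex and n
    unfolding norm_mult[of "complex_of_real _"] norm_of_real mult.assoc using nb[OF that]
    by (intro mult_left_mono) auto
  have 2: "(\<lambda>n. g \<zeta> * ((\<sigma> \<zeta> * \<zeta>) ^ n * ?\<beta> n)) sums (g \<zeta> * (LINT \<eta>|circle. g \<eta> * k \<zeta> \<eta>))" 
    if "norm \<zeta> = 1" for \<zeta> :: complex
    using inner(2)[OF that] by (rule sums_mult)
  show "integrable circle (\<lambda>\<zeta>. g \<zeta> * (LINT \<eta>|circle. g \<eta> * k \<zeta> \<eta>))"
    by (rule *(1)) (use 1 2 R R0 intg in auto)
  have "(\<lambda>n. LINT \<zeta>|circle. g \<zeta> * ((\<sigma> \<zeta> * \<zeta>) ^ n * ?\<beta> n)) sums 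
      (LINT \<zeta>|circle. g \<zeta> * (LINT \<eta>|circle. g \<eta> * k \<zeta> \<eta>))"
    by (rule *(2)) (use 1 2 R R0 intg in auto)
  then show "(\<lambda>n. (LINT \<zeta>|circle. g \<zeta> * (\<sigma> \<zeta> * \<zeta>) ^ n) * ?\<beta> n) sums 
      (LINT \<zeta>|circle. g \<zeta> * (LINT \<eta>|circle. g \<eta> * k \<zeta> \<eta>))"
    by (simp flip: mult.assoc)
qed


text \<open>The sequence \<open>b\<close> is, up to conjugation, the adjoint of \<open>a \<mapsto> F (\<rho> \<zeta> \<zeta>)\<close>, with \<open>F\<close> the power series of \<open>a\<close>, applied to \<open>g\<close>.
  The square norm of \<open>b\<close> is the double integral of \<open>g(\<zeta>) g(\<eta>)\<close> against the kernel at radius \<open>\<rho>(\<zeta>) \<rho>(\<eta>)\<close>. The real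
  part of this kernel is at most 8 times the sum of those of the kernels at the radii \<open>\<rho>(\<zeta>)\<close> and \<open>\<rho>(\<eta>)\<close>. As
  \<open>g \<ge> 0\<close>, this carries over to the double integrals, and the two on the right are, up to conjugation, the
  pairing of \<open>b\<close> with the Fourier coefficients \<open>c\<close> of \<open>g\<close>. Hence the square norm of \<open>b\<close>
  is at most a constant times the product of the norms of \<open>b\<close> and \<open>c\<close>, one factor of \<open>b\<close> cancels, and Bessel's
  inequality bounds \<open>c\<close>.\<close>

lemma adjoint_radial_bound:
  fixes g \<rho> :: "complex \<Rightarrow> real"
  assumes [measurable]: "g \<in> borel_measurable circle" "\<rho> \<in> borel_measurable circle" 
    and g: "\<And>\<zeta>. 0 \<le> g \<zeta>" "\<And>\<zeta>. norm \<zeta> = 1 \<Longrightarrow> g \<zeta> \<le> B"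
    and \<rho>: "\<And>\<zeta>. 0 \<le> \<rho> \<zeta>" "\<And>\<zeta>. \<rho> \<zeta> \<le> R" and R: "R < 1"
  defines "b \<equiv> \<lambda>n. LINT \<zeta>|circle. g \<zeta> * (\<rho> \<zeta> * \<zeta>) ^ n"
  shows "summable (\<lambda>n. (norm (b n))\<^sup>2)"
    and "(\<Sum>n. (norm (b n))\<^sup>2) \<le> 256 * (LINT \<zeta>|circle. (g \<zeta>)\<^sup>2)"
proof -
  define c where "c = fourier_coeff (\<lambda>\<zeta>. complex_of_real (g \<zeta>))"
  define k where "k r s \<zeta> \<eta> = 1 / (1 - complex_of_real (r * s) * (\<zeta> * cnj \<eta>))" for r s \<zeta> \<eta>
  have R0: "0 \<le> R" using \<rho> order_trans by blast
  have \<rho>1: "\<rho> \<zeta> < 1" for \<zeta> using \<rho>(2) R le_less_trans by blast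
  have gB: "\<bar>g \<zeta>\<bar> \<le> B" if "norm \<zeta> = 1" for \<zeta> using g(1) g(2)[OF that] by auto
  have \<rho>\<rho>: "\<rho> \<zeta> * \<rho> \<eta> \<le> R" for \<zeta> \<eta>
    using mult_mono[OF \<rho>(2)[of \<zeta>] less_imp_le[OF \<rho>1[of \<eta>]] R0 \<rho>(1)] by simp
  have b: "(LINT \<zeta>|circle. g \<zeta> * (\<rho> \<zeta> * \<zeta>) ^ n) = b n" for n
    by (simp add: b_def)
  have b': "(LINT \<zeta>|circle. g \<zeta> * (\<rho> \<zeta> * cnj \<zeta>) ^ n) = cnj (b n)" for n
    unfolding b_def by (subst Bochner_Integration.integral_cnj[symmetric]) simp
  have c: "(LINT \<zeta>|circle. g \<zeta> * (complex_of_real 1 * cnj \<zeta>) ^ n) = c n" for n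
    by (simp add: c_def fourier_coeff_def)
  have c': "(LINT \<zeta>|circle. g \<zeta> * (complex_of_real 1 * \<zeta>) ^ n) = cnj (c n)" for n
    unfolding c[symmetric] by (subst Bochner_Integration.integral_cnj[symmetric]) simp
  define I where "I \<sigma> \<tau> \<zeta> = (LINT \<eta>|circle. g \<eta> * k (\<sigma> \<zeta>) (\<tau> \<eta>) \<zeta> \<eta>)" for \<sigma> \<tau> \<zeta>
  note ker = integral_szego_kernel[of g _ _ B R, folded k_def, folded I_def]
  note k1 = ker[of \<rho> \<rho>] and k2 = ker[of \<rho> "\<lambda>_. 1"] and k3 = ker[of "\<lambda>_. 1" \<rho>]
  have m: "(\<lambda>_. 1 :: real) \<in> borel_measurable circle" by simp
  have [simp]: "g \<in> borel_measurable circle" "\<rho> \<in> borel_measurable circle" by fact+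
  note [simp] = gB \<rho> R \<rho>\<rho> less_imp_le[OF \<rho>1]
  have s1: "(\<lambda>n. b n * cnj (b n)) sums (LINT \<zeta>|circle. g \<zeta> * I \<rho> \<rho> \<zeta>)"
    using k1(3) by (simp add: b b')
  have s2: "(\<lambda>n. b n * c n) sums (LINT \<zeta>|circle. g \<zeta> * I \<rho> (\<lambda>_. 1) \<zeta>)"
    using k2(3) unfolding c by (simp add: b)
  have s3: "(\<lambda>n. cnj (c n) * cnj (b n)) sums (LINT \<zeta>|circle. g \<zeta> * I (\<lambda>_. 1) \<rho> \<zeta>)"
    using k3(3) unfolding c' b' by simp
  have ReI: "Re (LINT \<zeta>|circle. g \<zeta> * J \<zeta>) = (LINT \<zeta>|circle. g \<zeta> * Re (J \<zeta>))"
      "integrable circle (\<lambda>\<zeta>. g \<zeta> * Re (J \<zeta>))"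
    if "integrable circle (\<lambda>\<zeta>. g \<zeta> * J \<zeta>)" for J :: "complex \<Rightarrow> complex"
    using integral_Re[OF that] integrable_Re[OF that] by simp_all
  have int1: "integrable circle (\<lambda>\<zeta>. g \<zeta> * I \<rho> \<rho> \<zeta>)" by (rule k1(2)) simp_all
  have int2: "integrable circle (\<lambda>\<zeta>. g \<zeta> * I \<rho> (\<lambda>_. 1) \<zeta>)" by (rule k2(2)) simp_all
  have int3: "integrable circle (\<lambda>\<zeta>. g \<zeta> * I (\<lambda>_. 1) \<rho> \<zeta>)" by (rule k3(2)) simp_all
  have ker_le: "Re (k (\<rho> \<zeta>) (\<rho> \<eta>) \<zeta> \<eta>) \<le> 8 * (Re (k (\<rho> \<zeta>) 1 \<zeta> \<eta>) + Re (k 1 (\<rho> \<eta>) \<zeta> \<eta>))"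
    if "norm \<zeta> = 1" "norm \<eta> = 1" for \<zeta> \<eta>
  proof -
    have w: "norm (\<zeta> * cnj \<eta>) = 1" using that by (simp add: norm_mult)
    have pos: "0 \<le> Re (1 / (1 - r * (\<zeta> * cnj \<eta>)))" if "0 \<le> r" "r < 1" for r :: real
    proof -
      have "norm (r * (\<zeta> * cnj \<eta>)) = r" using w that by (simp add: norm_mult)
      moreover have "0 \<le> (1 - r\<^sup>2) / x\<^sup>2" for x
        using that by (simp add: power_le_one)
      ultimately show ?thesis using Re_szego_kernel[of "r * (\<zeta> * cnj \<eta>)"] that
        by (smt (verit))
    qed
    show ?thesis
    proof (cases "\<rho> \<eta> \<le> \<rho> \<zeta>")
      case True
      then show ?thesis using Re_szego_kernel_le[OF w \<rho>(1) True] pos[of "\<rho> \<zeta>"] \<rho>1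
        by (simp add: k_def)
    next
      case False
      then show ?thesis using Re_szego_kernel_le[OF w \<rho>(1), of \<zeta> "\<rho> \<eta>"] pos[of "\<rho> \<eta>"] \<rho>1
        by (simp add: k_def mult_ac)
    qed
  qed
  have I_le: "Re (I \<rho> \<rho> \<zeta>) \<le> 8 * (Re (I \<rho> (\<lambda>_. 1) \<zeta>) + Re (I (\<lambda>_. 1) \<rho> \<zeta>))"
    if \<zeta>: "norm \<zeta> = 1" for \<zeta> :: complex
  proof -
    have i: "integrable circle (\<lambda>\<eta>. g \<eta> * k (\<rho> \<zeta>) (\<rho> \<eta>) \<zeta> \<eta>)"
        "integrable circle (\<lambda>\<eta>. g \<eta> * k (\<rho> \<zeta>) 1 \<zeta> \<eta>)"
        "integrable circle (\<lambda>\<eta>. g \<eta> * k 1 (\<rho> \<eta>) \<zeta> \<eta>)"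
      using \<zeta> by (intro k1(1) k2(1) k3(1); simp)+
    have "(LINT \<eta>|circle. g \<eta> * Re (k (\<rho> \<zeta>) (\<rho> \<eta>) \<zeta> \<eta>)) \<le> 
        (LINT \<eta>|circle. 8 * (g \<eta> * Re (k (\<rho> \<zeta>) 1 \<zeta> \<eta>) + g \<eta> * Re (k 1 (\<rho> \<eta>) \<zeta> \<eta>)))"
    proof (rule integral_mono)
      fix \<eta> assume "\<eta> \<in> space circle"
      then show "g \<eta> * Re (k (\<rho> \<zeta>) (\<rho> \<eta>) \<zeta> \<eta>)
         \<le> 8 * (g \<eta> * Re (k (\<rho> \<zeta>) 1 \<zeta> \<eta>) + g \<eta> * Re (k 1 (\<rho> \<eta>) \<zeta> \<eta>))"
        using mult_left_mono[OF ker_le[OF \<zeta>, of \<eta>] g(1)[of \<eta>]] by (simp add: algebra_simps)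
    qed (use i in \<open>auto intro!: ReI(2)\<close>)
    then show ?thesis using i by (simp add: I_def ReI)
  qed
  have "Re (LINT \<zeta>|circle. g \<zeta> * I \<rho> \<rho> \<zeta>) \<le> 
     8 * (Re (LINT \<zeta>|circle. g \<zeta> * I \<rho> (\<lambda>_. 1) \<zeta>) + Re (LINT \<zeta>|circle. g \<zeta> * I (\<lambda>_. 1) \<rho> \<zeta>))"
  proof -
    have "(LINT \<zeta>|circle. g \<zeta> * Re (I \<rho> \<rho> \<zeta>)) \<le> 
      (LINT \<zeta>|circle. 8 * (g \<zeta> * Re (I \<rho> (\<lambda>_. 1) \<zeta>) + g \<zeta> * Re (I (\<lambda>_. 1) \<rho> \<zeta>)))"
    proof (rule integral_mono)
      fix \<zeta> assume "\<zeta> \<in> space circle"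
      then show "g \<zeta> * Re (I \<rho> \<rho> \<zeta>) \<le> 8 * (g \<zeta> * Re (I \<rho> (\<lambda>_. 1) \<zeta>) + g \<zeta> * Re (I (\<lambda>_. 1) \<rho> \<zeta>))"
        using mult_left_mono[OF I_le[of \<zeta>] g(1)[of \<zeta>]] by (simp add: algebra_simps)
    qed (use int1 int2 int3 in \<open>auto intro!: ReI(2)\<close>)
    then show ?thesis using int1 int2 int3 by (simp add: ReI)
  qed
  moreover have sb: "(\<lambda>n. (norm (b n))\<^sup>2) sums Re (LINT \<zeta>|circle. g \<zeta> * I \<rho> \<rho> \<zeta>)"
    using sums_Re[OF s1] by (simp flip: complex_norm_square of_real_power)
  ultimately have main: "Re (LINT \<zeta>|circle. g \<zeta> * I \<rho> \<rho> \<zeta>) \<le> 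
     (\<Sum>n. 8 * (Re (b n * c n) + Re (cnj (c n) * cnj (b n))))"
    and s23: "summable (\<lambda>n. 8 * (Re (b n * c n) + Re (cnj (c n) * cnj (b n))))"
    using sums_mult[OF sums_add[OF sums_Re[OF s2] sums_Re[OF s3]], of 8] by (simp_all add: sums_iff)
  have gsq: "square_integrable (\<lambda>\<zeta>. complex_of_real (g \<zeta>))"
    using gB by (intro square_integrable_bounded[where B = B] AE_I2) auto
  have sc: "summable (\<lambda>n. (norm (c n))\<^sup>2)" "(\<Sum>n. (norm (c n))\<^sup>2) \<le> (LINT \<zeta>|circle. (g \<zeta>)\<^sup>2)"
    using Bessel_summable[OF gsq] by (simp_all add: c_def)
  show sbs: "summable (\<lambda>n. (norm (b n))\<^sup>2)" using sb by (simp add: sums_iff)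
  \<comment> \<open>The weight 1/2 lets the sum of the squares of \<open>b\<close> be absorbed on the left.\<close>
  have "8 * (Re (b n * c n) + Re (cnj (c n) * cnj (b n))) \<le> (norm (b n))\<^sup>2 / 2 + 128 * (norm (c n))\<^sup>2" for n
  proof -
    have "8 * (Re (b n * c n) + Re (cnj (c n) * cnj (b n))) = 16 * Re (b n * c n)"
      by (simp add: mult.commute)
    also have "\<dots> \<le> 16 * (norm (b n) * norm (c n))"
      using complex_Re_le_cmod[of "b n * c n"] by (simp add: norm_mult)
    also have "\<dots> \<le> (norm (b n))\<^sup>2 / 2 + 128 * (norm (c n))\<^sup>2"
      using zero_le_power2[of "norm (b n) - 16 * norm (c n)"] by (simp add: power2_eq_square algebra_simps)
    finally show ?thesis .
  qed
  then have "(\<Sum>n. 8 * (Re (b n * c n) + Re (cnj (c n) * cnj (b n)))) \<le> 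
      (\<Sum>n. (norm (b n))\<^sup>2 / 2 + 128 * (norm (c n))\<^sup>2)"
    by (rule suminf_le[OF _ s23]) (use sbs sc in \<open>intro summable_add summable_mult summable_divide\<close>)
  also have "\<dots> = (\<Sum>n. (norm (b n))\<^sup>2) / 2 + 128 * (\<Sum>n. (norm (c n))\<^sup>2)"
    using sbs sc by (simp add: suminf_add[symmetric] suminf_divide suminf_mult summable_mult summable_divide)
  finally show "(\<Sum>n. (norm (b n))\<^sup>2) \<le> 256 * (LINT \<zeta>|circle. (g \<zeta>)\<^sup>2)"
    using main sc(2) sb by (simp add: sums_iff)
qed

definition power_series :: "(nat \<Rightarrow> complex) \<Rightarrow> complex \<Rightarrow> complex" where
  "power_series a z = (\<Sum>n. a n * z ^ n)"

lemma square_summable_bounded: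
  fixes a :: "nat \<Rightarrow> complex"
  assumes "summable (\<lambda>n. (norm (a n))\<^sup>2)"
  obtains A where "\<And>n. norm (a n) \<le> A"
proof
  fix n
  have "(norm (a n))\<^sup>2 = (\<Sum>k\<in>{n}. (norm (a k))\<^sup>2)" by simp
  also have "\<dots> \<le> (\<Sum>n. (norm (a n))\<^sup>2)" using assms by (intro sum_le_suminf) auto
  finally show "norm (a n) \<le> sqrt (\<Sum>n. (norm (a n))\<^sup>2)"
    by (simp add: real_le_rsqrt)
qed

lemma sums_power_series:
  assumes "\<And>n. norm (a n) \<le> A" "norm z < 1"
  shows "(\<lambda>n. a n * z ^ n) sums power_series a z"
  unfolding power_series_def
proof (rule summable_sums, rule summable_comparison_test')
  show "summable (\<lambda>n. A * norm z ^ n)" using assms by (intro summable_mult summable_geometric) auto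
  show "norm (a n * z ^ n) \<le> A * norm z ^ n" for n
    using assms by (auto simp: norm_mult norm_power intro!: mult_right_mono)
qed

lemma norm_power_series_le:
  assumes a: "\<And>n. norm (a n) \<le> A" and z: "norm z \<le> R" "R < 1"
  shows "norm (power_series a z) \<le> A / (1 - R)"
proof -
  have R: "0 \<le> R" using z norm_ge_zero order_trans by blast
  have A: "0 \<le> A" using a norm_ge_zero order_trans by blast
  have g: "(\<lambda>n. A * R ^ n) sums (A * (1 / (1 - R)))" using R z by (intro sums_mult geometric_sums) auto
  have "norm (power_series a z) \<le> (\<Sum>n. A * R ^ n)"
    unfolding power_series_def
    by (rule norm_suminf_le) 
       (use g a z R A in \<open>auto simp: sums_iff norm_mult norm_power intro!: mult_mono power_mono\<close>)
  then show ?thesis using g by (simp add: sums_iff)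
qed

lemma holomorphic_on_power_series:
  assumes a: "\<And>n. norm (a n) \<le> A"
  shows "power_series a holomorphic_on ball 0 1"
  by (rule power_series_holomorphic[where a = a]) (use sums_power_series[OF a] in auto)

lemma measurable_power_series [measurable]: "power_series a \<in> borel_measurable borel"
  unfolding power_series_def[abs_def] by measurable

text \<open>Used with \<open>w \<zeta> = r \<zeta>\<close>, with a radius that varies with \<open>\<zeta>\<close>, and with \<open>w \<zeta> = cnj w \<zeta>\<close> for the Cauchy kernel.\<close>

lemma sums_integral_power_series:
  assumes a: "\<And>n. norm (a n) \<le> A" and h: "integrable circle h"
    and [measurable]: "w \<in> borel_measurable circle" 
    and w: "\<And>\<zeta>. norm \<zeta> = 1 \<Longrightarrow> norm (w \<zeta>) \<le> R" and R: "0 \<le> R" "R < 1"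
  shows "integrable circle (\<lambda>\<zeta>. h \<zeta> * power_series a (w \<zeta>))"
    and "(\<lambda>n. a n * (LINT \<zeta>|circle. h \<zeta> * w \<zeta> ^ n)) sums (LINT \<zeta>|circle. h \<zeta> * power_series a (w \<zeta>))"
proof -
  have [measurable]: "h \<in> borel_measurable circle" using h by auto
  note * = sums_integral_geometric[where f = "\<lambda>n \<zeta>. a n * (h \<zeta> * w \<zeta> ^ n)" and R = R
     and G = "\<lambda>\<zeta>. A * norm (h \<zeta>)" and s = "\<lambda>\<zeta>. h \<zeta> * power_series a (w \<zeta>)"]
  have A: "0 \<le> A" using a norm_ge_zero order_trans by blast
  have 1: "norm (a n * (h \<zeta> * w \<zeta> ^ n)) \<le> A * norm (h \<zeta>) * R ^ n" if "norm \<zeta> = 1" for n \<zeta>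
    unfolding norm_mult norm_power mult.assoc[symmetric]
    using a w[OF that] A by (intro mult_mono power_mono) auto
  have 2: "(\<lambda>n. a n * (h \<zeta> * w \<zeta> ^ n)) sums (h \<zeta> * power_series a (w \<zeta>))" if "norm \<zeta> = 1" for \<zeta>
  proof -
    have "norm (w \<zeta>) < 1" using w[OF that] R by simp
    then have "(\<lambda>n. h \<zeta> * (a n * w \<zeta> ^ n)) sums (h \<zeta> * power_series a (w \<zeta>))"
      by (intro sums_mult sums_power_series[where A = A] a)
    then show ?thesis by (simp add: mult.left_commute)
  qed
  show "integrable circle (\<lambda>\<zeta>. h \<zeta> * power_series a (w \<zeta>))"
    by (rule *(1)) (use 1 2 R h in auto)
  have "(\<lambda>n. LINT \<zeta>|circle. a n * (h \<zeta> * w \<zeta> ^ n)) sums (LINT \<zeta>|circle. h \<zeta> * power_series a (w \<zeta>))"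
    by (rule *(2)) (use 1 2 R h in auto)
  then show "(\<lambda>n. a n * (LINT \<zeta>|circle. h \<zeta> * w \<zeta> ^ n)) sums (LINT \<zeta>|circle. h \<zeta> * power_series a (w \<zeta>))"
    by simp
qed

text \<open>Splits \<open>\<bar>z\<bar>\<^sup>2\<close> into pairings of \<open>z\<close> with four nonnegative numbers, as the adjoint bound is for nonnegative functions.\<close>

lemma mult_cnj_eq_parts: "z * cnj z = z * max 0 (Re z) - z * max 0 (- Re z) - \<i> * (z * max 0 (Im z)) + \<i> * (z * max 0 (- Im z))"
proof -
  have "cnj z = complex_of_real (max 0 (Re z) - max 0 (- Re z)) - \<i> * complex_of_real (max 0 (Im z) - max 0 (- Im z))"
    by (simp add: complex_eq_iff max_def)
  then have "z * cnj z = z * (complex_of_real (max 0 (Re z) - max 0 (- Re z)) - \<i> * complex_of_real (max 0 (Im z) - max 0 (- Im z)))"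
    by (rule arg_cong)
  then show ?thesis by (simp add: algebra_simps)
qed

text \<open>Dual form of the preceding adjoint bound: the integral is the pairing of \<open>f(\<zeta>) = F (\<rho> \<zeta> \<zeta>)\<close>
  with itself, and each of the four nonnegative parts of the second factor is handled by that bound. The
  constant does not depend on \<open>\<rho>\<close> or \<open>R\<close>, so \<open>\<rho> \<zeta>\<close> may be chosen as a radius where \<open>\<bar>F\<bar>\<close> is nearly maximal.\<close>

lemma linearized_maximal_inequality:
  fixes \<rho> :: "complex \<Rightarrow> real"
  assumes S: "summable (\<lambda>n. (norm (a n))\<^sup>2)"
    and [measurable]: "\<rho> \<in> borel_measurable circle" 
    and \<rho>: "\<And>\<zeta>. 0 \<le> \<rho> \<zeta>" "\<And>\<zeta>. \<rho> \<zeta> \<le> R" and R: "R < 1"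
  shows "(LINT \<zeta>|circle. (norm (power_series a (complex_of_real (\<rho> \<zeta>) * \<zeta>)))\<^sup>2) \<le> 1024 * (\<Sum>n. (norm (a n))\<^sup>2)"
proof -
  obtain A where A: "\<And>n. norm (a n) \<le> A" using square_summable_bounded[OF S] by blast
  have R0: "0 \<le> R" using \<rho> order_trans by blast
  define f where "f \<zeta> = power_series a (complex_of_real (\<rho> \<zeta>) * \<zeta>)" for \<zeta>
  have \<rho>n: "norm (complex_of_real (\<rho> \<zeta>) * \<zeta>) \<le> R" if "norm \<zeta> = 1" for \<zeta>
    using \<rho> that by (simp add: norm_mult)
  have fm [measurable]: "f \<in> borel_measurable circle" unfolding f_def[abs_def] by measurable
  have fB: "norm (f \<zeta>) \<le> A / (1 - R)" if "norm \<zeta> = 1" for \<zeta>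
    unfolding f_def using A \<rho>n[OF that] R by (rule norm_power_series_le)
  have A0: "0 \<le> A" using A norm_ge_zero order_trans by blast
  let ?S = "\<Sum>n. (norm (a n))\<^sup>2"
  define X where "X = (LINT \<zeta>|circle. (norm (f \<zeta>))\<^sup>2)"
  have part: "norm (LINT \<zeta>|circle. f \<zeta> * complex_of_real (g \<zeta>)) \<le> 128 * ?S + (LINT \<zeta>|circle. (g \<zeta>)\<^sup>2) / 2"
    if [measurable]: "g \<in> borel_measurable circle" and g: "\<And>\<zeta>. 0 \<le> g \<zeta>" "\<And>\<zeta>. g \<zeta> \<le> norm (f \<zeta>)" for g
  proof -
    have gB: "g \<zeta> \<le> A / (1 - R)" if "norm \<zeta> = 1" for \<zeta> using g(2) fB[OF that] order_trans by blast
    define b where "b n = (LINT \<zeta>|circle. g \<zeta> * (\<rho> \<zeta> * \<zeta>) ^ n)" for n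
    have b: "summable (\<lambda>n. (norm (b n))\<^sup>2)" "(\<Sum>n. (norm (b n))\<^sup>2) \<le> 256 * (LINT \<zeta>|circle. (g \<zeta>)\<^sup>2)"
      unfolding b_def by (rule adjoint_radial_bound[of g \<rho> "A / (1 - R)" R]; use g gB \<rho> R in simp)+
    have gi: "integrable circle (\<lambda>\<zeta>. complex_of_real (g \<zeta>))"
      using g gB by (intro integrable_circle_bounded[where B = "A / (1 - R)"]) auto
    have "(\<lambda>n. a n * b n) sums (LINT \<zeta>|circle. g \<zeta> * f \<zeta>)"
      unfolding b_def f_def by (rule sums_integral_power_series[OF A gi]) (use \<rho>n R R0 in auto)
    then have eq: "(LINT \<zeta>|circle. f \<zeta> * complex_of_real (g \<zeta>)) = (\<Sum>n. a n * b n)" by (simp add: sums_iff mult.commute)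
    have le: "norm (a n * b n) \<le> 128 * (norm (a n))\<^sup>2 + (norm (b n))\<^sup>2 / 512" for n
    proof -
      \<comment> \<open>The weight of \<open>b\<close> is chosen so that, after the adjoint bound, the four parts contribute half of \<open>X\<close> in total.\<close>
      have "0 \<le> (256 * norm (a n) - norm (b n))\<^sup>2 / 512" by simp
      also have "\<dots> = 128 * (norm (a n))\<^sup>2 + (norm (b n))\<^sup>2 / 512 - norm (a n * b n)"
        by (simp add: power2_eq_square algebra_simps norm_mult add_divide_distrib diff_divide_distrib)
      finally show ?thesis by simp
    qed
    have "norm (\<Sum>n. a n * b n) \<le> (\<Sum>n. 128 * (norm (a n))\<^sup>2 + (norm (b n))\<^sup>2 / 512)"
      by (rule norm_suminf_le) (use S b le in \<open>auto intro!: summable_add summable_mult summable_divide\<close>)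
    also have "\<dots> = 128 * ?S + (\<Sum>n. (norm (b n))\<^sup>2) / 512"
      using S b by (simp add: suminf_add[symmetric] suminf_divide suminf_mult summable_mult summable_divide)
    also have "\<dots> \<le> 128 * ?S + (256 * (LINT \<zeta>|circle. (g \<zeta>)\<^sup>2)) / 512"
      using b by (intro add_left_mono divide_right_mono) auto
    finally show ?thesis by (simp add: eq)
  qed
  define g1 g2 g3 g4 where "g1 \<zeta> = max 0 (Re (f \<zeta>))" "g2 \<zeta> = max 0 (- Re (f \<zeta>))" 
     "g3 \<zeta> = max 0 (Im (f \<zeta>))" "g4 \<zeta> = max 0 (- Im (f \<zeta>))" for \<zeta>
  note g_defs = g1_g2_g3_g4_def
  have gm [measurable]: "g1 \<in> borel_measurable circle" "g2 \<in> borel_measurable circle"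
       "g3 \<in> borel_measurable circle" "g4 \<in> borel_measurable circle"
    unfolding g_defs[abs_def] by measurable
  have g0: "0 \<le> g1 \<zeta>" "0 \<le> g2 \<zeta>" "0 \<le> g3 \<zeta>" "0 \<le> g4 \<zeta>" for \<zeta> by (auto simp: g_defs)
  have gf: "g1 \<zeta> \<le> norm (f \<zeta>)" "g2 \<zeta> \<le> norm (f \<zeta>)" "g3 \<zeta> \<le> norm (f \<zeta>)" "g4 \<zeta> \<le> norm (f \<zeta>)" for \<zeta>
    using abs_Re_le_cmod[of "f \<zeta>"] abs_Im_le_cmod[of "f \<zeta>"] by (auto simp: g_defs)
  have sum4: "p1 + p2 + p3 + p4 \<le> 512 * t + (q1 + q2 + q3 + q4) / 2"
    if "p1 \<le> 128 * t + q1 / 2" "p2 \<le> 128 * t + q2 / 2" "p3 \<le> 128 * t + q3 / 2" "p4 \<le> 128 * t + q4 / 2"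
    for p1 p2 p3 p4 q1 q2 q3 q4 t :: real
    using that by (simp add: field_simps)
  have int: "integrable circle (\<lambda>\<zeta>. f \<zeta> * complex_of_real (h \<zeta>))" "integrable circle (\<lambda>\<zeta>. (h \<zeta>)\<^sup>2)"
    if [measurable]: "h \<in> borel_measurable circle" and "\<And>\<zeta>. 0 \<le> h \<zeta>" "\<And>\<zeta>. h \<zeta> \<le> norm (f \<zeta>)" for h
  proof -
    define K where "K = A / (1 - R)"
    have fK: "norm (f \<zeta>) \<le> K" if "norm \<zeta> = 1" for \<zeta> using fB[OF that] by (simp add: K_def)
    have hB: "h \<zeta> \<le> K" if "norm \<zeta> = 1" for \<zeta>
      using \<open>\<And>\<zeta>. h \<zeta> \<le> norm (f \<zeta>)\<close> fK[OF that] order_trans by blast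
    have "norm (f \<zeta> * complex_of_real (h \<zeta>)) \<le> K * K" if "norm \<zeta> = 1" for \<zeta>
      unfolding norm_mult norm_of_real using fK[OF that] hB[OF that] \<open>\<And>\<zeta>. 0 \<le> h \<zeta>\<close>[of \<zeta>]
      by (intro mult_mono) (auto intro: order_trans[OF norm_ge_zero fK[OF that]])
    then show "integrable circle (\<lambda>\<zeta>. f \<zeta> * complex_of_real (h \<zeta>))"
      by (intro integrable_circle_bounded[where B = "K * K"]) auto
    show "integrable circle (\<lambda>\<zeta>. (h \<zeta>)\<^sup>2)"
      using hB that by (intro integrable_circle_bounded[where B = "K\<^sup>2"]) (auto intro!: power_mono)
  qed
  note i = int[OF gm(1) g0(1) gf(1)] int[OF gm(2) g0(2) gf(2)] int[OF gm(3) g0(3) gf(3)] int[OF gm(4) g0(4) gf(4)]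
  have "complex_of_real X = (LINT \<zeta>|circle. complex_of_real ((norm (f \<zeta>))\<^sup>2))"
    unfolding X_def by (rule integral_complex_of_real[symmetric])
  also have "\<dots> = (LINT \<zeta>|circle. f \<zeta> * g1 \<zeta> - f \<zeta> * g2 \<zeta> - \<i> * (f \<zeta> * g3 \<zeta>) + \<i> * (f \<zeta> * g4 \<zeta>))"
    unfolding complex_norm_square mult_cnj_eq_parts by (simp add: g_defs)
  also have "\<dots> = (LINT \<zeta>|circle. f \<zeta> * g1 \<zeta>) - (LINT \<zeta>|circle. f \<zeta> * g2 \<zeta>) 
      - \<i> * (LINT \<zeta>|circle. f \<zeta> * g3 \<zeta>) + \<i> * (LINT \<zeta>|circle. f \<zeta> * g4 \<zeta>)"
    using i by simp
  finally have "\<bar>X\<bar> = norm ((LINT \<zeta>|circle. f \<zeta> * g1 \<zeta>) - (LINT \<zeta>|circle. f \<zeta> * g2 \<zeta>) 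
      - \<i> * (LINT \<zeta>|circle. f \<zeta> * g3 \<zeta>) + \<i> * (LINT \<zeta>|circle. f \<zeta> * g4 \<zeta>))"
    by (metis norm_of_real)
  also have "\<dots> \<le> norm (LINT \<zeta>|circle. f \<zeta> * g1 \<zeta>) + norm (LINT \<zeta>|circle. f \<zeta> * g2 \<zeta>) 
      + norm (LINT \<zeta>|circle. f \<zeta> * g3 \<zeta>) + norm (LINT \<zeta>|circle. f \<zeta> * g4 \<zeta>)"
  proof -
    have "norm (p - q - \<i> * r + \<i> * s) \<le> norm p + norm q + norm r + norm s" for p q r s :: complex
      using norm_triangle_ineq[of "p - q - \<i> * r" "\<i> * s"] norm_triangle_ineq4[of "p - q" "\<i> * r"]
        norm_triangle_ineq4[of p q] by (simp add: norm_mult)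
    then show ?thesis by blast
  qed
  also have "\<dots> \<le> 512 * ?S + ((LINT \<zeta>|circle. (g1 \<zeta>)\<^sup>2) + (LINT \<zeta>|circle. (g2 \<zeta>)\<^sup>2) 
      + (LINT \<zeta>|circle. (g3 \<zeta>)\<^sup>2) + (LINT \<zeta>|circle. (g4 \<zeta>)\<^sup>2)) / 2"
    by (intro sum4 part gm g0 gf)
  also have "(LINT \<zeta>|circle. (g1 \<zeta>)\<^sup>2) + (LINT \<zeta>|circle. (g2 \<zeta>)\<^sup>2) 
      + (LINT \<zeta>|circle. (g3 \<zeta>)\<^sup>2) + (LINT \<zeta>|circle. (g4 \<zeta>)\<^sup>2) = 
      (LINT \<zeta>|circle. (g1 \<zeta>)\<^sup>2 + (g2 \<zeta>)\<^sup>2 + (g3 \<zeta>)\<^sup>2 + (g4 \<zeta>)\<^sup>2)"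
    using i by simp
  also have "\<dots> = X"
  proof -
    have m: "(max 0 x)\<^sup>2 + (max 0 (-x))\<^sup>2 = x\<^sup>2" for x :: real by (simp add: max_def)
    have "(g1 \<zeta>)\<^sup>2 + (g2 \<zeta>)\<^sup>2 + (g3 \<zeta>)\<^sup>2 + (g4 \<zeta>)\<^sup>2 = (norm (f \<zeta>))\<^sup>2" for \<zeta>
      using m[of "Re (f \<zeta>)"] m[of "Im (f \<zeta>)"] by (simp add: g_defs cmod_power2)
    then show ?thesis by (simp add: X_def)
  qed
  finally show ?thesis by (simp add: X_def f_def)
qed

lemma continuous_le_if_rational_le:
  fixes h :: "real \<Rightarrow> real"
  assumes h: "continuous_on {0..<1} h" and le: "\<And>q. q \<in> \<rat> \<Longrightarrow> 0 \<le> q \<Longrightarrow> q < 1 \<Longrightarrow> h q \<le> c"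
    and r: "0 \<le> r" "r < 1"
  shows "h r \<le> c"
proof (rule ccontr)
  assume "\<not> h r \<le> c"
  then obtain d where d: "d > 0" "\<And>x. x \<in> {0..<1} \<Longrightarrow> dist x r < d \<Longrightarrow> dist (h x) (h r) < h r - c"
    using h r unfolding continuous_on_iff by (metis atLeastLessThan_iff diff_gt_0_iff_gt not_le)
  obtain q where q: "q \<in> \<rat>" "r < q" "q < min (r + d) 1"
    using Rats_dense_in_real[of r "min (r + d) 1"] d r by auto
  then have "dist (h q) (h r) < h r - c" using r by (intro d) (auto simp: dist_real_def)
  moreover have "h q \<le> c" using q r by (intro le) auto
  ultimately show False by (auto simp: dist_real_def)
qed

definition unit_rational :: "nat \<Rightarrow> real" where
  "unit_rational = from_nat_into (\<rat> \<inter> {0..<1})"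

lemma range_unit_rational: "range unit_rational = \<rat> \<inter> {0..<1}"
  unfolding unit_rational_def
proof (rule range_from_nat_into)
  have "(0::real) \<in> \<rat> \<inter> {0..<1}" by simp
  then show "\<rat> \<inter> {0..<1::real} \<noteq> {}" by blast
qed (rule countable_Int1[OF countable_rat])

lemma unit_rational: "0 \<le> unit_rational i" "unit_rational i < 1"
proof -
  have "unit_rational i \<in> \<rat> \<inter> {0..<1}" unfolding range_unit_rational[symmetric] by (rule rangeI)
  then show "0 \<le> unit_rational i" "unit_rational i < 1" by simp_all
qed

text \<open>Restricting to countably many radii makes the supremum measurable; by continuity it
  dominates all radii.\<close>

definition radial_maximal :: "(nat \<Rightarrow> complex) \<Rightarrow> complex \<Rightarrow> ennreal" where
  "radial_maximal a \<zeta> = (SUP i. ennreal ((norm (power_series a (complex_of_real (unit_rational i) * \<zeta>)))\<^sup>2))"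

lemma measurable_radial_maximal [measurable]: "radial_maximal a \<in> borel_measurable circle"
  unfolding radial_maximal_def[abs_def] by measurable

lemma radial_maximal_upper:
  assumes S: "summable (\<lambda>n. (norm (a n))\<^sup>2)" and r: "0 \<le> r" "r < 1" and \<zeta>: "norm \<zeta> = 1"
  shows "ennreal ((norm (power_series a (complex_of_real r * \<zeta>)))\<^sup>2) \<le> radial_maximal a \<zeta>"
proof (cases "radial_maximal a \<zeta>")
  case (real c)
  obtain A where A: "\<And>n. norm (a n) \<le> A" using square_summable_bounded[OF S] by blast
  have "continuous_on {0..<1} (\<lambda>r. (norm (power_series a (complex_of_real r * \<zeta>)))\<^sup>2)"
  proof (intro continuous_on_power continuous_on_norm)
    have "continuous_on (ball 0 1) (power_series a)"
      by (rule holomorphic_on_imp_continuous_on[OF holomorphic_on_power_series[OF A]])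
    then show "continuous_on {0..<1} (\<lambda>r. power_series a (complex_of_real r * \<zeta>))"
    proof (rule continuous_on_compose2)
      show "continuous_on {0..<1} (\<lambda>r. complex_of_real r * \<zeta>)" by (intro continuous_intros)
      show "(\<lambda>r. complex_of_real r * \<zeta>) ` {0..<1} \<subseteq> ball 0 1" using \<zeta> by (auto simp: norm_mult)
    qed
  qed
  moreover have "(norm (power_series a (complex_of_real q * \<zeta>)))\<^sup>2 \<le> c" if q: "q \<in> \<rat>" "0 \<le> q" "q < 1" for q
  proof -
    have "q \<in> range unit_rational" using q by (simp add: range_unit_rational)
    then obtain i where "q = unit_rational i" by blast
    then have "ennreal ((norm (power_series a (complex_of_real q * \<zeta>)))\<^sup>2) \<le> radial_maximal a \<zeta>"
      unfolding radial_maximal_def by (simp only:) (rule SUP_upper, simp)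
    then show ?thesis using real by simp
  qed
  ultimately have "(norm (power_series a (complex_of_real r * \<zeta>)))\<^sup>2 \<le> c"
    by (rule continuous_le_if_rational_le[where h = "\<lambda>r. (norm (power_series a (complex_of_real r * \<zeta>)))\<^sup>2"])
       (use r in auto)
  then show ?thesis using real by (simp add: ennreal_leI)
qed simp

text \<open>For finitely many radii a measurable choice \<open>\<rho>\<close> attains the maximum, so the linearized
  inequality applies; monotone convergence passes to all of them.\<close>

theorem radial_maximal_inequality:
  assumes S: "summable (\<lambda>n. (norm (a n))\<^sup>2)"
  shows "(\<integral>\<^sup>+\<zeta>. radial_maximal a \<zeta> \<partial>circle) \<le> ennreal (1024 * (\<Sum>n. (norm (a n))\<^sup>2))"
proof -
  let ?h = "\<lambda>r \<zeta>. norm (power_series a (complex_of_real r * \<zeta>))"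
  have ex: "\<exists>\<rho> R. \<rho> \<in> borel_measurable circle \<and> R < 1 \<and> (\<forall>\<zeta>. 0 \<le> \<rho> \<zeta> \<and> \<rho> \<zeta> \<le> R) \<and> 
      (\<forall>i<Suc m. \<forall>\<zeta>. ?h (unit_rational i) \<zeta> \<le> ?h (\<rho> \<zeta>) \<zeta>)" for m
  proof (induction m)
    case 0
    show ?case by (rule exI[of _ "\<lambda>_. unit_rational 0"], rule exI[of _ "unit_rational 0"]) (auto simp: unit_rational)
  next
    case (Suc m)
    then obtain \<rho> R where *: "\<rho> \<in> borel_measurable circle" "R < 1" "\<And>\<zeta>. 0 \<le> \<rho> \<zeta>" "\<And>\<zeta>. \<rho> \<zeta> \<le> R"
      "\<And>i \<zeta>. i < Suc m \<Longrightarrow> ?h (unit_rational i) \<zeta> \<le> ?h (\<rho> \<zeta>) \<zeta>" by blast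
    let ?\<rho> = "\<lambda>\<zeta>. if ?h (unit_rational (Suc m)) \<zeta> \<le> ?h (\<rho> \<zeta>) \<zeta> then \<rho> \<zeta> else unit_rational (Suc m)"
    note [measurable] = *(1)
    show ?case
    proof (intro exI conjI allI impI)
      show "?\<rho> \<in> borel_measurable circle" by measurable
      show "max R (unit_rational (Suc m)) < 1" using * unit_rational by simp
      show "0 \<le> ?\<rho> \<zeta>" "?\<rho> \<zeta> \<le> max R (unit_rational (Suc m))" for \<zeta>
        using *(3,4)[of \<zeta>] unit_rational[of "Suc m"] by auto
      show "?h (unit_rational i) \<zeta> \<le> ?h (?\<rho> \<zeta>) \<zeta>" if "i < Suc (Suc m)" for i \<zeta>
        using *(5)[of i \<zeta>] that by (cases "i = Suc m") (auto simp: less_Suc_eq)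
    qed
  qed
  define H where "H m \<zeta> = (SUP i\<in>{..<Suc m}. ennreal ((?h (unit_rational i) \<zeta>)\<^sup>2))" for m \<zeta>
  have [measurable]: "H m \<in> borel_measurable circle" for m
    unfolding H_def[abs_def] by measurable
  have "(\<integral>\<^sup>+\<zeta>. radial_maximal a \<zeta> \<partial>circle) = (\<integral>\<^sup>+\<zeta>. (SUP m. H m \<zeta>) \<partial>circle)"
  proof (rule nn_integral_cong)
    fix \<zeta>
    have "(SUP i\<in>(\<Union>m. {..<Suc m}). ennreal ((?h (unit_rational i) \<zeta>)\<^sup>2)) = (SUP m. H m \<zeta>)"
      unfolding H_def by (rule SUP_UNION)
    moreover have "(\<Union>m. {..<Suc m}) = UNIV" by auto
    ultimately show "radial_maximal a \<zeta> = (SUP m. H m \<zeta>)"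
      by (simp add: radial_maximal_def)
  qed
  also have "\<dots> = (SUP m. \<integral>\<^sup>+\<zeta>. H m \<zeta> \<partial>circle)"
  proof (rule nn_integral_monotone_convergence_SUP)
    show "incseq H"
      unfolding incseq_def le_fun_def H_def by (intro allI impI SUP_subset_mono) auto
  qed measurable
  also have "\<dots> \<le> ennreal (1024 * (\<Sum>n. (norm (a n))\<^sup>2))"
  proof (rule SUP_least)
    fix m
    obtain \<rho> R where *: "\<rho> \<in> borel_measurable circle" "R < 1" "\<And>\<zeta>. 0 \<le> \<rho> \<zeta>" "\<And>\<zeta>. \<rho> \<zeta> \<le> R"
      "\<And>i \<zeta>. i < Suc m \<Longrightarrow> ?h (unit_rational i) \<zeta> \<le> ?h (\<rho> \<zeta>) \<zeta>" using ex[of m] by blast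
    note [measurable] = *(1)
    obtain A where A: "\<And>n. norm (a n) \<le> A" using square_summable_bounded[OF S] by blast
    have "integrable circle (\<lambda>\<zeta>. (?h (\<rho> \<zeta>) \<zeta>)\<^sup>2)"
    proof (rule integrable_circle_bounded)
      fix \<zeta> :: complex assume "norm \<zeta> = 1"
      then have "?h (\<rho> \<zeta>) \<zeta> \<le> A / (1 - R)"
        using * by (intro norm_power_series_le A) (auto simp: norm_mult)
      then show "norm ((?h (\<rho> \<zeta>) \<zeta>)\<^sup>2) \<le> (A / (1 - R))\<^sup>2" by (simp add: power_mono del: power_divide)
    qed measurable
    then have "(\<integral>\<^sup>+\<zeta>. ennreal ((?h (\<rho> \<zeta>) \<zeta>)\<^sup>2) \<partial>circle) = ennreal (LINT \<zeta>|circle. (?h (\<rho> \<zeta>) \<zeta>)\<^sup>2)"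
      by (intro nn_integral_eq_integral) auto
    also have "\<dots> \<le> ennreal (1024 * (\<Sum>n. (norm (a n))\<^sup>2))"
      by (intro ennreal_leI linearized_maximal_inequality[OF S *(1,3,4,2)])
    finally have "(\<integral>\<^sup>+\<zeta>. ennreal ((?h (\<rho> \<zeta>) \<zeta>)\<^sup>2) \<partial>circle) \<le> ennreal (1024 * (\<Sum>n. (norm (a n))\<^sup>2))" .
    moreover have "(\<integral>\<^sup>+\<zeta>. H m \<zeta> \<partial>circle) \<le> (\<integral>\<^sup>+\<zeta>. ennreal ((?h (\<rho> \<zeta>) \<zeta>)\<^sup>2) \<partial>circle)"
      unfolding H_def using *(5) by (intro nn_integral_mono SUP_least ennreal_leI power_mono) auto
    ultimately show "(\<integral>\<^sup>+\<zeta>. H m \<zeta> \<partial>circle) \<le> ennreal (1024 * (\<Sum>n. (norm (a n))\<^sup>2))" by (rule order_trans[rotated])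
  qed
  finally show ?thesis .
qed

section \<open>Radial limits and weak convergence\<close>

text \<open>Splitting off a partial sum does not change the oscillation at the boundary, so this oscillation
  is controlled by the maximal function of every tail. The integrals of these maximal functions tend to zero,
  hence the oscillation vanishes almost everywhere and the radial values are Cauchy.\<close>

lemma radial_limit_power_series:
  assumes S: "summable (\<lambda>n. (norm (a n))\<^sup>2)"
  shows "AE \<zeta> in circle. \<exists>l. ((\<lambda>r. power_series a (complex_of_real r * \<zeta>)) \<longlongrightarrow> l) (at_left 1)"
proof -
  define tail where "tail N n = (if n < N then 0 else a n)" for N n
  have tail_sums: "(\<lambda>n. (norm (tail N n))\<^sup>2) sums ((\<Sum>n. (norm (a n))\<^sup>2) - (\<Sum>n<N. (norm (a n))\<^sup>2))" for N
  proof -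
    have "(\<lambda>n. (norm (a n))\<^sup>2 - (if n \<in> {..<N} then (norm (a n))\<^sup>2 else 0)) sums
        ((\<Sum>n. (norm (a n))\<^sup>2) - (\<Sum>n<N. (norm (a n))\<^sup>2))"
      by (intro sums_diff summable_sums[OF S] sums_If_finite_set) simp
    also have "(\<lambda>n. (norm (a n))\<^sup>2 - (if n \<in> {..<N} then (norm (a n))\<^sup>2 else 0)) = (\<lambda>n. (norm (tail N n))\<^sup>2)"
      by (auto simp: tail_def)
    finally show ?thesis .
  qed
  have tail_S: "summable (\<lambda>n. (norm (tail N n))\<^sup>2)" for N using tail_sums by (simp add: sums_iff)
  define m where "m \<zeta> = (INF N. radial_maximal (tail N) \<zeta>)" for \<zeta>
  have [measurable]: "m \<in> borel_measurable circle" unfolding m_def[abs_def] by measurable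
  have le: "(\<integral>\<^sup>+\<zeta>. m \<zeta> \<partial>circle) \<le> ennreal (1024 * ((\<Sum>n. (norm (a n))\<^sup>2) - (\<Sum>n<N. (norm (a n))\<^sup>2)))" for N
  proof -
    have "(\<integral>\<^sup>+\<zeta>. m \<zeta> \<partial>circle) \<le> (\<integral>\<^sup>+\<zeta>. radial_maximal (tail N) \<zeta> \<partial>circle)"
      unfolding m_def by (intro nn_integral_mono INF_lower) auto
    also have "\<dots> \<le> ennreal (1024 * (\<Sum>n. (norm (tail N n))\<^sup>2))"
      by (rule radial_maximal_inequality[OF tail_S])
    finally show ?thesis using tail_sums by (simp add: sums_iff)
  qed
  have "(\<lambda>N. ennreal (1024 * ((\<Sum>n. (norm (a n))\<^sup>2) - (\<Sum>n<N. (norm (a n))\<^sup>2)))) \<longlonglongrightarrow> 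
      ennreal (1024 * ((\<Sum>n. (norm (a n))\<^sup>2) - (\<Sum>n. (norm (a n))\<^sup>2)))"
    by (intro tendsto_ennrealI tendsto_mult tendsto_const tendsto_diff summable_LIMSEQ[OF S])
  then have "(\<integral>\<^sup>+\<zeta>. m \<zeta> \<partial>circle) \<le> 0"
    using le by (intro LIMSEQ_le_const[where a = "\<integral>\<^sup>+\<zeta>. m \<zeta> \<partial>circle"]) auto
  then have "AE \<zeta> in circle. m \<zeta> = 0"
    by (subst (asm) le_zero_eq) (simp add: nn_integral_0_iff_AE)
  then show ?thesis
  proof (rule AE_mp[OF _ AE_I2], intro impI)
    fix \<zeta> assume "\<zeta> \<in> space circle" and m0: "m \<zeta> = 0"
    then have \<zeta>: "norm \<zeta> = 1" by simp
    let ?F = "\<lambda>r. power_series a (complex_of_real r * \<zeta>)"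
    have "cauchy_filter (filtermap ?F (at_left 1))"
      unfolding cauchy_filter_metric_filtermap
    proof (intro allI impI)
      fix e :: real assume e: "e > 0"
      then have "m \<zeta> < ennreal ((e / 4)\<^sup>2)" using m0 by simp
      then obtain N where N: "radial_maximal (tail N) \<zeta> < ennreal ((e / 4)\<^sup>2)"
        unfolding m_def by (auto simp: INF_less_iff)
      define p where "p r = (\<Sum>n<N. a n * (complex_of_real r * \<zeta>) ^ n)" for r
      have F: "?F r = p r + power_series (tail N) (complex_of_real r * \<zeta>)" if "0 \<le> r" "r < 1" for r
      proof -
        obtain A where A: "\<And>n. norm (a n) \<le> A" using square_summable_bounded[OF S] by blast
        have z: "norm (complex_of_real r * \<zeta>) < 1" using that \<zeta> by (simp add: norm_mult)
        let ?z = "complex_of_real r * \<zeta>"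
        have "(\<lambda>n. a n * ?z ^ n - (if n \<in> {..<N} then a n * ?z ^ n else 0)) sums (?F r - p r)"
          unfolding p_def by (intro sums_diff sums_power_series[OF A z] sums_If_finite_set) simp
        also have "(\<lambda>n. a n * ?z ^ n - (if n \<in> {..<N} then a n * ?z ^ n else 0)) = (\<lambda>n. tail N n * ?z ^ n)"
          by (auto simp: tail_def)
        finally show ?thesis by (simp add: power_series_def sums_iff)
      qed
      have small: "norm (power_series (tail N) (complex_of_real r * \<zeta>)) < e / 4" if "0 \<le> r" "r < 1" for r
      proof -
        have "ennreal ((norm (power_series (tail N) (complex_of_real r * \<zeta>)))\<^sup>2) < ennreal ((e / 4)\<^sup>2)"
          using radial_maximal_upper[OF tail_S that \<zeta>] N by (rule le_less_trans)
        then have "(norm (power_series (tail N) (complex_of_real r * \<zeta>)))\<^sup>2 < (e / 4)\<^sup>2"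
          by (subst (asm) ennreal_less_iff) auto
        then show ?thesis by (rule power_less_imp_less_base) (use e in simp)
      qed
      have "(p \<longlongrightarrow> p 1) (at_left 1)"
        unfolding p_def by (intro tendsto_intros)
      then have "\<forall>\<^sub>F r in at_left 1. dist (p r) (p 1) < e / 4" using e by (intro tendstoD) auto
      moreover have "\<forall>\<^sub>F r in at_left (1::real). r \<in> {0<..<1}"
        by (rule eventually_at_left_real) simp
      ultimately have "\<forall>\<^sub>F r in at_left 1. dist (p r) (p 1) < e / 4 \<and> 0 \<le> r \<and> r < 1"
        by eventually_elim auto
      moreover have "dist (?F r) (?F s) < e"
        if "dist (p r) (p 1) < e / 4 \<and> 0 \<le> r \<and> r < 1" "dist (p s) (p 1) < e / 4 \<and> 0 \<le> s \<and> s < 1" for r s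
      proof -
        have *: "dist (?F r) (p 1) < e / 2" if "dist (p r) (p 1) < e / 4 \<and> 0 \<le> r \<and> r < 1" for r
          using norm_triangle_ineq[of "p r - p 1" "power_series (tail N) (complex_of_real r * \<zeta>)"] that small[of r] F[of r]
          by (simp add: dist_norm algebra_simps)
        show ?thesis using *[OF that(1)] *[OF that(2)] by (rule dist_triangle_half_l)
      qed
      ultimately show "\<exists>P. eventually P (at_left 1) \<and> (\<forall>r s. P r \<and> P s \<longrightarrow> dist (?F r) (?F s) < e)"
        by (intro exI[of _ "\<lambda>r. dist (p r) (p 1) < e / 4 \<and> 0 \<le> r \<and> r < 1"]) auto
    qed
    moreover have "filtermap ?F (at_left 1) \<noteq> bot" by (simp add: filtermap_bot_iff)
    ultimately obtain l where "filtermap ?F (at_left 1) \<le> nhds l"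
      using cauchy_filter_complete_converges[of "filtermap ?F (at_left 1)" UNIV] complete_UNIV by auto
    then show "\<exists>l. (?F \<longlongrightarrow> l) (at_left 1)" by (auto simp: filterlim_def)
  qed
qed

lemma Fatou_square_integrable:
  assumes f: "\<And>n::nat. square_integrable (f n)" and C: "\<And>n. (LINT \<zeta>|circle. (norm (f n \<zeta>))\<^sup>2) \<le> C"
    and [measurable]: "g \<in> borel_measurable circle" and lim: "AE \<zeta> in circle. (\<lambda>n. f n \<zeta>) \<longlonglongrightarrow> g \<zeta>"
  shows "square_integrable g"
proof -
  have [measurable]: "f n \<in> borel_measurable circle" for n using f by (simp add: square_integrable_def)
  have "(\<integral>\<^sup>+\<zeta>. ennreal ((norm (g \<zeta>))\<^sup>2) \<partial>circle) = (\<integral>\<^sup>+\<zeta>. liminf (\<lambda>n. ennreal ((norm (f n \<zeta>))\<^sup>2)) \<partial>circle)"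
  proof (rule nn_integral_cong_AE)
    show "AE \<zeta> in circle. ennreal ((norm (g \<zeta>))\<^sup>2) = liminf (\<lambda>n. ennreal ((norm (f n \<zeta>))\<^sup>2))"
      using lim
    proof eventually_elim
      fix \<zeta> assume "(\<lambda>n. f n \<zeta>) \<longlonglongrightarrow> g \<zeta>"
      then have "(\<lambda>n. ennreal ((norm (f n \<zeta>))\<^sup>2)) \<longlonglongrightarrow> ennreal ((norm (g \<zeta>))\<^sup>2)"
        by (intro tendsto_ennrealI tendsto_power tendsto_norm)
      then show "ennreal ((norm (g \<zeta>))\<^sup>2) = liminf (\<lambda>n. ennreal ((norm (f n \<zeta>))\<^sup>2))"
        by (rule lim_imp_Liminf[OF sequentially_bot, symmetric])
    qed
  qed
  also have "\<dots> \<le> liminf (\<lambda>n. \<integral>\<^sup>+\<zeta>. ennreal ((norm (f n \<zeta>))\<^sup>2) \<partial>circle)"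
    by (rule nn_integral_liminf) measurable
  also have "\<dots> \<le> liminf (\<lambda>n::nat. ennreal C)"
  proof (rule Liminf_mono, rule always_eventually, rule allI)
    fix n
    have "(\<integral>\<^sup>+\<zeta>. ennreal ((norm (f n \<zeta>))\<^sup>2) \<partial>circle) = ennreal (LINT \<zeta>|circle. (norm (f n \<zeta>))\<^sup>2)"
      using f by (intro nn_integral_eq_integral) (auto simp: square_integrable_def)
    then show "(\<integral>\<^sup>+\<zeta>. ennreal ((norm (f n \<zeta>))\<^sup>2) \<partial>circle) \<le> ennreal C"
      using C by (simp add: ennreal_leI)
  qed
  also have "\<dots> < \<infinity>" by (simp add: Liminf_const)
  finally have "(\<integral>\<^sup>+\<zeta>. ennreal ((norm (g \<zeta>))\<^sup>2) \<partial>circle) < \<infinity>" .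
  then show ?thesis
    unfolding square_integrable_def by (auto intro!: integrableI_bounded)
qed

lemma square_integrable_diff:
  assumes "square_integrable f" "square_integrable g" shows "square_integrable (\<lambda>\<zeta>. f \<zeta> - g \<zeta>)"
  using square_integrable_add[OF assms(1) square_integrable_scale[OF assms(2), of "-1"]] by simp

text \<open>With \<open>u n = \<bar>f n - g\<bar>\<close> one has \<open>\<bar>k\<bar> u \<le> min (\<bar>k\<bar> u) (M \<bar>k\<bar>\<^sup>2) + u\<^sup>2 / M\<close>. The first term converges to zero in mean by
  dominated convergence, and the second is small for large \<open>M\<close> by the uniform square bound.\<close>

lemma weak_convergence_of_AE_convergence:
  assumes f: "\<And>n::nat. square_integrable (f n)" and C: "\<And>n. (LINT \<zeta>|circle. (norm (f n \<zeta>))\<^sup>2) \<le> C"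
    and gm [measurable]: "g \<in> borel_measurable circle" and lim: "AE \<zeta> in circle. (\<lambda>n. f n \<zeta>) \<longlonglongrightarrow> g \<zeta>"
    and k: "square_integrable k"
  shows "(\<lambda>n. LINT \<zeta>|circle. f n \<zeta> * cnj (k \<zeta>)) \<longlonglongrightarrow> (LINT \<zeta>|circle. g \<zeta> * cnj (k \<zeta>))"
proof -
  have g: "square_integrable g" using f C gm lim by (rule Fatou_square_integrable)
  have [measurable]: "f n \<in> borel_measurable circle" "k \<in> borel_measurable circle" for n
    using f k by (simp_all add: square_integrable_def)
  define u where "u n \<zeta> = norm (f n \<zeta> - g \<zeta>)" for n \<zeta>
  have [measurable]: "u n \<in> borel_measurable circle" for n unfolding u_def[abs_def] by measurable
  have fn2: "integrable circle (\<lambda>\<zeta>. (norm (f n \<zeta>))\<^sup>2)" and g2: "integrable circle (\<lambda>\<zeta>. (norm (g \<zeta>))\<^sup>2)"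
    and k2: "integrable circle (\<lambda>\<zeta>. (norm (k \<zeta>))\<^sup>2)" and u2: "integrable circle (\<lambda>\<zeta>. (u n \<zeta>)\<^sup>2)" for n
    using f g k square_integrable_diff[OF f g] by (simp_all add: square_integrable_def u_def)
  have ku: "integrable circle (\<lambda>\<zeta>. norm (k \<zeta>) * u n \<zeta>)" for n
    using integrable_norm[OF square_integrable_mult_cnj[OF square_integrable_diff[OF f g] k]]
    by (simp add: u_def norm_mult mult.commute)
  define D where "D = 2 * C + 2 * (LINT \<zeta>|circle. (norm (g \<zeta>))\<^sup>2)"
  have uD: "(LINT \<zeta>|circle. (u n \<zeta>)\<^sup>2) \<le> D" for n
  proof -
    have "(LINT \<zeta>|circle. (u n \<zeta>)\<^sup>2) \<le> (LINT \<zeta>|circle. 2 * (norm (f n \<zeta>))\<^sup>2 + 2 * (norm (g \<zeta>))\<^sup>2)"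
    proof (rule integral_mono)
      fix \<zeta>
      have "(u n \<zeta>)\<^sup>2 \<le> (norm (f n \<zeta>) + norm (g \<zeta>))\<^sup>2"
        unfolding u_def by (intro power_mono norm_triangle_ineq4 norm_ge_zero)
      also have "\<dots> \<le> 2 * (norm (f n \<zeta>))\<^sup>2 + 2 * (norm (g \<zeta>))\<^sup>2"
        using sum_squares_bound[of "norm (f n \<zeta>)" "norm (g \<zeta>)"] by (simp add: power2_sum)
      finally show "(u n \<zeta>)\<^sup>2 \<le> 2 * (norm (f n \<zeta>))\<^sup>2 + 2 * (norm (g \<zeta>))\<^sup>2" .
    qed (use fn2 g2 u2 in auto)
    also have "\<dots> \<le> D" using fn2 g2 C[of n] by (simp add: D_def)
    finally show ?thesis .
  qed
  have D0: "0 \<le> D" proof -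
    have "0 \<le> (LINT \<zeta>|circle. (u 0 \<zeta>)\<^sup>2)" by simp
    then show ?thesis using uD[of 0] by linarith
  qed
  have ulim: "AE \<zeta> in circle. (\<lambda>n. u n \<zeta>) \<longlonglongrightarrow> 0"
    using lim by eventually_elim (simp add: u_def tendsto_norm_zero LIM_zero)
  have "(\<lambda>n. LINT \<zeta>|circle. norm (k \<zeta>) * u n \<zeta>) \<longlonglongrightarrow> 0"
  proof (rule LIMSEQ_I)
    fix e :: real assume e: "e > 0"
    define M where "M = 2 * (D + 1) / e"
    have M: "M > 0" using e D0 by (simp add: M_def)
    let ?m = "\<lambda>n \<zeta>. min (norm (k \<zeta>) * u n \<zeta>) (M * (norm (k \<zeta>))\<^sup>2)"
    have pos: "0 \<le> ?m n \<zeta>" for n \<zeta> using M by (simp add: u_def)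
    have mi: "integrable circle (?m n)" for n
      by (rule Bochner_Integration.integrable_bound[OF ku[of n]]) (use M in \<open>auto simp: u_def\<close>)
    have "(\<lambda>n. LINT \<zeta>|circle. ?m n \<zeta>) \<longlonglongrightarrow> (LINT \<zeta>|circle. 0)"
    proof (rule integral_dominated_convergence[where w = "\<lambda>\<zeta>. M * (norm (k \<zeta>))\<^sup>2"])
      show "AE \<zeta> in circle. (\<lambda>n. ?m n \<zeta>) \<longlonglongrightarrow> 0"
        using ulim
      proof eventually_elim
        fix \<zeta> assume "(\<lambda>n. u n \<zeta>) \<longlonglongrightarrow> 0"
        then have "(\<lambda>n. ?m n \<zeta>) \<longlonglongrightarrow> min (norm (k \<zeta>) * 0) (M * (norm (k \<zeta>))\<^sup>2)"
          by (intro tendsto_intros)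
        then show "(\<lambda>n. ?m n \<zeta>) \<longlonglongrightarrow> 0" using M by simp
      qed
      show "AE \<zeta> in circle. norm (?m n \<zeta>) \<le> M * (norm (k \<zeta>))\<^sup>2" for n
        using M pos[of _ n] by (intro AE_I2) (simp add: u_def)
    qed (use k2 in \<open>auto\<close>)
    then have "(\<lambda>n. LINT \<zeta>|circle. ?m n \<zeta>) \<longlonglongrightarrow> 0" by simp
    then obtain n0 where n0: "\<And>n. n \<ge> n0 \<Longrightarrow> norm ((LINT \<zeta>|circle. ?m n \<zeta>) - 0) < e / 2"
      using e LIMSEQ_D[of "\<lambda>n. LINT \<zeta>|circle. ?m n \<zeta>" 0 "e / 2"] by auto
    have "norm ((LINT \<zeta>|circle. norm (k \<zeta>) * u n \<zeta>) - 0) < e" if "n \<ge> n0" for n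
    proof -
      have "(LINT \<zeta>|circle. norm (k \<zeta>) * u n \<zeta>) \<le> (LINT \<zeta>|circle. ?m n \<zeta> + (u n \<zeta>)\<^sup>2 / M)"
      proof (rule integral_mono)
        fix \<zeta>
        show "norm (k \<zeta>) * u n \<zeta> \<le> ?m n \<zeta> + (u n \<zeta>)\<^sup>2 / M"
        proof (cases "u n \<zeta> \<le> M * norm (k \<zeta>)")
          case True
          then have "norm (k \<zeta>) * u n \<zeta> \<le> norm (k \<zeta>) * (M * norm (k \<zeta>))" by (intro mult_left_mono) auto
          then have "?m n \<zeta> = norm (k \<zeta>) * u n \<zeta>" by (simp add: power2_eq_square mult_ac min_def)
          then show ?thesis using M by simp
        next
          case False
          then have "norm (k \<zeta>) \<le> u n \<zeta> / M" using M by (simp add: field_simps)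
          then have "norm (k \<zeta>) * u n \<zeta> \<le> u n \<zeta> / M * u n \<zeta>" by (intro mult_right_mono) (auto simp: u_def)
          then show ?thesis using pos[of \<zeta> n] unfolding power2_eq_square times_divide_eq_left by linarith
        qed
      qed (use ku mi u2 in auto)
      also have "\<dots> = (LINT \<zeta>|circle. ?m n \<zeta>) + (LINT \<zeta>|circle. (u n \<zeta>)\<^sup>2) / M"
        using mi u2 by simp
      also have "\<dots> < e / 2 + (D + 1) / M"
      proof (rule add_strict_mono)
        show "(LINT \<zeta>|circle. (u n \<zeta>)\<^sup>2) / M < (D + 1) / M"
          using uD[of n] M by (intro divide_strict_right_mono) auto
      qed (use n0[OF that] in auto)
      also have "(D + 1) / M = e / 2" using e D0 unfolding M_def by (simp add: divide_simps)
      finally have "(LINT \<zeta>|circle. norm (k \<zeta>) * u n \<zeta>) < e" by simp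
      moreover have "0 \<le> (LINT \<zeta>|circle. norm (k \<zeta>) * u n \<zeta>)" by (intro Bochner_Integration.integral_nonneg) (simp add: u_def)
      ultimately show ?thesis by simp
    qed
    then show "\<exists>n0. \<forall>n\<ge>n0. norm ((LINT \<zeta>|circle. norm (k \<zeta>) * u n \<zeta>) - 0) < e" by blast
  qed
  moreover have "norm ((LINT \<zeta>|circle. f n \<zeta> * cnj (k \<zeta>)) - (LINT \<zeta>|circle. g \<zeta> * cnj (k \<zeta>))) 
      \<le> (LINT \<zeta>|circle. norm (k \<zeta>) * u n \<zeta>)" for n
  proof -
    have "(LINT \<zeta>|circle. f n \<zeta> * cnj (k \<zeta>)) - (LINT \<zeta>|circle. g \<zeta> * cnj (k \<zeta>)) = 
       (LINT \<zeta>|circle. (f n \<zeta> - g \<zeta>) * cnj (k \<zeta>))"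
      using square_integrable_mult_cnj[OF f k] square_integrable_mult_cnj[OF g k]
      by (simp add: left_diff_distrib)
    also have "norm \<dots> \<le> (LINT \<zeta>|circle. norm ((f n \<zeta> - g \<zeta>) * cnj (k \<zeta>)))" by (rule integral_norm_bound)
    finally show ?thesis by (simp add: u_def norm_mult mult.commute)
  qed
  ultimately show ?thesis
    by (subst LIM_zero_iff[symmetric]) (rule Lim_null_comparison, auto)
qed

section \<open>Boundary functions and the Riesz projection\<close>

lemma measurable_dilate:
  assumes F: "F holomorphic_on ball 0 1" and r: "0 \<le> r" "r < 1"
  shows "(\<lambda>\<zeta>. F (complex_of_real r * \<zeta>)) \<in> borel_measurable circle"
proof -
  have "continuous_on (sphere 0 1) (\<lambda>\<zeta>. F (complex_of_real r * \<zeta>))"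
  proof (rule continuous_on_compose2[OF holomorphic_on_imp_continuous_on[OF F]])
    show "continuous_on (sphere 0 1) (\<lambda>\<zeta>. complex_of_real r * \<zeta>)" by (intro continuous_intros)
    show "(\<lambda>\<zeta>. complex_of_real r * \<zeta>) ` sphere 0 1 \<subseteq> ball 0 1" using r by (auto simp: norm_mult)
  qed
  from borel_measurable_continuous_on_restrict[OF this] show ?thesis
    by (subst measurable_cong_sets[OF sets_circle refl])
qed

lemma square_integrable_dilate:
  assumes F: "F holomorphic_on ball 0 1" and r: "0 \<le> r" "r < 1"
  shows "square_integrable (\<lambda>\<zeta>. F (complex_of_real r * \<zeta>))"
proof -
  have "compact (F ` cball 0 r)"
    using r by (intro compact_continuous_image holomorphic_on_imp_continuous_on holomorphic_on_subset[OF F]) auto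
  then obtain B where B: "\<And>x. x \<in> F ` cball 0 r \<Longrightarrow> norm x \<le> B"
    using compact_imp_bounded bounded_iff by metis
  show ?thesis
    using r by (intro square_integrable_bounded[OF measurable_dilate[OF F r], of B] AE_I2 B) (auto simp: norm_mult)
qed

text \<open>The Taylor coefficients need not be bounded, but they are after rescaling to a radius \<open>s\<close>
  strictly between \<open>r\<close> and 1.\<close>

lemma sums_integral_dilate:
  assumes F: "F holomorphic_on ball 0 1" and r: "0 \<le> r" "r < 1" and h: "integrable circle h"
  shows "(\<lambda>n. (deriv ^^ n) F 0 / fact n * (LINT \<zeta>|circle. h \<zeta> * (complex_of_real r * \<zeta>) ^ n)) sums 
     (LINT \<zeta>|circle. h \<zeta> * F (complex_of_real r * \<zeta>))"
proof -
  define c where "c n = (deriv ^^ n) F 0 / fact n" for n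
  have c: "(\<lambda>n. c n * z ^ n) sums F z" if "norm z < 1" for z
    using holomorphic_power_series[OF F, of z] that by (simp add: c_def)
  define s where "s = (1 + r) / 2"
  have s: "r < s" "s < 1" "0 < s" using r by (auto simp: s_def)
  define a where "a n = c n * complex_of_real s ^ n" for n
  define w where "w \<zeta> = complex_of_real (r / s) * \<zeta>" for \<zeta>
  have "(\<lambda>n. a n) \<longlonglongrightarrow> 0"
    using c[of "complex_of_real s"] s unfolding a_def by (intro summable_LIMSEQ_zero) (auto simp: sums_iff)
  then have "Bseq a" by (intro convergent_imp_Bseq convergentI)
  then obtain A where A: "\<And>n. norm (a n) \<le> A" by (auto simp: Bseq_def)
  have cw: "a n * w \<zeta> ^ n = c n * (complex_of_real r * \<zeta>) ^ n" for n \<zeta>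
    using s by (simp add: a_def w_def power_mult_distrib power_divide)
  have nw: "norm (w \<zeta>) \<le> r / s" if "norm \<zeta> = 1" for \<zeta>
    using that r s by (simp add: w_def norm_mult norm_divide)
  have F: "power_series a (w \<zeta>) = F (complex_of_real r * \<zeta>)" if "norm \<zeta> = 1" for \<zeta>
    unfolding power_series_def cw using c[of "complex_of_real r * \<zeta>"] that r by (simp add: norm_mult sums_iff)
  have [measurable]: "w \<in> borel_measurable circle" unfolding w_def[abs_def] by measurable
  have "(\<lambda>n. a n * (LINT \<zeta>|circle. h \<zeta> * w \<zeta> ^ n)) sums (LINT \<zeta>|circle. h \<zeta> * power_series a (w \<zeta>))"
    by (rule sums_integral_power_series[OF A h, where R = "r / s"]) (use nw r s in auto)
  also have "(LINT \<zeta>|circle. h \<zeta> * power_series a (w \<zeta>)) = (LINT \<zeta>|circle. h \<zeta> * F (complex_of_real r * \<zeta>))"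
    using F by (intro Bochner_Integration.integral_cong) auto
  also have "(\<lambda>n. a n * (LINT \<zeta>|circle. h \<zeta> * w \<zeta> ^ n)) = 
      (\<lambda>n. c n * (LINT \<zeta>|circle. h \<zeta> * (complex_of_real r * \<zeta>) ^ n))"
  proof
    fix n
    have "a n * (LINT \<zeta>|circle. h \<zeta> * w \<zeta> ^ n) = (LINT \<zeta>|circle. h \<zeta> * (a n * w \<zeta> ^ n))"
      by (simp add: mult.left_commute)
    also have "\<dots> = c n * (LINT \<zeta>|circle. h \<zeta> * (complex_of_real r * \<zeta>) ^ n)"
      unfolding cw by (simp add: mult.left_commute)
    finally show "a n * (LINT \<zeta>|circle. h \<zeta> * w \<zeta> ^ n) = c n * (LINT \<zeta>|circle. h \<zeta> * (complex_of_real r * \<zeta>) ^ n)" .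
  qed
  finally show ?thesis by (simp add: c_def)
qed

text \<open>A fixed sequence tending to 1, for the convergence theorems that speak about sequences.\<close>

definition radii :: "nat \<Rightarrow> real" where "radii n = 1 - 1 / real (Suc n)"

lemma radii: "0 \<le> radii n" "radii n < 1"
  by (auto simp: radii_def field_simps)

lemma filterlim_radii: "filterlim radii (at_left 1) sequentially"
proof -
  have "(\<lambda>n. 1 - 1 / real (Suc n)) \<longlonglongrightarrow> 1 - 0"
    by (intro tendsto_diff tendsto_const LIMSEQ_Suc lim_1_over_n)
  then have "radii \<longlonglongrightarrow> 1" unfolding radii_def[abs_def] by simp
  then show ?thesis
    using radii(2) by (simp add: filterlim_at less_imp_neq)
qed

lemma radial_limit_radii:
  assumes "((\<lambda>r. F (complex_of_real r * \<zeta>)) \<longlongrightarrow> l) (at_left 1)"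
  shows "(\<lambda>n. F (complex_of_real (radii n) * \<zeta>)) \<longlonglongrightarrow> l"
  using filterlim_compose[OF assms filterlim_radii] .

lemma hardy_two_boundary:
  assumes F: "F \<in> hardy_two" and f: "boundary_function F f"
  shows "square_integrable f"
    and "square_integrable k \<Longrightarrow> (\<lambda>n. LINT \<zeta>|circle. F (complex_of_real (radii n) * \<zeta>) * cnj (k \<zeta>)) 
      \<longlonglongrightarrow> (LINT \<zeta>|circle. f \<zeta> * cnj (k \<zeta>))"
proof -
  obtain C where hol: "F holomorphic_on ball 0 1" 
    and C: "\<And>r. r \<in> {0..<1} \<Longrightarrow> (LINT \<zeta>|circle. (norm (F (complex_of_real r * \<zeta>)))\<^sup>2) \<le> C"
    using F unfolding hardy_two_def by blast
  have 1: "square_integrable (\<lambda>\<zeta>. F (complex_of_real (radii n) * \<zeta>))" for n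
    by (rule square_integrable_dilate[OF hol radii])
  have 2: "(LINT \<zeta>|circle. (norm (F (complex_of_real (radii n) * \<zeta>)))\<^sup>2) \<le> C" for n
    by (rule C) (simp add: radii)
  have 3: "f \<in> borel_measurable circle" using f by (simp add: boundary_function_def)
  have "AE \<zeta> in circle. ((\<lambda>r. F (complex_of_real r * \<zeta>)) \<longlongrightarrow> f \<zeta>) (at_left 1)"
    using f by (simp add: boundary_function_def)
  then have 4: "AE \<zeta> in circle. (\<lambda>n. F (complex_of_real (radii n) * \<zeta>)) \<longlonglongrightarrow> f \<zeta>"
    by eventually_elim (rule radial_limit_radii)
  show "square_integrable f" using 1 2 3 4 by (rule Fatou_square_integrable)
  show "(\<lambda>n. LINT \<zeta>|circle. F (complex_of_real (radii n) * \<zeta>) * cnj (k \<zeta>)) 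
      \<longlonglongrightarrow> (LINT \<zeta>|circle. f \<zeta> * cnj (k \<zeta>))" if "square_integrable k"
    using 1 2 3 4 that by (rule weak_convergence_of_AE_convergence)
qed

text \<open>The pairing of \<open>k\<close> with each dilate of \<open>F\<close> is a series in the pairings with the monomials,
  and the dilates converge weakly to the boundary function.\<close>

lemma hardy_two_orthogonal:
  assumes F: "F \<in> hardy_two" and f: "boundary_function F f" and k: "square_integrable k"
    and orth: "\<And>n. (LINT \<zeta>|circle. \<zeta> ^ n * cnj (k \<zeta>)) = 0"
  shows "(LINT \<zeta>|circle. f \<zeta> * cnj (k \<zeta>)) = 0"
proof -
  have hol: "F holomorphic_on ball 0 1" using F by (simp add: hardy_two_def)
  have ki: "integrable circle (\<lambda>\<zeta>. cnj (k \<zeta>))" using square_integrable_integrable[OF k] by simp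
  have "(LINT \<zeta>|circle. F (complex_of_real (radii n) * \<zeta>) * cnj (k \<zeta>)) = 0" for n
  proof -
    have "(LINT \<zeta>|circle. cnj (k \<zeta>) * (complex_of_real (radii n) * \<zeta>) ^ m) = 0" for m
    proof -
      have "(LINT \<zeta>|circle. cnj (k \<zeta>) * (complex_of_real (radii n) * \<zeta>) ^ m)
        = (LINT \<zeta>|circle. complex_of_real (radii n) ^ m * (\<zeta> ^ m * cnj (k \<zeta>)))"
        by (simp add: power_mult_distrib mult_ac)
      then show ?thesis using orth by simp
    qed
    then have "(\<lambda>m. 0) sums (LINT \<zeta>|circle. cnj (k \<zeta>) * F (complex_of_real (radii n) * \<zeta>))"
      using sums_integral_dilate[OF hol radii[of n] ki] by simp
    then show ?thesis by (simp add: sums_iff mult.commute)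
  qed
  then show ?thesis using hardy_two_boundary(2)[OF F f k] by (simp add: LIMSEQ_const_iff)
qed

text \<open>The power series with the nonnegative Fourier coefficients of \<open>f\<close> has a square integrable boundary function
  by the maximal inequality; weak convergence of its dilates identifies the coefficients of this boundary
  function.\<close>

theorem riesz_projection:
  assumes f: "square_integrable f"
  obtains F h where "F \<in> hardy_two" "boundary_function F h" "square_integrable h"
    "\<And>n. fourier_coeff h n = fourier_coeff f n"
proof -
  define a where "a = fourier_coeff f"
  have S: "summable (\<lambda>n. (norm (a n))\<^sup>2)" unfolding a_def by (rule Bessel_summable[OF f])
  obtain A where A: "\<And>n. norm (a n) \<le> A" using square_summable_bounded[OF S] by blast
  let ?F = "power_series a"
  have "(LINT \<zeta>|circle. (norm (?F (complex_of_real r * \<zeta>)))\<^sup>2) \<le> 1024 * (\<Sum>n. (norm (a n))\<^sup>2)" if "r \<in> {0..<1}" for r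
    by (rule linearized_maximal_inequality[OF S, of "\<lambda>_. r" r]) (use that in auto)
  then have F: "?F \<in> hardy_two"
    using holomorphic_on_power_series[of a A] A unfolding hardy_two_def by blast
  define h where "h \<zeta> = lim (\<lambda>n. ?F (complex_of_real (radii n) * \<zeta>))" for \<zeta>
  have [measurable]: "h \<in> borel_measurable circle" unfolding h_def[abs_def] by measurable
  have "AE \<zeta> in circle. ((\<lambda>r. ?F (complex_of_real r * \<zeta>)) \<longlongrightarrow> h \<zeta>) (at_left 1)"
    using radial_limit_power_series[OF S]
  proof eventually_elim
    fix \<zeta> assume "\<exists>l. ((\<lambda>r. ?F (complex_of_real r * \<zeta>)) \<longlongrightarrow> l) (at_left 1)"
    then obtain l where l: "((\<lambda>r. ?F (complex_of_real r * \<zeta>)) \<longlongrightarrow> l) (at_left 1)" ..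
    have "h \<zeta> = l" unfolding h_def by (rule limI[OF radial_limit_radii[OF l]])
    then show "((\<lambda>r. ?F (complex_of_real r * \<zeta>)) \<longlongrightarrow> h \<zeta>) (at_left 1)" using l by simp
  qed
  then have bF: "boundary_function ?F h" by (simp add: boundary_function_def)
  have "fourier_coeff h n = a n" for n
  proof -
    have "(LINT \<zeta>|circle. ?F (complex_of_real (radii m) * \<zeta>) * cnj (\<zeta> ^ n)) = a n * complex_of_real (radii m) ^ n" for m
    proof -
      have "(\<lambda>j. a j * (LINT \<zeta>|circle. cnj (\<zeta> ^ n) * (complex_of_real (radii m) * \<zeta>) ^ j)) sums 
          (LINT \<zeta>|circle. cnj (\<zeta> ^ n) * ?F (complex_of_real (radii m) * \<zeta>))"
      proof (rule sums_integral_power_series[OF A, where R = "radii m"])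
        show "integrable circle (\<lambda>\<zeta>. cnj (\<zeta> ^ n))"
          using square_integrable_integrable[OF square_integrable_power[of n]] by (simp del: complex_cnj_power)
      qed (auto simp: norm_mult radii)
      moreover have cj: "(LINT \<zeta>|circle. cnj (\<zeta> ^ n) * (complex_of_real (radii m) * \<zeta>) ^ j) = 
          (if j = n then complex_of_real (radii m) ^ j else 0)" for j
      proof -
        have "(LINT \<zeta>|circle. cnj (\<zeta> ^ n) * (complex_of_real (radii m) * \<zeta>) ^ j) = 
          (LINT \<zeta>|circle. complex_of_real (radii m) ^ j * (\<zeta> ^ j * cnj \<zeta> ^ n))"
          by (simp add: power_mult_distrib mult_ac)
        then show ?thesis by (simp add: integral_circle_power_cnj)
      qed
      ultimately have "(\<lambda>j. a j * (if j = n then complex_of_real (radii m) ^ j else 0)) sums 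
          (LINT \<zeta>|circle. cnj (\<zeta> ^ n) * ?F (complex_of_real (radii m) * \<zeta>))"
        by (simp only: cj)
      moreover have "(\<lambda>j. a j * (if j = n then complex_of_real (radii m) ^ j else 0)) sums (a n * complex_of_real (radii m) ^ n)"
        using sums_single[of n "\<lambda>j. a j * complex_of_real (radii m) ^ j"] by (simp add: if_distrib cong: if_cong)
      ultimately have "(LINT \<zeta>|circle. cnj (\<zeta> ^ n) * ?F (complex_of_real (radii m) * \<zeta>)) = a n * complex_of_real (radii m) ^ n"
        by (rule sums_unique2)
      then show ?thesis by (simp only: mult.commute)
    qed
    then have "(\<lambda>m. a n * complex_of_real (radii m) ^ n) \<longlonglongrightarrow> (LINT \<zeta>|circle. h \<zeta> * cnj (\<zeta> ^ n))"
      using hardy_two_boundary(2)[OF F bF square_integrable_power[of n]] by simp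
    moreover have "radii \<longlonglongrightarrow> 1" using filterlim_radii by (simp add: filterlim_at)
    then have "(\<lambda>m. a n * complex_of_real (radii m) ^ n) \<longlonglongrightarrow> a n * complex_of_real 1 ^ n"
      by (intro tendsto_intros)
    ultimately have "(LINT \<zeta>|circle. h \<zeta> * cnj (\<zeta> ^ n)) = a n * complex_of_real 1 ^ n" by (rule LIMSEQ_unique)
    then show ?thesis by (simp add: fourier_coeff_def)
  qed
  then show thesis using that[OF F bF hardy_two_boundary(1)[OF F bF]] by (simp add: a_def)
qed

lemma hardy_inf_subset_hardy_two: "hardy_inf \<subseteq> hardy_two"
proof
  fix F assume F: "F \<in> hardy_inf"
  then have hol: "F holomorphic_on ball 0 1" by (simp add: hardy_inf_def)
  obtain B where "\<forall>x\<in>F ` ball 0 1. norm x \<le> B"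
    using F unfolding hardy_inf_def bounded_iff by blast
  then have B: "norm (F z) \<le> B" if "norm z < 1" for z using that by simp
  have "(LINT \<zeta>|circle. (norm (F (complex_of_real r * \<zeta>)))\<^sup>2) \<le> B\<^sup>2" if r: "r \<in> {0..<1}" for r
  proof -
    have "(LINT \<zeta>|circle. (norm (F (complex_of_real r * \<zeta>)))\<^sup>2) \<le> (LINT \<zeta>|circle. B\<^sup>2)"
      using r square_integrable_dilate[OF hol, of r]
      by (intro integral_mono power_mono B) (auto simp: square_integrable_def norm_mult)
    then show ?thesis by simp
  qed
  then show "F \<in> hardy_two" using hol unfolding hardy_two_def by blast
qed

text \<open>On the circle \<open>cnj (1 / (\<zeta> - w))\<close> equals \<open>\<zeta> / (1 - cnj w \<zeta>)\<close>, a power series that vanishes at the origin.\<close>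

lemma cauchy_kernel_orthogonal:
  assumes w: "norm w < 1"
  shows "square_integrable (\<lambda>\<zeta>. 1 / (\<zeta> - w))"
    and "(LINT \<zeta>|circle. \<zeta> ^ n * cnj (1 / (\<zeta> - w))) = 0"
proof -
  show "square_integrable (\<lambda>\<zeta>. 1 / (\<zeta> - w))"
  proof (rule square_integrable_bounded[where B = "1 / (1 - norm w)"])
    have "norm (1 / (\<zeta> - w)) \<le> 1 / (1 - norm w)" if "norm \<zeta> = 1" for \<zeta>
      using norm_triangle_ineq2[of \<zeta> w] w that by (auto simp: norm_divide intro!: divide_left_mono mult_pos_pos)
    then show "AE \<zeta> in circle. norm (1 / (\<zeta> - w)) \<le> 1 / (1 - norm w)" by (intro AE_I2) auto
  qed measurable
  have A: "norm ((\<lambda>_. 1 :: complex) m) \<le> 1" for m :: nat by simp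
  have "(\<lambda>m. 1 * (LINT \<zeta>|circle. \<zeta> ^ Suc n * (cnj w * \<zeta>) ^ m)) sums
      (LINT \<zeta>|circle. \<zeta> ^ Suc n * power_series (\<lambda>_. 1) (cnj w * \<zeta>))"
    by (rule sums_integral_power_series[OF A, where R = "norm w"])
       (use w in \<open>auto simp: norm_mult intro!: square_integrable_integrable square_integrable_power simp del: power_Suc\<close>)
  moreover have "(LINT \<zeta>|circle. \<zeta> ^ Suc n * (cnj w * \<zeta>) ^ m) = 0" for m
  proof -
    have "(LINT \<zeta>|circle. \<zeta> ^ Suc n * (cnj w * \<zeta>) ^ m) = (LINT \<zeta>|circle. cnj w ^ m * \<zeta> ^ (Suc n + m))"
      by (simp add: power_mult_distrib power_add mult_ac)
    then show ?thesis using integral_circle_power[of "Suc n + m"] by simp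
  qed
  ultimately have "(LINT \<zeta>|circle. \<zeta> ^ Suc n * power_series (\<lambda>_. 1) (cnj w * \<zeta>)) = 0"
    by (simp add: sums_iff)
  also have "(LINT \<zeta>|circle. \<zeta> ^ Suc n * power_series (\<lambda>_. 1) (cnj w * \<zeta>)) = 
      (LINT \<zeta>|circle. \<zeta> ^ n * cnj (1 / (\<zeta> - w)))"
  proof (rule Bochner_Integration.integral_cong)
    fix \<zeta> assume "\<zeta> \<in> space circle"
    then have \<zeta>: "norm \<zeta> = 1" by simp
    have n: "norm (cnj w * \<zeta>) < 1" using w \<zeta> by (simp add: norm_mult)
    have zz: "\<zeta> * cnj \<zeta> = 1" using \<zeta> by (simp add: complex_norm_square[symmetric])
    have "\<zeta> * (cnj \<zeta> - cnj w) = 1 - cnj w * \<zeta>" by (simp add: algebra_simps zz)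
    moreover have "1 - cnj w * \<zeta> \<noteq> 0" using n by auto
    ultimately have "\<zeta> / (1 - cnj w * \<zeta>) = 1 / (cnj \<zeta> - cnj w)" 
      by (metis divide_divide_eq_left divide_self_if mult_eq_0_iff)
    moreover have "power_series (\<lambda>_. 1) (cnj w * \<zeta>) = 1 / (1 - cnj w * \<zeta>)"
      unfolding power_series_def using geometric_sums[OF n] by (simp add: sums_iff)
    moreover have "\<zeta> ^ Suc n * (1 / (1 - cnj w * \<zeta>)) = \<zeta> ^ n * (\<zeta> / (1 - cnj w * \<zeta>))"
      by (simp only: power_Suc2 mult.assoc times_divide_eq_right mult_1_right)
    ultimately show "\<zeta> ^ Suc n * power_series (\<lambda>_. 1) (cnj w * \<zeta>) = \<zeta> ^ n * cnj (1 / (\<zeta> - w))"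
      by simp
  qed simp
  finally show "(LINT \<zeta>|circle. \<zeta> ^ n * cnj (1 / (\<zeta> - w))) = 0" .
qed

section \<open>Multiplication operators on \<open>L\<^sup>2\<close>\<close>

lemma l2_eq_rep_abs: "square_integrable f \<Longrightarrow> l2_eq (rep_l2 (abs_l2 f)) f"
  by (subst Quotient3_rel[OF Quotient3_l2, symmetric])
     (auto simp: Quotient3_abs_rep[OF Quotient3_l2] l2_eq_def square_integrable_rep)

lemma AE_rep_abs: "square_integrable f \<Longrightarrow> AE \<zeta> in circle. rep_l2 (abs_l2 f) \<zeta> = f \<zeta>"
  using l2_eq_rep_abs by (simp add: l2_eq_def)

lemma measurable_rep [measurable, simp]: "rep_l2 f \<in> borel_measurable circle"
  using square_integrable_rep[of f] by (simp add: square_integrable_def)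

lemma l2_eqI:
  assumes "AE \<zeta> in circle. rep_l2 f \<zeta> = rep_l2 g \<zeta>" shows "f = g"
proof -
  have "l2_eq (rep_l2 f) (rep_l2 g)" using assms by (simp add: l2_eq_def square_integrable_rep)
  then show ?thesis using Quotient3_rel_rep[OF Quotient3_l2] by blast
qed

lemma AE_rep_zero: "AE \<zeta> in circle. rep_l2 0 \<zeta> = 0"
  unfolding zero_l2_def by (rule AE_rep_abs[OF square_integrable_zero])

lemma AE_rep_plus: "AE \<zeta> in circle. rep_l2 (f + g) \<zeta> = rep_l2 f \<zeta> + rep_l2 g \<zeta>"
  unfolding plus_l2_def map_fun_apply
  by (intro AE_rep_abs square_integrable_add square_integrable_rep)

lemma AE_rep_minus: "AE \<zeta> in circle. rep_l2 (f - g) \<zeta> = rep_l2 f \<zeta> - rep_l2 g \<zeta>"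
  unfolding minus_l2_def map_fun_apply
  by (intro AE_rep_abs square_integrable_diff square_integrable_rep)

lemma AE_rep_cscale: "AE \<zeta> in circle. rep_l2 (c *\<^sub>c f) \<zeta> = c * rep_l2 f \<zeta>"
  unfolding cscale_def map_fun_apply id_apply
  by (intro AE_rep_abs square_integrable_scale square_integrable_rep)

lemma cinner_integral: "cinner f g = (LINT \<zeta>|circle. rep_l2 f \<zeta> * cnj (rep_l2 g \<zeta>))"
  by (rule cinner.rep_eq)

lemma cinner_eqI:
  assumes "AE \<zeta> in circle. rep_l2 f \<zeta> * cnj (rep_l2 g \<zeta>) = h \<zeta>" "h \<in> borel_measurable circle"
  shows "cinner f g = (LINT \<zeta>|circle. h \<zeta>)"
  unfolding cinner_integral using assms by (intro integral_cong_AE) auto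

lemma cinner_add_right: "cinner f (g + h) = cinner f g + cinner f h"
  by (subst (1 2 3) cinner_commute) (simp add: cinner_add_left)

lemma cinner_zero_right [simp]: "cinner f 0 = 0"
  using cinner_add_right[of f 0 0] by simp

lemma cinner_cscale_right: "cinner f (c *\<^sub>c g) = cnj c * cinner f g"
  by (subst (1 2) cinner_commute) (simp add: cinner_cscale_left)

lemma cinner_zero_left [simp]: "cinner 0 f = 0"
  using cinner_add_left[of 0 0 f] by simp

lemma cinner_diff_left: "cinner (f - g) h = cinner f h - cinner g h"
  using cinner_add_left[of "f - g" g h] by simp

lemma cinner_eq_0_commute: "cinner f g = 0 \<longleftrightarrow> cinner g f = 0"
  by (subst cinner_commute) simp

lemma cscale_add: "c *\<^sub>c (f + g) = c *\<^sub>c f + c *\<^sub>c g"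
proof (rule l2_eqI)
  show "AE \<zeta> in circle. rep_l2 (c *\<^sub>c (f + g)) \<zeta> = rep_l2 (c *\<^sub>c f + c *\<^sub>c g) \<zeta>"
    using AE_rep_cscale[of c "f + g"] AE_rep_plus[of f g] AE_rep_cscale[of c f] AE_rep_cscale[of c g]
      AE_rep_plus[of "c *\<^sub>c f" "c *\<^sub>c g"]
    by eventually_elim (simp add: distrib_left)
qed

lemma cscale_minus_one: "(- 1) *\<^sub>c f = - f"
  using scaleR_eq_cscale[of "-1" f] by simp

lemma cscale_diff: "c *\<^sub>c (f - g) = c *\<^sub>c f - c *\<^sub>c g"
  using cscale_add[of c "f - g" g] by simp

lemma cscale_zero [simp]: "c *\<^sub>c 0 = 0"
  using cscale_add[of c 0 0] by simp

lemma cscale_diff_left: "(c - d) *\<^sub>c f = c *\<^sub>c f - d *\<^sub>c f"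
proof (rule l2_eqI)
  show "AE \<zeta> in circle. rep_l2 ((c - d) *\<^sub>c f) \<zeta> = rep_l2 (c *\<^sub>c f - d *\<^sub>c f) \<zeta>"
    using AE_rep_cscale[of "c - d" f] AE_rep_cscale[of c f] AE_rep_cscale[of d f] AE_rep_minus[of "c *\<^sub>c f" "d *\<^sub>c f"]
    by eventually_elim (simp add: left_diff_distrib)
qed

lemma norm_l2_sq: "(norm f)\<^sup>2 = (LINT \<zeta>|circle. (norm (rep_l2 f \<zeta>))\<^sup>2)"
  by (simp add: norm_l2_def inner_l2_def cinner_self)

lemma norm_cscale: "norm (c *\<^sub>c f) = norm c * norm f"
proof (rule power2_eq_imp_eq)
  have sq: "(norm g)\<^sup>2 = Re (cinner g g)" for g by (simp add: norm_l2_def inner_l2_def cinner_self)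
  have "(norm (c *\<^sub>c f))\<^sup>2 = Re (c * cnj c * cinner f f)"
    unfolding sq cinner_cscale_left cinner_cscale_right by (simp only: mult_ac)
  also have "\<dots> = (norm c)\<^sup>2 * Re (cinner f f)"
    unfolding complex_norm_square[symmetric] by simp
  also have "\<dots> = (norm c * norm f)\<^sup>2"
    unfolding sq[symmetric] by (simp add: power_mult_distrib)
  finally show "(norm (c *\<^sub>c f))\<^sup>2 = (norm c * norm f)\<^sup>2" .
qed auto

definition csubspace :: "l2 set \<Rightarrow> bool" where
  "csubspace M \<longleftrightarrow> 0 \<in> M \<and> (\<forall>f\<in>M. \<forall>g\<in>M. f + g \<in> M) \<and> (\<forall>c. \<forall>f\<in>M. c *\<^sub>c f \<in> M)"

lemma csubspace_diff: "csubspace M \<Longrightarrow> f \<in> M \<Longrightarrow> g \<in> M \<Longrightarrow> f - g \<in> M"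
  unfolding csubspace_def using cscale_minus_one[of g] by (metis diff_conv_add_uminus)

lemma csubspace_ortho_compl: "csubspace (ortho_compl A)"
  by (auto simp: csubspace_def ortho_compl_def cinner_add_left cinner_cscale_left)

lemma ortho_proj_eqI:
  assumes M: "csubspace M" and g: "g \<in> M" "f - g \<in> ortho_compl M"
  shows "ortho_proj M f = g"
  unfolding ortho_proj_def
proof (rule the_equality)
  fix g' assume g': "g' \<in> M \<and> f - g' \<in> ortho_compl M"
  have "g' - g \<in> M" using csubspace_diff[OF M] g g' by blast
  moreover have "(f - g) - (f - g') \<in> ortho_compl M"
    using csubspace_diff[OF csubspace_ortho_compl] g g' by blast
  ultimately have "cinner (g' - g) (g' - g) = 0" by (simp add: ortho_compl_def)
  then show "g' = g" by (simp add: cinner_self_eq_0_iff)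
qed (use g in simp)

text \<open>On these symbols \<open>mult_op\<close> is pointwise multiplication almost everywhere.\<close>

definition ess_bounded :: "(complex \<Rightarrow> complex) \<Rightarrow> bool" where
  "ess_bounded \<psi> \<longleftrightarrow> \<psi> \<in> borel_measurable circle \<and> (\<exists>B. AE \<zeta> in circle. norm (\<psi> \<zeta>) \<le> B)"

lemma ess_bounded_cnj: "ess_bounded \<psi> \<Longrightarrow> ess_bounded (\<lambda>\<zeta>. cnj (\<psi> \<zeta>))"
  by (auto simp: ess_bounded_def)

lemma ess_bounded_mult:
  assumes "ess_bounded \<psi>" "ess_bounded \<xi>" shows "ess_bounded (\<lambda>\<zeta>. \<psi> \<zeta> * \<xi> \<zeta>)"
proof -
  obtain A B where A: "AE \<zeta> in circle. norm (\<psi> \<zeta>) \<le> A" and B: "AE \<zeta> in circle. norm (\<xi> \<zeta>) \<le> B"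
    using assms by (auto simp: ess_bounded_def)
  have "AE \<zeta> in circle. norm (\<psi> \<zeta> * \<xi> \<zeta>) \<le> \<bar>A\<bar> * \<bar>B\<bar>"
    using A B by eventually_elim (auto simp: norm_mult intro!: mult_mono)
  then show ?thesis using assms by (auto simp: ess_bounded_def)
qed

lemma square_integrable_mult_bounded:
  assumes m: "\<psi> \<in> borel_measurable circle" and B: "AE \<zeta> in circle. norm (\<psi> \<zeta>) \<le> B" and f: "square_integrable f"
  shows "square_integrable (\<lambda>\<zeta>. \<psi> \<zeta> * f \<zeta>)"
    and "(LINT \<zeta>|circle. (norm (\<psi> \<zeta> * f \<zeta>))\<^sup>2) \<le> B\<^sup>2 * (LINT \<zeta>|circle. (norm (f \<zeta>))\<^sup>2)"
proof -
  have [measurable]: "\<psi> \<in> borel_measurable circle" "f \<in> borel_measurable circle"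
    using m f by (auto simp: square_integrable_def)
  have le: "AE \<zeta> in circle. (norm (\<psi> \<zeta> * f \<zeta>))\<^sup>2 \<le> B\<^sup>2 * (norm (f \<zeta>))\<^sup>2"
    using B by eventually_elim (auto simp: norm_mult power_mult_distrib intro!: mult_right_mono power_mono)
  have i: "integrable circle (\<lambda>\<zeta>. B\<^sup>2 * (norm (f \<zeta>))\<^sup>2)" using f by (simp add: square_integrable_def)
  have "integrable circle (\<lambda>\<zeta>. (norm (\<psi> \<zeta> * f \<zeta>))\<^sup>2)"
    by (rule Bochner_Integration.integrable_bound[OF i]) (use le in auto)
  then show s: "square_integrable (\<lambda>\<zeta>. \<psi> \<zeta> * f \<zeta>)" by (simp add: square_integrable_def)
  have "(LINT \<zeta>|circle. (norm (\<psi> \<zeta> * f \<zeta>))\<^sup>2) \<le> (LINT \<zeta>|circle. B\<^sup>2 * (norm (f \<zeta>))\<^sup>2)"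
    using s i le by (intro integral_mono_AE) (auto simp: square_integrable_def)
  then show "(LINT \<zeta>|circle. (norm (\<psi> \<zeta> * f \<zeta>))\<^sup>2) \<le> B\<^sup>2 * (LINT \<zeta>|circle. (norm (f \<zeta>))\<^sup>2)" by simp
qed

lemma AE_rep_mult:
  assumes "ess_bounded \<psi>" shows "AE \<zeta> in circle. rep_l2 (mult_op \<psi> f) \<zeta> = \<psi> \<zeta> * rep_l2 f \<zeta>"
  using assms unfolding mult_op_def ess_bounded_def
  by (auto intro!: AE_rep_abs square_integrable_mult_bounded(1) square_integrable_rep)

lemma mult_op_add:
  assumes "ess_bounded \<psi>" shows "mult_op \<psi> (f + g) = mult_op \<psi> f + mult_op \<psi> g"
proof (rule l2_eqI)
  show "AE \<zeta> in circle. rep_l2 (mult_op \<psi> (f + g)) \<zeta> = rep_l2 (mult_op \<psi> f + mult_op \<psi> g) \<zeta>"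
    using AE_rep_mult[OF assms, of "f + g"] AE_rep_mult[OF assms, of f] AE_rep_mult[OF assms, of g]
      AE_rep_plus[of f g] AE_rep_plus[of "mult_op \<psi> f" "mult_op \<psi> g"]
    by eventually_elim (simp add: distrib_left)
qed

lemma mult_op_diff:
  assumes "ess_bounded \<psi>" shows "mult_op \<psi> (f - g) = mult_op \<psi> f - mult_op \<psi> g"
  using mult_op_add[OF assms, of "f - g" g] by simp

lemma mult_op_zero:
  assumes "ess_bounded \<psi>" shows "mult_op \<psi> 0 = 0"
  using mult_op_add[OF assms, of 0 0] by simp

lemma mult_op_cscale:
  assumes "ess_bounded \<psi>" shows "mult_op \<psi> (c *\<^sub>c f) = c *\<^sub>c mult_op \<psi> f"
proof (rule l2_eqI)
  show "AE \<zeta> in circle. rep_l2 (mult_op \<psi> (c *\<^sub>c f)) \<zeta> = rep_l2 (c *\<^sub>c mult_op \<psi> f) \<zeta>"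
    using AE_rep_mult[OF assms, of "c *\<^sub>c f"] AE_rep_mult[OF assms, of f] AE_rep_cscale[of c f] 
      AE_rep_cscale[of c "mult_op \<psi> f"]
    by eventually_elim (simp add: mult_ac)
qed

lemma mult_op_mult_op:
  assumes \<psi>: "ess_bounded \<psi>" and \<xi>: "ess_bounded \<xi>"
  shows "mult_op \<psi> (mult_op \<xi> f) = mult_op (\<lambda>\<zeta>. \<psi> \<zeta> * \<xi> \<zeta>) f"
proof (rule l2_eqI)
  show "AE \<zeta> in circle. rep_l2 (mult_op \<psi> (mult_op \<xi> f)) \<zeta> = rep_l2 (mult_op (\<lambda>\<zeta>. \<psi> \<zeta> * \<xi> \<zeta>) f) \<zeta>"
    using AE_rep_mult[OF \<psi>, of "mult_op \<xi> f"] AE_rep_mult[OF \<xi>, of f] AE_rep_mult[OF ess_bounded_mult[OF \<psi> \<xi>], of f]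
    by eventually_elim simp
qed

lemma mult_op_one: 
  assumes \<psi>: "ess_bounded \<psi>" and eq: "AE \<zeta> in circle. \<psi> \<zeta> = 1" 
  shows "mult_op \<psi> f = f"
proof (rule l2_eqI)
  show "AE \<zeta> in circle. rep_l2 (mult_op \<psi> f) \<zeta> = rep_l2 f \<zeta>"
    using AE_rep_mult[OF \<psi>, of f] eq by eventually_elim simp
qed

lemma mult_op_minus_const:
  assumes \<psi>: "ess_bounded \<psi>" and \<xi>: "ess_bounded \<xi>" and eq: "AE \<zeta> in circle. \<xi> \<zeta> = \<psi> \<zeta> - \<mu>"
  shows "mult_op \<xi> f = mult_op \<psi> f - \<mu> *\<^sub>c f"
proof (rule l2_eqI)
  show "AE \<zeta> in circle. rep_l2 (mult_op \<xi> f) \<zeta> = rep_l2 (mult_op \<psi> f - \<mu> *\<^sub>c f) \<zeta>"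
    using AE_rep_mult[OF \<psi>, of f] AE_rep_mult[OF \<xi>, of f] eq AE_rep_cscale[of \<mu> f] AE_rep_minus[of "mult_op \<psi> f" "\<mu> *\<^sub>c f"]
    by eventually_elim (simp add: left_diff_distrib)
qed

lemma cinner_mult_op:
  assumes \<psi>: "ess_bounded \<psi>"
  shows "cinner (mult_op \<psi> f) g = cinner f (mult_op (\<lambda>\<zeta>. cnj (\<psi> \<zeta>)) g)"
proof -
  have "AE \<zeta> in circle. rep_l2 (mult_op \<psi> f) \<zeta> * cnj (rep_l2 g \<zeta>) = 
      rep_l2 f \<zeta> * cnj (rep_l2 (mult_op (\<lambda>\<zeta>. cnj (\<psi> \<zeta>)) g) \<zeta>)"
    using AE_rep_mult[OF \<psi>, of f] AE_rep_mult[OF ess_bounded_cnj[OF \<psi>], of g]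
    by eventually_elim simp
  then show ?thesis by (subst (2) cinner_integral) (rule cinner_eqI, auto)
qed

lemma norm_mult_op_le:
  assumes m: "\<psi> \<in> borel_measurable circle" and B: "AE \<zeta> in circle. norm (\<psi> \<zeta>) \<le> B" "0 \<le> B"
  shows "norm (mult_op \<psi> f) \<le> B * norm f"
proof (rule power2_le_imp_le)
  have \<psi>: "ess_bounded \<psi>" using m B by (auto simp: ess_bounded_def)
  have "(norm (mult_op \<psi> f))\<^sup>2 = (LINT \<zeta>|circle. (norm (\<psi> \<zeta> * rep_l2 f \<zeta>))\<^sup>2)"
    unfolding norm_l2_sq
  proof (rule integral_cong_AE)
    show "AE \<zeta> in circle. (norm (rep_l2 (mult_op \<psi> f) \<zeta>))\<^sup>2 = (norm (\<psi> \<zeta> * rep_l2 f \<zeta>))\<^sup>2"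
      using AE_rep_mult[OF \<psi>, of f] by eventually_elim simp
  qed (use m in measurable)
  also have "\<dots> \<le> B\<^sup>2 * (LINT \<zeta>|circle. (norm (rep_l2 f \<zeta>))\<^sup>2)"
    by (rule square_integrable_mult_bounded(2)[OF m B(1) square_integrable_rep])
  also have "\<dots> = (B * norm f)\<^sup>2" by (simp add: norm_l2_sq power_mult_distrib)
  finally show "(norm (mult_op \<psi> f))\<^sup>2 \<le> (B * norm f)\<^sup>2" .
qed (use B in simp)

section \<open>The Hardy space as a subspace of \<open>L\<^sup>2\<close>\<close>

lemma boundary_function_cong_AE:
  assumes F: "boundary_function F f" and g: "g \<in> borel_measurable circle" and eq: "AE \<zeta> in circle. g \<zeta> = f \<zeta>"
  shows "boundary_function F g"
proof -
  have "AE \<zeta> in circle. ((\<lambda>r. F (complex_of_real r * \<zeta>)) \<longlongrightarrow> f \<zeta>) (at_left 1)"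
    using F by (simp add: boundary_function_def)
  with eq have "AE \<zeta> in circle. ((\<lambda>r. F (complex_of_real r * \<zeta>)) \<longlongrightarrow> g \<zeta>) (at_left 1)"
    by eventually_elim simp
  then show ?thesis using g by (simp add: boundary_function_def)
qed

lemma boundary_function_unique:
  assumes "boundary_function F f" "boundary_function F g"
  shows "AE \<zeta> in circle. f \<zeta> = g \<zeta>"
proof -
  have "AE \<zeta> in circle. ((\<lambda>r. F (complex_of_real r * \<zeta>)) \<longlongrightarrow> f \<zeta>) (at_left 1)"
       "AE \<zeta> in circle. ((\<lambda>r. F (complex_of_real r * \<zeta>)) \<longlongrightarrow> g \<zeta>) (at_left 1)"
    using assms by (simp_all add: boundary_function_def)
  then show ?thesis
    by eventually_elim (rule tendsto_unique, auto)
qed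

lemma eventually_at_left_1: "\<forall>\<^sub>F r in at_left (1::real). 0 < r \<and> r < 1"
  using eventually_at_left_real[of 0 "1::real"] by (simp add: greaterThanLessThan_iff)

text \<open>Applied with a disc this bounds boundary functions; applied with the closure of the range it
  keeps them away from every point outside this closure.\<close>

lemma boundary_values_in_closed_set:
  assumes F: "boundary_function F f" and S: "closed S" "F ` ball 0 1 \<subseteq> S"
  shows "AE \<zeta> in circle. f \<zeta> \<in> S"
proof -
  have "AE \<zeta> in circle. ((\<lambda>r. F (complex_of_real r * \<zeta>)) \<longlongrightarrow> f \<zeta>) (at_left 1)"
    using F by (simp add: boundary_function_def)
  then show ?thesis
  proof (rule AE_mp[OF _ AE_I2], intro impI)
    fix \<zeta> assume \<zeta>: "\<zeta> \<in> space circle" and lim: "((\<lambda>r. F (complex_of_real r * \<zeta>)) \<longlongrightarrow> f \<zeta>) (at_left 1)"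
    show "f \<zeta> \<in> S"
    proof (rule Lim_in_closed_set[OF S(1) _ _ lim])
      show "\<forall>\<^sub>F r in at_left 1. F (complex_of_real r * \<zeta>) \<in> S"
        using eventually_at_left_1 by eventually_elim (use \<zeta> S(2) in \<open>auto simp: norm_mult\<close>)
    qed simp
  qed
qed

lemma hardy_inf_ess_bounded:
  assumes F: "F \<in> hardy_inf" and f: "boundary_function F f"
  shows "ess_bounded f"
proof -
  obtain B where B: "\<forall>x\<in>F ` ball 0 1. norm x \<le> B"
    using F unfolding hardy_inf_def bounded_iff by blast
  have "AE \<zeta> in circle. f \<zeta> \<in> cball 0 B"
    using f by (rule boundary_values_in_closed_set) (use B in auto)
  then show ?thesis using f by (auto simp: ess_bounded_def boundary_function_def)
qed

lemma H2I:
  assumes F: "F \<in> hardy_two" and f: "boundary_function F f"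
  shows "abs_l2 f \<in> H2"
proof -
  have "boundary_function F (rep_l2 (abs_l2 f))"
    using f measurable_rep AE_rep_abs[OF hardy_two_boundary(1)[OF F f]] by (rule boundary_function_cong_AE)
  then show ?thesis using F by (auto simp: H2_def)
qed

lemma hardy_two_mult:
  assumes F: "F \<in> hardy_two" and G: "G \<in> hardy_inf"
  shows "(\<lambda>z. G z * F z) \<in> hardy_two"
proof -
  have hol: "F holomorphic_on ball 0 1" "G holomorphic_on ball 0 1" using F G by (auto simp: hardy_two_def hardy_inf_def)
  have hol': "(\<lambda>z. G z * F z) holomorphic_on ball 0 1" using hol by (intro holomorphic_intros)
  obtain B where "\<forall>x\<in>G ` ball 0 1. norm x \<le> B" using G unfolding hardy_inf_def bounded_iff by blast
  then have B: "norm (G z) \<le> B" if "norm z < 1" for z using that by simp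
  obtain C where C: "\<forall>r\<in>{0..<1}. (LINT \<zeta>|circle. (norm (F (complex_of_real r * \<zeta>)))\<^sup>2) \<le> C"
    using F by (auto simp: hardy_two_def)
  have "(LINT \<zeta>|circle. (norm (G (complex_of_real r * \<zeta>) * F (complex_of_real r * \<zeta>)))\<^sup>2) \<le> B\<^sup>2 * C"
    if r: "r \<in> {0..<1}" for r
  proof -
    have "(LINT \<zeta>|circle. (norm (G (complex_of_real r * \<zeta>) * F (complex_of_real r * \<zeta>)))\<^sup>2) 
        \<le> B\<^sup>2 * (LINT \<zeta>|circle. (norm (F (complex_of_real r * \<zeta>)))\<^sup>2)"
      by (rule square_integrable_mult_bounded(2)[OF measurable_dilate[OF hol(2)] AE_I2 square_integrable_dilate[OF hol(1)]])
         (use r in \<open>auto simp: norm_mult intro!: B\<close>)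
    also have "\<dots> \<le> B\<^sup>2 * C" using C r by (intro mult_left_mono) auto
    finally show ?thesis .
  qed
  then show ?thesis using hol' unfolding hardy_two_def by blast
qed

lemma hardy_two_add:
  assumes F: "F \<in> hardy_two" and G: "G \<in> hardy_two"
  shows "(\<lambda>z. F z + G z) \<in> hardy_two"
proof -
  have hol: "F holomorphic_on ball 0 1" "G holomorphic_on ball 0 1" using F G by (auto simp: hardy_two_def)
  have hol': "(\<lambda>z. F z + G z) holomorphic_on ball 0 1" using hol by (intro holomorphic_intros)
  obtain C D where C: "\<forall>r\<in>{0..<1}. (LINT \<zeta>|circle. (norm (F (complex_of_real r * \<zeta>)))\<^sup>2) \<le> C"
    and D: "\<forall>r\<in>{0..<1}. (LINT \<zeta>|circle. (norm (G (complex_of_real r * \<zeta>)))\<^sup>2) \<le> D"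
    using F G unfolding hardy_two_def by blast
  have "(LINT \<zeta>|circle. (norm (F (complex_of_real r * \<zeta>) + G (complex_of_real r * \<zeta>)))\<^sup>2) \<le> 2 * C + 2 * D"
    if r: "r \<in> {0..<1}" for r
  proof -
    let ?f = "\<lambda>\<zeta>. F (complex_of_real r * \<zeta>)" and ?g = "\<lambda>\<zeta>. G (complex_of_real r * \<zeta>)"
    have f: "square_integrable ?f" and g: "square_integrable ?g" using hol r by (auto intro!: square_integrable_dilate)
    have "(LINT \<zeta>|circle. (norm (?f \<zeta> + ?g \<zeta>))\<^sup>2) \<le> (LINT \<zeta>|circle. 2 * (norm (?f \<zeta>))\<^sup>2 + 2 * (norm (?g \<zeta>))\<^sup>2)"
    proof (rule integral_mono)
      fix \<zeta>
      have "(norm (?f \<zeta> + ?g \<zeta>))\<^sup>2 \<le> (norm (?f \<zeta>) + norm (?g \<zeta>))\<^sup>2"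
        by (intro power_mono norm_triangle_ineq norm_ge_zero)
      also have "\<dots> \<le> 2 * (norm (?f \<zeta>))\<^sup>2 + 2 * (norm (?g \<zeta>))\<^sup>2"
        using sum_squares_bound[of "norm (?f \<zeta>)" "norm (?g \<zeta>)"] by (simp add: power2_sum)
      finally show "(norm (?f \<zeta> + ?g \<zeta>))\<^sup>2 \<le> 2 * (norm (?f \<zeta>))\<^sup>2 + 2 * (norm (?g \<zeta>))\<^sup>2" .
    qed (use f g square_integrable_add[OF f g] in \<open>auto simp: square_integrable_def\<close>)
    also have "\<dots> = 2 * (LINT \<zeta>|circle. (norm (?f \<zeta>))\<^sup>2) + 2 * (LINT \<zeta>|circle. (norm (?g \<zeta>))\<^sup>2)"
      using f g by (simp add: square_integrable_def)
    also have "\<dots> \<le> 2 * C + 2 * D" using C D r by (intro add_mono mult_left_mono) auto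
    finally show ?thesis .
  qed
  then show ?thesis using hol' unfolding hardy_two_def by blast
qed

lemma H2_mult_op:
  assumes G: "G \<in> hardy_inf" and \<psi>: "boundary_function G \<psi>" and f: "f \<in> H2"
  shows "mult_op \<psi> f \<in> H2"
proof -
  obtain F where F: "F \<in> hardy_two" and bF: "boundary_function F (rep_l2 f)" using f by (auto simp: H2_def)
  have "AE \<zeta> in circle. ((\<lambda>r. F (complex_of_real r * \<zeta>)) \<longlongrightarrow> rep_l2 f \<zeta>) (at_left 1)"
       "AE \<zeta> in circle. ((\<lambda>r. G (complex_of_real r * \<zeta>)) \<longlongrightarrow> \<psi> \<zeta>) (at_left 1)"
    using bF \<psi> by (simp_all add: boundary_function_def)
  then have "AE \<zeta> in circle. ((\<lambda>r. G (complex_of_real r * \<zeta>) * F (complex_of_real r * \<zeta>)) \<longlongrightarrow> \<psi> \<zeta> * rep_l2 f \<zeta>) (at_left 1)"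
    by eventually_elim (intro tendsto_mult)
  then have "boundary_function (\<lambda>z. G z * F z) (\<lambda>\<zeta>. \<psi> \<zeta> * rep_l2 f \<zeta>)"
    using \<psi> by (simp add: boundary_function_def borel_measurable_times)
  then show ?thesis unfolding mult_op_def by (rule H2I[OF hardy_two_mult[OF F G]])
qed

lemma csubspace_H2: "csubspace H2"
  unfolding csubspace_def
proof (intro conjI ballI allI)
  have "(\<lambda>_. 0) \<in> hardy_two" by (auto simp: hardy_two_def)
  moreover have "boundary_function (\<lambda>_. 0) (\<lambda>_. 0)" by (simp add: boundary_function_def)
  ultimately show "0 \<in> H2" unfolding zero_l2_def by (rule H2I)
next
  fix f g assume "f \<in> H2" "g \<in> H2"
  then obtain F G where F: "F \<in> hardy_two" "boundary_function F (rep_l2 f)" 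
    and G: "G \<in> hardy_two" "boundary_function G (rep_l2 g)" by (auto simp: H2_def)
  have "AE \<zeta> in circle. ((\<lambda>r. F (complex_of_real r * \<zeta>)) \<longlongrightarrow> rep_l2 f \<zeta>) (at_left 1)"
       "AE \<zeta> in circle. ((\<lambda>r. G (complex_of_real r * \<zeta>)) \<longlongrightarrow> rep_l2 g \<zeta>) (at_left 1)"
    using F G by (simp_all add: boundary_function_def)
  then have "AE \<zeta> in circle. ((\<lambda>r. F (complex_of_real r * \<zeta>) + G (complex_of_real r * \<zeta>)) \<longlongrightarrow> rep_l2 f \<zeta> + rep_l2 g \<zeta>) (at_left 1)"
    by eventually_elim (intro tendsto_add)
  then have "boundary_function (\<lambda>z. F z + G z) (\<lambda>\<zeta>. rep_l2 f \<zeta> + rep_l2 g \<zeta>)"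
    by (simp add: boundary_function_def)
  then show "f + g \<in> H2" unfolding plus_l2_def map_fun_apply by (rule H2I[OF hardy_two_add[OF F(1) G(1)]])
next
  fix c f assume f: "f \<in> H2"
  have "(\<lambda>_. c) \<in> hardy_inf" by (auto simp: hardy_inf_def bounded_iff)
  moreover have "boundary_function (\<lambda>_. c) (\<lambda>_. c)" by (simp add: boundary_function_def)
  ultimately have "mult_op (\<lambda>_. c) f \<in> H2" using f by (rule H2_mult_op)
  then show "c *\<^sub>c f \<in> H2" by (simp add: mult_op_def cscale_def)
qed

text \<open>The difference between \<open>f\<close> and the boundary function with the same nonnegative Fourier coefficients is
  orthogonal to the monomials, hence to all of \<open>H\<^sup>2\<close>.\<close>

lemma riesz_decomposition: "\<exists>h\<in>H2. f - h \<in> ortho_compl H2"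
proof -
  obtain F h where F: "F \<in> hardy_two" "boundary_function F h" and h: "square_integrable h"
    and c: "\<And>n. fourier_coeff h n = fourier_coeff (rep_l2 f) n"
    using riesz_projection[OF square_integrable_rep[of f]] by blast
  define k where "k \<zeta> = rep_l2 f \<zeta> - h \<zeta>" for \<zeta>
  have k: "square_integrable k" unfolding k_def[abs_def] by (intro square_integrable_diff square_integrable_rep h)
  have [measurable]: "k \<in> borel_measurable circle" using k by (simp add: square_integrable_def)
  have k0: "(LINT \<zeta>|circle. \<zeta> ^ n * cnj (k \<zeta>)) = 0" for n
  proof -
    have "(LINT \<zeta>|circle. k \<zeta> * cnj \<zeta> ^ n) = fourier_coeff (rep_l2 f) n - fourier_coeff h n"
      unfolding k_def fourier_coeff_def
      using square_integrable_mult_power[OF square_integrable_rep[of f], of n] square_integrable_mult_power[OF h, of n]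
      by (simp add: left_diff_distrib)
    then have "(LINT \<zeta>|circle. cnj (k \<zeta> * cnj \<zeta> ^ n)) = 0"
      by (subst Bochner_Integration.integral_cnj) (simp add: c)
    then show ?thesis by (simp add: mult.commute)
  qed
  have AE_k: "AE \<zeta> in circle. rep_l2 (f - abs_l2 h) \<zeta> = k \<zeta>"
    using AE_rep_minus[of f "abs_l2 h"] AE_rep_abs[OF h] by eventually_elim (simp add: k_def)
  have "cinner (f - abs_l2 h) g = 0" if g: "g \<in> H2" for g
  proof -
    obtain G where G: "G \<in> hardy_two" "boundary_function G (rep_l2 g)" using g by (auto simp: H2_def)
    have "cinner g (f - abs_l2 h) = (LINT \<zeta>|circle. rep_l2 g \<zeta> * cnj (k \<zeta>))"
    proof (rule cinner_eqI)
      show "AE \<zeta> in circle. rep_l2 g \<zeta> * cnj (rep_l2 (f - abs_l2 h) \<zeta>) = rep_l2 g \<zeta> * cnj (k \<zeta>)"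
        using AE_k by eventually_elim simp
    qed measurable
    also have "\<dots> = 0" by (rule hardy_two_orthogonal[OF G k k0])
    finally show ?thesis using cinner_eq_0_commute by blast
  qed
  then have "f - abs_l2 h \<in> ortho_compl H2" by (simp add: ortho_compl_def)
  then show ?thesis using H2I[OF F] by blast
qed

section \<open>Dual Toeplitz operators and the model space\<close>

abbreviation riesz_proj :: "l2 \<Rightarrow> l2" where "riesz_proj \<equiv> ortho_proj H2"

lemma riesz_proj_eqI: "h \<in> H2 \<Longrightarrow> f - h \<in> ortho_compl H2 \<Longrightarrow> riesz_proj f = h"
  by (rule ortho_proj_eqI[OF csubspace_H2])

lemma riesz_proj: "riesz_proj f \<in> H2" "f - riesz_proj f \<in> ortho_compl H2"
proof -
  obtain h where h: "h \<in> H2" "f - h \<in> ortho_compl H2" using riesz_decomposition by blast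
  then have "riesz_proj f = h" by (rule riesz_proj_eqI)
  then show "riesz_proj f \<in> H2" "f - riesz_proj f \<in> ortho_compl H2" using h by simp_all
qed

lemma riesz_proj_add: "riesz_proj (f + g) = riesz_proj f + riesz_proj g"
proof (rule riesz_proj_eqI)
  show "riesz_proj f + riesz_proj g \<in> H2"
    using riesz_proj(1) csubspace_H2 by (simp add: csubspace_def)
  have "(f - riesz_proj f) + (g - riesz_proj g) \<in> ortho_compl H2"
    using riesz_proj(2) csubspace_ortho_compl[of H2] unfolding csubspace_def by blast
  then show "f + g - (riesz_proj f + riesz_proj g) \<in> ortho_compl H2" by (simp add: algebra_simps)
qed

lemma riesz_proj_cscale: "riesz_proj (c *\<^sub>c f) = c *\<^sub>c riesz_proj f"
proof (rule riesz_proj_eqI)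
  show "c *\<^sub>c riesz_proj f \<in> H2"
    using riesz_proj(1) csubspace_H2 by (simp add: csubspace_def)
  have "c *\<^sub>c (f - riesz_proj f) \<in> ortho_compl H2"
    using riesz_proj(2) csubspace_ortho_compl[of H2] unfolding csubspace_def by blast
  then show "c *\<^sub>c f - c *\<^sub>c riesz_proj f \<in> ortho_compl H2" by (simp add: cscale_diff)
qed

lemma riesz_proj_sum: 
  assumes "g \<in> ortho_compl H2" "h \<in> H2" shows "riesz_proj (g + h) = h"
  using assms by (intro riesz_proj_eqI) auto

lemma norm_riesz_proj_le: "norm (riesz_proj f) \<le> norm f"
proof (cases "riesz_proj f = 0")
  case False
  have "cinner (f - riesz_proj f) (riesz_proj f) = 0"
    using riesz_proj[of f] by (simp add: ortho_compl_def)
  then have "inner (riesz_proj f) (riesz_proj f) = inner f (riesz_proj f)"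
    by (simp add: inner_l2_def cinner_diff_left)
  also have "\<dots> \<le> norm f * norm (riesz_proj f)" by (rule norm_cauchy_schwarz)
  finally show ?thesis using False by (simp add: power2_norm_eq_inner[symmetric] power2_eq_square)
qed simp

text \<open>Restricted to the orthogonal complement of \<open>H\<^sup>2\<close> this is the dual Toeplitz operator with symbol \<open>\<psi>\<close>.\<close>

definition dual_toeplitz :: "(complex \<Rightarrow> complex) \<Rightarrow> l2 \<Rightarrow> l2" where
  "dual_toeplitz \<psi> f = mult_op \<psi> f - riesz_proj (mult_op \<psi> f)"

lemma dual_toeplitz_in: "dual_toeplitz \<psi> f \<in> ortho_compl H2"
  unfolding dual_toeplitz_def by (rule riesz_proj(2))

text \<open>Multiplication by \<open>\<psi>\<close> preserves \<open>H\<^sup>2\<close>, so the part of \<open>\<xi> g\<close> that the inner projection removes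
  is carried into \<open>H\<^sup>2\<close> and removed again by the outer one.\<close>

lemma dual_toeplitz_inverse:
  assumes \<psi>: "ess_bounded \<psi>" and \<xi>: "ess_bounded \<xi>" and one: "AE \<zeta> in circle. \<psi> \<zeta> * \<xi> \<zeta> = 1"
    and H2: "\<And>h. h \<in> H2 \<Longrightarrow> mult_op \<psi> h \<in> H2" and g: "g \<in> ortho_compl H2"
  shows "dual_toeplitz \<psi> (dual_toeplitz \<xi> g) = g"
proof -
  define p where "p = riesz_proj (mult_op \<xi> g)"
  have pH: "mult_op \<psi> p \<in> H2" unfolding p_def by (intro H2 riesz_proj)
  have "mult_op \<psi> (mult_op \<xi> g) = g"
    unfolding mult_op_mult_op[OF \<psi> \<xi>] by (rule mult_op_one[OF ess_bounded_mult[OF \<psi> \<xi>] one])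
  then have eq: "mult_op \<psi> (dual_toeplitz \<xi> g) = g - mult_op \<psi> p"
    unfolding dual_toeplitz_def mult_op_diff[OF \<psi>] p_def by simp
  have "riesz_proj (g - mult_op \<psi> p) = 0 - mult_op \<psi> p"
  proof (rule riesz_proj_eqI)
    show "0 - mult_op \<psi> p \<in> H2"
      using csubspace_H2 pH by (intro csubspace_diff) (auto simp: csubspace_def)
  qed (use g in simp)
  then show ?thesis unfolding dual_toeplitz_def[of \<psi>] eq by simp
qed

lemma mult_op_commute:
  assumes "ess_bounded \<psi>" "ess_bounded \<xi>"
  shows "mult_op \<psi> (mult_op \<xi> f) = mult_op \<xi> (mult_op \<psi> f)"
  unfolding mult_op_mult_op[OF assms] mult_op_mult_op[OF assms(2,1)] by (simp only: mult.commute)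

text \<open>The properties of the boundary function of an inner function that matter for the geometry of
  the model space.\<close>

locale inner_symbol =
  fixes \<theta> :: "complex \<Rightarrow> complex"
  assumes bounded: "ess_bounded \<theta>" and unimodular: "AE \<zeta> in circle. norm (\<theta> \<zeta>) = 1"
    and H2_invariant: "h \<in> H2 \<Longrightarrow> mult_op \<theta> h \<in> H2"
begin

abbreviation "cnj_symbol \<equiv> (\<lambda>\<zeta>. cnj (\<theta> \<zeta>))"

lemma cnj_mult: "mult_op cnj_symbol (mult_op \<theta> f) = f" "mult_op \<theta> (mult_op cnj_symbol f) = f"
proof -
  have "AE \<zeta> in circle. \<theta> \<zeta> * cnj (\<theta> \<zeta>) = 1"
    using unimodular by eventually_elim (simp add: complex_norm_square[symmetric])
  then show 1: "mult_op \<theta> (mult_op cnj_symbol f) = f"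
    unfolding mult_op_mult_op[OF bounded ess_bounded_cnj[OF bounded]]
    by (intro mult_op_one ess_bounded_mult ess_bounded_cnj bounded)
  then show "mult_op cnj_symbol (mult_op \<theta> f) = f"
    by (simp add: mult_op_commute[OF bounded ess_bounded_cnj[OF bounded]])
qed

lemma cinner_mult_right: "cinner f (mult_op \<theta> g) = cinner (mult_op cnj_symbol f) g"
  using cinner_mult_op[OF ess_bounded_cnj[OF bounded], of f g] by simp

text \<open>This is \<open>(K\<^sub>\<theta>)\<^sup>\<bottom> = (H\<^sup>2)\<^sup>\<bottom> \<oplus> \<theta> H\<^sup>2\<close>. For the inclusion from left to right, the projections of \<open>f\<close> and of
  \<open>cnj \<theta> f\<close> to \<open>H\<^sup>2\<close> give the components of \<open>f\<close> in the two summands; the remainder \<open>q\<close> lies in the model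
  space and is orthogonal to itself.\<close>

lemma model_perp_decomposition:
  "f \<in> model_perp \<theta> \<longleftrightarrow> (\<exists>g\<in>ortho_compl H2. \<exists>h\<in>H2. f = g + mult_op \<theta> h)"
proof
  assume f: "f \<in> model_perp \<theta>"
  define p where "p = riesz_proj f"
  define h where "h = riesz_proj (mult_op cnj_symbol f)"
  define g where "g = f - p"
  define q where "q = p - mult_op \<theta> h"
  have p: "p \<in> H2" and g: "g \<in> ortho_compl H2" unfolding p_def g_def by (rule riesz_proj)+
  have h: "h \<in> H2" "mult_op cnj_symbol f - h \<in> ortho_compl H2" unfolding h_def by (rule riesz_proj)+
  have qH: "q \<in> H2" unfolding q_def by (intro csubspace_diff csubspace_H2 p H2_invariant h)
  have qorth: "cinner q (mult_op \<theta> k) = 0" if k: "k \<in> H2" for k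
  proof -
    have "q = mult_op \<theta> (mult_op cnj_symbol f - h) - g"
      by (simp add: mult_op_diff[OF bounded] cnj_mult q_def g_def)
    then have "cinner q (mult_op \<theta> k) = cinner (mult_op \<theta> (mult_op cnj_symbol f - h)) (mult_op \<theta> k) - cinner g (mult_op \<theta> k)"
      by (simp add: cinner_diff_left)
    also have "cinner g (mult_op \<theta> k) = 0" using g H2_invariant[OF k] by (simp add: ortho_compl_def)
    also have "cinner (mult_op \<theta> (mult_op cnj_symbol f - h)) (mult_op \<theta> k) = cinner (mult_op cnj_symbol f - h) k"
      by (simp add: cinner_mult_right cnj_mult)
    also have "\<dots> = 0" using h(2) k by (simp add: ortho_compl_def)
    finally show ?thesis by simp
  qed
  have "q \<in> model_space \<theta>" using qH qorth by (auto simp: model_space_def ortho_compl_def)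
  then have "cinner f q = 0" using f by (simp add: model_perp_def ortho_compl_def)
  moreover have "cinner g q = 0" using g qH by (simp add: ortho_compl_def)
  moreover have "cinner (mult_op \<theta> h) q = 0" using qorth[OF h(1)] cinner_eq_0_commute by blast
  ultimately have "cinner (f - g - mult_op \<theta> h) q = 0" by (simp add: cinner_diff_left)
  moreover have "f - g - mult_op \<theta> h = q" by (simp add: q_def g_def)
  ultimately have "q = 0" by (simp add: cinner_self_eq_0_iff)
  then have "f = g + mult_op \<theta> h" by (simp add: q_def g_def)
  then show "\<exists>g\<in>ortho_compl H2. \<exists>h\<in>H2. f = g + mult_op \<theta> h" using g h by blast
next
  assume "\<exists>g\<in>ortho_compl H2. \<exists>h\<in>H2. f = g + mult_op \<theta> h"
  then obtain g h where g: "g \<in> ortho_compl H2" and h: "h \<in> H2" and f: "f = g + mult_op \<theta> h" by blast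
  have "cinner f q = 0" if q: "q \<in> model_space \<theta>" for q
  proof -
    have "cinner q (mult_op \<theta> h) = 0" using q h by (simp add: model_space_def ortho_compl_def)
    then have "cinner (mult_op \<theta> h) q = 0" using cinner_eq_0_commute by blast
    moreover have "cinner g q = 0" using g q by (simp add: model_space_def ortho_compl_def)
    ultimately show ?thesis by (simp add: f cinner_add_left)
  qed
  then show "f \<in> model_perp \<theta>" by (simp add: model_perp_def ortho_compl_def)
qed

text \<open>On \<open>\<theta> H\<^sup>2\<close> the symbol acts by multiplication, as it preserves \<open>H\<^sup>2\<close>. For \<open>g\<close> orthogonal to \<open>H\<^sup>2\<close> the part of
  \<open>\<phi> g\<close> in \<open>H\<^sup>2\<close> is orthogonal to \<open>\<theta> H\<^sup>2\<close>, since \<open>\<langle>\<phi> g, \<theta> k\<rangle> = \<langle>cnj \<theta> \<phi> g, k\<rangle> = 0\<close>; so it lies in the model space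
  and the projection discards it. The operator is therefore diagonal in the decomposition.\<close>

lemma dual_tto_decomposition:
  assumes \<phi>: "ess_bounded \<phi>" and \<phi>H2: "\<And>h. h \<in> H2 \<Longrightarrow> mult_op \<phi> h \<in> H2"
    and co: "\<And>g. g \<in> ortho_compl H2 \<Longrightarrow> mult_op (\<lambda>\<zeta>. cnj (\<theta> \<zeta>) * \<phi> \<zeta>) g \<in> ortho_compl H2"
    and g: "g \<in> ortho_compl H2" and h: "h \<in> H2"
  shows "dual_tto \<theta> \<phi> (g + mult_op \<theta> h) = dual_toeplitz \<phi> g + mult_op \<theta> (mult_op \<phi> h)"
  unfolding dual_tto_def
proof (rule ortho_proj_eqI)
  show "csubspace (model_perp \<theta>)" unfolding model_perp_def by (rule csubspace_ortho_compl)
  show "dual_toeplitz \<phi> g + mult_op \<theta> (mult_op \<phi> h) \<in> model_perp \<theta>"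
    unfolding model_perp_decomposition using dual_toeplitz_in \<phi>H2[OF h] by blast
  define q where "q = riesz_proj (mult_op \<phi> g)"
  have q: "q \<in> H2" "mult_op \<phi> g - q \<in> ortho_compl H2" unfolding q_def by (rule riesz_proj)+
  have "cinner q (mult_op \<theta> k) = 0" if k: "k \<in> H2" for k
  proof -
    have "cinner (mult_op \<phi> g - q) (mult_op \<theta> k) = 0" using q(2) H2_invariant[OF k] by (simp add: ortho_compl_def)
    moreover have "cinner (mult_op \<phi> g) (mult_op \<theta> k) = cinner (mult_op (\<lambda>\<zeta>. cnj (\<theta> \<zeta>) * \<phi> \<zeta>) g) k"
      unfolding cinner_mult_right mult_op_mult_op[OF ess_bounded_cnj[OF bounded] \<phi>] ..
    moreover have "\<dots> = 0" using co[OF g] k by (simp add: ortho_compl_def)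
    ultimately show ?thesis by (simp add: cinner_diff_left)
  qed
  then have qK: "q \<in> model_space \<theta>" using q(1) by (auto simp: model_space_def ortho_compl_def)
  have "mult_op \<phi> (g + mult_op \<theta> h) - (dual_toeplitz \<phi> g + mult_op \<theta> (mult_op \<phi> h)) = q"
    by (simp add: mult_op_add[OF \<phi>] dual_toeplitz_def q_def mult_op_commute[OF \<phi> bounded])
  moreover have "q \<in> ortho_compl (model_perp \<theta>)"
    unfolding ortho_compl_def
  proof (intro CollectI ballI)
    fix x assume "x \<in> model_perp \<theta>"
    then have "cinner x q = 0" using qK by (simp add: model_perp_def ortho_compl_def)
    then show "cinner q x = 0" using cinner_eq_0_commute by blast
  qed
  ultimately show "mult_op \<phi> (g + mult_op \<theta> h) - (dual_toeplitz \<phi> g + mult_op \<theta> (mult_op \<phi> h)) 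
    \<in> ortho_compl (model_perp \<theta>)" by simp
qed

text \<open>Supplies the candidate for the resolvent. It is in general not the dual truncated Toeplitz
  operator with symbol \<open>\<psi>\<close>, because \<open>cnj \<theta> \<psi>\<close> need not be conjugate analytic.\<close>

lemma block_diagonal_operator_bounded:
  assumes \<psi>: "ess_bounded \<psi>" and \<psi>H2: "\<And>h. h \<in> H2 \<Longrightarrow> mult_op \<psi> h \<in> H2"
  defines "S \<equiv> \<lambda>f. dual_toeplitz \<psi> (f - riesz_proj f) + mult_op \<psi> (riesz_proj f)"
  shows "bounded_operator_on (model_perp \<theta>) S"
    and "\<And>g h. g \<in> ortho_compl H2 \<Longrightarrow> h \<in> H2 \<Longrightarrow> 
           S (g + mult_op \<theta> h) = dual_toeplitz \<psi> g + mult_op \<theta> (mult_op \<psi> h)"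
proof -
  show S: "S (g + mult_op \<theta> h) = dual_toeplitz \<psi> g + mult_op \<theta> (mult_op \<psi> h)"
    if "g \<in> ortho_compl H2" "h \<in> H2" for g h
    unfolding S_def riesz_proj_sum[OF that(1) H2_invariant[OF that(2)]]
    by (simp add: mult_op_commute[OF \<psi> bounded])
  show "bounded_operator_on (model_perp \<theta>) S"
    unfolding bounded_operator_on_def
  proof (intro conjI ballI allI)
    fix f assume "f \<in> model_perp \<theta>"
    then show "S f \<in> model_perp \<theta>"
      unfolding model_perp_decomposition using S dual_toeplitz_in \<psi>H2 by metis
  next
    fix f g
    have split: "f + g - (riesz_proj f + riesz_proj g) = (f - riesz_proj f) + (g - riesz_proj g)" by simp
    show "S (f + g) = S f + S g"
      unfolding S_def dual_toeplitz_def riesz_proj_add split mult_op_add[OF \<psi>] by (simp add: algebra_simps)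
  next
    fix c f
    show "S (c *\<^sub>c f) = c *\<^sub>c S f"
      unfolding S_def dual_toeplitz_def
      by (simp only: riesz_proj_cscale cscale_diff[symmetric] mult_op_cscale[OF \<psi>] cscale_add)
  next
    obtain B where "AE \<zeta> in circle. norm (\<psi> \<zeta>) \<le> B" and m: "\<psi> \<in> borel_measurable circle"
      using \<psi> by (auto simp: ess_bounded_def)
    then have "AE \<zeta> in circle. norm (\<psi> \<zeta>) \<le> \<bar>B\<bar>" by (auto elim: eventually_mono)
    then have B: "norm (mult_op \<psi> f) \<le> \<bar>B\<bar> * norm f" for f using norm_mult_op_le[OF m] by simp
    have "norm (S f) \<le> 5 * \<bar>B\<bar> * norm f" for f
    proof -
      let ?g = "f - riesz_proj f"
      have "norm ?g \<le> 2 * norm f"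
        using norm_triangle_ineq4[of f "riesz_proj f"] norm_riesz_proj_le[of f] by simp
      then have 1: "norm (mult_op \<psi> ?g) \<le> \<bar>B\<bar> * (2 * norm f)"
        using B[of ?g] mult_left_mono[of "norm ?g" "2 * norm f" "\<bar>B\<bar>"] by simp
      have 2: "norm (mult_op \<psi> (riesz_proj f)) \<le> \<bar>B\<bar> * norm f"
        using B[of "riesz_proj f"] mult_left_mono[OF norm_riesz_proj_le[of f], of "\<bar>B\<bar>"] by simp
      have 3: "norm (dual_toeplitz \<psi> ?g) \<le> 2 * norm (mult_op \<psi> ?g)"
        using norm_triangle_ineq4[of "mult_op \<psi> ?g" "riesz_proj (mult_op \<psi> ?g)"] norm_riesz_proj_le[of "mult_op \<psi> ?g"]
        by (simp add: dual_toeplitz_def)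
      show ?thesis using norm_triangle_ineq[of "dual_toeplitz \<psi> ?g" "mult_op \<psi> (riesz_proj f)"] 1 2 3
        by (simp add: S_def)
    qed
    then show "\<exists>C. \<forall>f\<in>model_perp \<theta>. norm (S f) \<le> C * norm f" by blast
  qed
qed

end

section \<open>Resolvents and eigenvectors\<close>

lemma dual_toeplitz_minus_const:
  assumes \<psi>: "ess_bounded \<psi>" and \<xi>: "ess_bounded \<xi>" and eq: "AE \<zeta> in circle. \<xi> \<zeta> = \<psi> \<zeta> - \<mu>" 
    and g: "g \<in> ortho_compl H2"
  shows "dual_toeplitz \<xi> g = dual_toeplitz \<psi> g - \<mu> *\<^sub>c g"
proof -
  have "riesz_proj (mult_op \<psi> g - \<mu> *\<^sub>c g) = riesz_proj (mult_op \<psi> g)"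
  proof (rule riesz_proj_eqI)
    have "\<mu> *\<^sub>c g \<in> ortho_compl H2" using g csubspace_ortho_compl[of H2] by (simp add: csubspace_def)
    then have "(mult_op \<psi> g - riesz_proj (mult_op \<psi> g)) - \<mu> *\<^sub>c g \<in> ortho_compl H2"
      using riesz_proj csubspace_ortho_compl csubspace_diff by blast
    then show "mult_op \<psi> g - \<mu> *\<^sub>c g - riesz_proj (mult_op \<psi> g) \<in> ortho_compl H2" by (simp add: algebra_simps)
  qed (rule riesz_proj)
  then show ?thesis unfolding dual_toeplitz_def mult_op_minus_const[OF \<psi> \<xi> eq] by simp
qed

text \<open>Near \<open>w\<close> the quotient is bounded by compactness, elsewhere because \<open>\<phi>\<close> is bounded and the denominator is bounded below.\<close>

lemma hardy_inf_difference_quotient: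
  assumes \<phi>: "\<phi> \<in> hardy_inf" and w: "norm w < 1"
  defines "Q \<equiv> \<lambda>z. if z = w then deriv \<phi> w else (\<phi> z - \<phi> w) / (z - w)"
  shows "Q \<in> hardy_inf"
proof -
  have hol: "\<phi> holomorphic_on ball 0 1" using \<phi> by (simp add: hardy_inf_def)
  then have Q: "Q holomorphic_on ball 0 1" unfolding Q_def by (rule pole_lemma_open) simp
  obtain B where "\<forall>x\<in>\<phi> ` ball 0 1. norm x \<le> B" using \<phi> unfolding hardy_inf_def bounded_iff by blast
  then have B: "norm (\<phi> z) \<le> B" if "norm z < 1" for z using that by simp
  define d where "d = (1 - norm w) / 2"
  have d: "d > 0" using w by (simp add: d_def)
  have sub: "cball w d \<subseteq> ball 0 1"
  proof
    fix z assume "z \<in> cball w d"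
    then have "norm (z - w) \<le> d" by (simp add: dist_norm norm_minus_commute)
    then have "norm z \<le> norm w + d" using norm_triangle_ineq2[of z w] by simp
    then show "z \<in> ball 0 1" using w by (simp add: d_def field_simps)
  qed
  have "compact (Q ` cball w d)"
    using Q sub by (intro compact_continuous_image holomorphic_on_imp_continuous_on) (auto intro: holomorphic_on_subset)
  then obtain A where A: "\<forall>x\<in>Q ` cball w d. norm x \<le> A" using compact_imp_bounded bounded_iff by metis
  have "norm (Q z) \<le> max A (2 * B / d)" if z: "norm z < 1" for z
  proof (cases "z \<in> cball w d")
    case True
    then show ?thesis using A by (simp add: le_max_iff_disj)
  next
    case False
    then have zw: "norm (z - w) > d" by (simp add: dist_norm norm_minus_commute)
    have "norm (Q z) = norm (\<phi> z - \<phi> w) / norm (z - w)" using False d by (auto simp: Q_def norm_divide)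
    also have "\<dots> \<le> (2 * B) / d"
      using zw d norm_triangle_ineq4[of "\<phi> z" "\<phi> w"] B[OF z] B[OF w] order_trans[OF norm_ge_zero B[OF w]]
      by (intro frac_le) auto
    finally show ?thesis by simp
  qed
  then have "\<forall>x\<in>Q ` ball 0 1. norm x \<le> max A (2 * B / d)" by simp
  then have "bounded (Q ` ball 0 1)" unfolding bounded_iff by blast
  then show ?thesis using Q by (simp add: hardy_inf_def)
qed

lemma boundary_difference_quotient:
  assumes \<phi>: "boundary_function \<phi> \<phi>'" and w: "norm w < 1"
  defines "Q \<equiv> \<lambda>z. if z = w then deriv \<phi> w else (\<phi> z - \<phi> w) / (z - w)"
  shows "boundary_function Q (\<lambda>\<zeta>. (\<phi>' \<zeta> - \<phi> w) / (\<zeta> - w))"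
proof -
  have [measurable]: "\<phi>' \<in> borel_measurable circle" using \<phi> by (simp add: boundary_function_def)
  have "AE \<zeta> in circle. ((\<lambda>r. \<phi> (complex_of_real r * \<zeta>)) \<longlongrightarrow> \<phi>' \<zeta>) (at_left 1)"
    using \<phi> by (simp add: boundary_function_def)
  then have "AE \<zeta> in circle. ((\<lambda>r. Q (complex_of_real r * \<zeta>)) \<longlongrightarrow> (\<phi>' \<zeta> - \<phi> w) / (\<zeta> - w)) (at_left 1)"
  proof (rule AE_mp[OF _ AE_I2], intro impI)
    fix \<zeta> assume "\<zeta> \<in> space circle" and lim: "((\<lambda>r. \<phi> (complex_of_real r * \<zeta>)) \<longlongrightarrow> \<phi>' \<zeta>) (at_left 1)"
    then have \<zeta>: "norm \<zeta> = 1" by simp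
    have nz: "\<zeta> - w \<noteq> 0" using \<zeta> w by auto
    have "((\<lambda>r. complex_of_real r * \<zeta>) \<longlongrightarrow> complex_of_real 1 * \<zeta>) (at_left 1)" by (intro tendsto_intros)
    then have "((\<lambda>r. (\<phi> (complex_of_real r * \<zeta>) - \<phi> w) / (complex_of_real r * \<zeta> - w)) \<longlongrightarrow> (\<phi>' \<zeta> - \<phi> w) / (\<zeta> - w)) (at_left 1)"
      using lim nz by (intro tendsto_divide tendsto_diff tendsto_const) auto
    moreover have "\<forall>\<^sub>F r in at_left 1. (\<phi> (complex_of_real r * \<zeta>) - \<phi> w) / (complex_of_real r * \<zeta> - w) = Q (complex_of_real r * \<zeta>)"
      using eventually_at_left_real[OF w]
    proof eventually_elim
      fix r assume "r \<in> {norm w<..<1}"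
      then have "norm w < r" by simp
      moreover from this have "0 < r" using norm_ge_zero[of w] by (rule le_less_trans[rotated])
      ultimately have "norm (complex_of_real r * \<zeta>) \<noteq> norm w" using \<zeta> by (simp add: norm_mult)
      then show "(\<phi> (complex_of_real r * \<zeta>) - \<phi> w) / (complex_of_real r * \<zeta> - w) = Q (complex_of_real r * \<zeta>)"
        by (auto simp: Q_def)
    qed
    ultimately show "((\<lambda>r. Q (complex_of_real r * \<zeta>)) \<longlongrightarrow> (\<phi>' \<zeta> - \<phi> w) / (\<zeta> - w)) (at_left 1)"
      by (rule Lim_transform_eventually)
  qed
  then show ?thesis by (simp add: boundary_function_def)
qed

lemma cauchy_kernel_l2:
  assumes w: "norm w < 1"
  defines "e \<equiv> abs_l2 (\<lambda>\<zeta>. 1 / (\<zeta> - w))"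
  shows "e \<in> ortho_compl H2" "e \<noteq> 0"
proof -
  note sq = cauchy_kernel_orthogonal(1)[OF w]
  have ae: "AE \<zeta> in circle. rep_l2 e \<zeta> = 1 / (\<zeta> - w)" unfolding e_def by (rule AE_rep_abs[OF sq])
  have "cinner e g = 0" if g: "g \<in> H2" for g
  proof -
    obtain G where G: "G \<in> hardy_two" "boundary_function G (rep_l2 g)" using g by (auto simp: H2_def)
    have "cinner g e = (LINT \<zeta>|circle. rep_l2 g \<zeta> * cnj (1 / (\<zeta> - w)))"
    proof (rule cinner_eqI)
      show "AE \<zeta> in circle. rep_l2 g \<zeta> * cnj (rep_l2 e \<zeta>) = rep_l2 g \<zeta> * cnj (1 / (\<zeta> - w))"
        using ae by eventually_elim simp
    qed measurable
    also have "\<dots> = 0" by (rule hardy_two_orthogonal[OF G sq cauchy_kernel_orthogonal(2)[OF w]])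
    finally show ?thesis using cinner_eq_0_commute by blast
  qed
  then show "e \<in> ortho_compl H2" by (simp add: ortho_compl_def)
  show "e \<noteq> 0"
  proof
    assume "e = 0"
    then have "AE \<zeta> in circle. 1 / (\<zeta> - w) = 0" using ae AE_rep_zero by (auto elim: AE_mp)
    moreover have "AE \<zeta> in circle. 1 / (\<zeta> - w) \<noteq> 0" using w by (intro AE_I2) auto
    ultimately have "AE \<zeta> in circle. False" by eventually_elim simp
    then have "(LINT \<zeta>|circle. 1 :: real) = (LINT \<zeta>|circle. 0)"
      by (intro integral_cong_AE) auto
    then show False by simp
  qed
qed

text \<open>Multiplying the Cauchy kernel by \<open>\<phi>\<close> gives \<open>\<phi> w\<close> times the kernel plus the difference quotient of \<open>\<phi>\<close>
  at \<open>w\<close>, which lies in \<open>H\<^sup>2\<close> and is projected away.\<close>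

lemma dual_toeplitz_eigenvector:
  assumes \<phi>: "\<phi> \<in> hardy_inf" and \<phi>': "boundary_function \<phi> \<phi>'" and w: "norm w < 1"
  defines "e \<equiv> abs_l2 (\<lambda>\<zeta>. 1 / (\<zeta> - w))"
  shows "dual_toeplitz \<phi>' e = \<phi> w *\<^sub>c e"
proof -
  define q where "q \<zeta> = (\<phi>' \<zeta> - \<phi> w) / (\<zeta> - w)" for \<zeta>
  have eb: "ess_bounded \<phi>'" by (rule hardy_inf_ess_bounded[OF \<phi> \<phi>'])
  note Q = hardy_inf_difference_quotient[OF \<phi> w] boundary_difference_quotient[OF \<phi>' w, folded q_def]
  have qH: "abs_l2 q \<in> H2" by (rule H2I) (use Q hardy_inf_subset_hardy_two in \<open>auto simp: q_def[abs_def]\<close>)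
  have qsq: "square_integrable q" 
    by (rule hardy_two_boundary(1)) (use Q hardy_inf_subset_hardy_two in \<open>auto simp: q_def[abs_def]\<close>)
  have ae: "AE \<zeta> in circle. rep_l2 e \<zeta> = 1 / (\<zeta> - w)" unfolding e_def
    by (rule AE_rep_abs[OF cauchy_kernel_orthogonal(1)[OF w]])
  have eq: "mult_op \<phi>' e - abs_l2 q = \<phi> w *\<^sub>c e"
  proof (rule l2_eqI)
    show "AE \<zeta> in circle. rep_l2 (mult_op \<phi>' e - abs_l2 q) \<zeta> = rep_l2 (\<phi> w *\<^sub>c e) \<zeta>"
      using AE_rep_minus[of "mult_op \<phi>' e" "abs_l2 q"] AE_rep_mult[OF eb, of e] AE_rep_abs[OF qsq] 
        AE_rep_cscale[of "\<phi> w" e] ae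
      by eventually_elim (simp add: q_def diff_divide_distrib)
  qed
  have "\<phi> w *\<^sub>c e \<in> ortho_compl H2"
    using cauchy_kernel_l2(1)[OF w] csubspace_ortho_compl[of H2] by (simp add: csubspace_def e_def)
  then have "riesz_proj (mult_op \<phi>' e) = abs_l2 q" using eq qH by (intro riesz_proj_eqI) auto
  then show ?thesis using eq by (simp add: dual_toeplitz_def)
qed

lemma resolvent_symbol:
  assumes \<phi>: "\<phi> \<in> hardy_inf" and \<phi>': "boundary_function \<phi> \<phi>'" and \<mu>: "\<mu> \<notin> closure (\<phi> ` ball 0 1)"
  shows "(\<lambda>z. 1 / (\<phi> z - \<mu>)) \<in> hardy_inf"
    and "boundary_function (\<lambda>z. 1 / (\<phi> z - \<mu>)) (\<lambda>\<zeta>. 1 / (\<phi>' \<zeta> - \<mu>))"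
    and "AE \<zeta> in circle. \<phi>' \<zeta> \<noteq> \<mu>"
proof -
  have hol: "\<phi> holomorphic_on ball 0 1" using \<phi> by (simp add: hardy_inf_def)
  have ne: "\<phi> z \<noteq> \<mu>" if "norm z < 1" for z
  proof
    assume "\<phi> z = \<mu>"
    then have "\<mu> \<in> \<phi> ` ball 0 1" using that by (intro image_eqI[of _ _ z]) auto
    then have "\<mu> \<in> closure (\<phi> ` ball 0 1)" by (rule subsetD[OF closure_subset])
    then show False using \<mu> by contradiction
  qed
  obtain d where d: "d > 0" "\<And>y. y \<in> \<phi> ` ball 0 1 \<Longrightarrow> d \<le> dist y \<mu>"
    using \<mu> by (auto simp: closure_approachable not_less)
  have "norm (1 / (\<phi> z - \<mu>)) \<le> 1 / d" if z: "norm z < 1" for z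
  proof -
    have "d \<le> norm (\<phi> z - \<mu>)" using d(2)[of "\<phi> z"] z by (simp add: dist_norm)
    then show ?thesis using d by (simp add: norm_divide frac_le)
  qed
  then have "\<forall>x\<in>(\<lambda>z. 1 / (\<phi> z - \<mu>)) ` ball 0 1. norm x \<le> 1 / d" by simp
  then have "bounded ((\<lambda>z. 1 / (\<phi> z - \<mu>)) ` ball 0 1)" unfolding bounded_iff by blast
  moreover have "(\<lambda>z. 1 / (\<phi> z - \<mu>)) holomorphic_on ball 0 1"
    using hol ne by (intro holomorphic_intros) auto
  ultimately show "(\<lambda>z. 1 / (\<phi> z - \<mu>)) \<in> hardy_inf" by (simp add: hardy_inf_def)
  have "AE \<zeta> in circle. \<phi>' \<zeta> \<in> closure (\<phi> ` ball 0 1)"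
    by (rule boundary_values_in_closed_set[OF \<phi>']) (auto simp: closure_subset)
  then show ae: "AE \<zeta> in circle. \<phi>' \<zeta> \<noteq> \<mu>" by eventually_elim (use \<mu> in auto)
  have [measurable]: "\<phi>' \<in> borel_measurable circle" using \<phi>' by (simp add: boundary_function_def)
  have "AE \<zeta> in circle. ((\<lambda>r. \<phi> (complex_of_real r * \<zeta>)) \<longlongrightarrow> \<phi>' \<zeta>) (at_left 1)"
    using \<phi>' by (simp add: boundary_function_def)
  with ae have "AE \<zeta> in circle. ((\<lambda>r. 1 / (\<phi> (complex_of_real r * \<zeta>) - \<mu>)) \<longlongrightarrow> 1 / (\<phi>' \<zeta> - \<mu>)) (at_left 1)"
    by eventually_elim (intro tendsto_divide tendsto_diff tendsto_const; simp)
  then show "boundary_function (\<lambda>z. 1 / (\<phi> z - \<mu>)) (\<lambda>\<zeta>. 1 / (\<phi>' \<zeta> - \<mu>))"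
    by (simp add: boundary_function_def)
qed

theorem theorem8p1:
  fixes \<theta> \<phi> \<theta>' \<phi>' :: "complex \<Rightarrow> complex"
  assumes "inner_function \<theta>" and "boundary_function \<theta> \<theta>'"
    and "\<phi> \<in> hardy_inf" and "boundary_function \<phi> \<phi>'"
    and "(\<lambda>\<zeta>. cnj (\<theta>' \<zeta>) * \<phi>' \<zeta>) \<in> conj_Hinf"
  shows "spectrum_on (model_perp \<theta>') (dual_tto \<theta>' \<phi>') = closure (\<phi> ` ball 0 1)"
proof -
  have \<theta>: "\<theta> \<in> hardy_inf" using assms(1) by (simp add: inner_function_def)
  obtain f where f: "boundary_function \<theta> f" "AE \<zeta> in circle. norm (f \<zeta>) = 1"
    using assms(1) by (auto simp: inner_function_def)
  have uni: "AE \<zeta> in circle. norm (\<theta>' \<zeta>) = 1"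
    using boundary_function_unique[OF f(1) assms(2)] f(2) by eventually_elim simp
  interpret inner_symbol \<theta>'
    by standard (use uni H2_mult_op[OF \<theta> assms(2)] hardy_inf_ess_bounded[OF \<theta> assms(2)] in auto)
  have \<phi>: "ess_bounded \<phi>'" by (rule hardy_inf_ess_bounded[OF assms(3,4)])
  have \<phi>H2: "mult_op \<phi>' h \<in> H2" if "h \<in> H2" for h by (rule H2_mult_op[OF assms(3,4) that])
  obtain u U where U: "U \<in> hardy_inf" "boundary_function U u" 
    and u: "(\<lambda>\<zeta>. cnj (\<theta>' \<zeta>) * \<phi>' \<zeta>) = (\<lambda>\<zeta>. cnj (u \<zeta>))"
    using assms(5) by (auto simp: conj_Hinf_def Hinf_def)
  have co: "mult_op (\<lambda>\<zeta>. cnj (\<theta>' \<zeta>) * \<phi>' \<zeta>) g \<in> ortho_compl H2" if g: "g \<in> ortho_compl H2" for g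
    unfolding u ortho_compl_def
    using g H2_mult_op[OF U] cinner_mult_op[OF ess_bounded_cnj[OF hardy_inf_ess_bounded[OF U]], of g]
    by (simp add: ortho_compl_def)
  let ?D = "dual_tto \<theta>' \<phi>'" and ?M = "model_perp \<theta>'"
  have D: "?D (g + mult_op \<theta>' h) = dual_toeplitz \<phi>' g + mult_op \<theta>' (mult_op \<phi>' h)"
    if "g \<in> ortho_compl H2" "h \<in> H2" for g h
    using \<phi> \<phi>H2 co that by (rule dual_tto_decomposition)
  show ?thesis
  proof (intro equalityI subsetI)
    fix \<mu> assume \<mu>: "\<mu> \<in> spectrum_on ?M ?D"
    show "\<mu> \<in> closure (\<phi> ` ball 0 1)"
    proof (rule ccontr)
      assume "\<mu> \<notin> closure (\<phi> ` ball 0 1)"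
      note r = resolvent_symbol[OF assms(3,4) this]
      define \<psi> where "\<psi> \<zeta> = 1 / (\<phi>' \<zeta> - \<mu>)" for \<zeta>
      define \<xi> where "\<xi> \<zeta> = \<phi>' \<zeta> - \<mu>" for \<zeta>
      have bd: "boundary_function (\<lambda>z. 1 / (\<phi> z - \<mu>)) \<psi>" using r(2) by (simp add: \<psi>_def[abs_def])
      have \<psi>: "ess_bounded \<psi>" by (rule hardy_inf_ess_bounded[OF r(1) bd])
      have \<psi>H2: "mult_op \<psi> h \<in> H2" if "h \<in> H2" for h by (rule H2_mult_op[OF r(1) bd that])
      have \<xi>: "ess_bounded \<xi>"
      proof -
        obtain B where B: "AE \<zeta> in circle. norm (\<phi>' \<zeta>) \<le> B" and [measurable]: "\<phi>' \<in> borel_measurable circle"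
          using \<phi> by (auto simp: ess_bounded_def)
        have "AE \<zeta> in circle. norm (\<xi> \<zeta>) \<le> B + norm \<mu>"
          using B
        proof eventually_elim
          fix \<zeta> assume "norm (\<phi>' \<zeta>) \<le> B"
          then show "norm (\<xi> \<zeta>) \<le> B + norm \<mu>"
            using norm_triangle_ineq4[of "\<phi>' \<zeta>" \<mu>] unfolding \<xi>_def by linarith
        qed
        then show ?thesis unfolding ess_bounded_def \<xi>_def[abs_def] by (intro conjI exI) auto
      qed
      have \<xi>H2: "mult_op \<xi> h \<in> H2" if h: "h \<in> H2" for h
        unfolding mult_op_minus_const[OF \<phi> \<xi> AE_I2[OF \<xi>_def]]
        using csubspace_H2 \<phi>H2[OF h] h by (intro csubspace_diff) (auto simp: csubspace_def)
      have one: "AE \<zeta> in circle. \<psi> \<zeta> * \<xi> \<zeta> = 1" "AE \<zeta> in circle. \<xi> \<zeta> * \<psi> \<zeta> = 1"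
        using r(3) by (eventually_elim, simp add: \<psi>_def \<xi>_def)+
      have D\<mu>: "?D (g + mult_op \<theta>' h) - \<mu> *\<^sub>c (g + mult_op \<theta>' h) = dual_toeplitz \<xi> g + mult_op \<theta>' (mult_op \<xi> h)"
        if g: "g \<in> ortho_compl H2" and h: "h \<in> H2" for g h
        unfolding D[OF g h] dual_toeplitz_minus_const[OF \<phi> \<xi> AE_I2[OF \<xi>_def] g] 
          mult_op_minus_const[OF \<phi> \<xi> AE_I2[OF \<xi>_def]] mult_op_diff[OF bounded] mult_op_cscale[OF bounded] cscale_add
        by simp
      \<comment> \<open>The resolvent inverts the two diagonal blocks of the operator separately.\<close>
      obtain S where S: "bounded_operator_on ?M S" 
        and S_eq: "\<And>g h. g \<in> ortho_compl H2 \<Longrightarrow> h \<in> H2 \<Longrightarrow> 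
           S (g + mult_op \<theta>' h) = dual_toeplitz \<psi> g + mult_op \<theta>' (mult_op \<psi> h)"
        using block_diagonal_operator_bounded[of \<psi>] \<psi> \<psi>H2 by blast
      have inv: "mult_op \<psi> (mult_op \<xi> h) = h" "mult_op \<xi> (mult_op \<psi> h) = h" for h
        unfolding mult_op_mult_op[OF \<psi> \<xi>] mult_op_mult_op[OF \<xi> \<psi>]
        by (intro mult_op_one ess_bounded_mult \<psi> \<xi> one)+
      have anti_inv: "dual_toeplitz \<psi> (dual_toeplitz \<xi> g) = g" "dual_toeplitz \<xi> (dual_toeplitz \<psi> g) = g"
        if g: "g \<in> ortho_compl H2" for g
        using dual_toeplitz_inverse[OF \<psi> \<xi> one(1) _ g] dual_toeplitz_inverse[OF \<xi> \<psi> one(2) _ g] \<psi>H2 \<xi>H2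
        by blast+
      have "S (?D f - \<mu> *\<^sub>c f) = f \<and> ?D (S f) - \<mu> *\<^sub>c S f = f" if fM: "f \<in> ?M" for f
      proof -
        obtain g h where g: "g \<in> ortho_compl H2" and h: "h \<in> H2" and f: "f = g + mult_op \<theta>' h"
          using fM unfolding model_perp_decomposition by blast
        have "S (?D f - \<mu> *\<^sub>c f) = f"
          unfolding f D\<mu>[OF g h] S_eq[OF dual_toeplitz_in \<xi>H2[OF h]] inv anti_inv(1)[OF g] ..
        moreover have "?D (S f) - \<mu> *\<^sub>c S f = f"
          unfolding f S_eq[OF g h] D\<mu>[OF dual_toeplitz_in \<psi>H2[OF h]] inv anti_inv(2)[OF g] ..
        ultimately show ?thesis by blast
      qed
      then show False using \<mu> S unfolding spectrum_on_def by blast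
    qed
  next
    fix \<mu> assume \<mu>: "\<mu> \<in> closure (\<phi> ` ball 0 1)"
    show "\<mu> \<in> spectrum_on ?M ?D"
    proof (rule ccontr)
      assume "\<mu> \<notin> spectrum_on ?M ?D"
      then obtain S where S: "bounded_operator_on ?M S" and inv: "\<And>f. f \<in> ?M \<Longrightarrow> S (?D f - \<mu> *\<^sub>c f) = f"
        unfolding spectrum_on_def by blast
      obtain C where C: "\<And>f. f \<in> ?M \<Longrightarrow> norm (S f) \<le> C * norm f" 
        and lin: "\<And>c f. f \<in> ?M \<Longrightarrow> S (c *\<^sub>c f) = c *\<^sub>c S f"
        using S unfolding bounded_operator_on_def by blast
      \<comment> \<open>An eigenvalue closer to \<open>\<mu>\<close> than the reciprocal of the norm of the resolvent contradicts its boundedness;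
        \<open>\<bar>C\<bar> + 1\<close> is a positive bound for that norm.\<close>
      obtain w where w: "norm w < 1" and close: "dist (\<phi> w) \<mu> < 1 / (\<bar>C\<bar> + 1)"
        using \<mu> unfolding closure_approachable by (auto dest!: spec[of _ "1 / (\<bar>C\<bar> + 1)"])
      define e where "e = abs_l2 (\<lambda>\<zeta>. 1 / (\<zeta> - w))"
      have e: "e \<in> ortho_compl H2" "e \<noteq> 0" unfolding e_def by (rule cauchy_kernel_l2[OF w])+
      have H0: "0 \<in> H2" using csubspace_H2 by (simp add: csubspace_def)
      have eM: "e \<in> ?M" unfolding model_perp_decomposition
        using e(1) H0 by (intro bexI[of _ e] bexI[of _ 0]) (auto simp: mult_op_zero[OF bounded])
      have "?D e = \<phi> w *\<^sub>c e"
        using D[OF e(1) H0] dual_toeplitz_eigenvector[OF assms(3,4) w]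
        by (simp add: mult_op_zero[OF bounded] mult_op_zero[OF \<phi>] e_def)
      then have "?D e - \<mu> *\<^sub>c e = (\<phi> w - \<mu>) *\<^sub>c e" by (simp add: cscale_diff_left)
      then have "e = (\<phi> w - \<mu>) *\<^sub>c S e" using inv[OF eM] lin[OF eM] by simp
      then have "norm e = norm (\<phi> w - \<mu>) * norm (S e)" using norm_cscale by metis
      also have "\<dots> \<le> norm (\<phi> w - \<mu>) * ((\<bar>C\<bar> + 1) * norm e)"
      proof (rule mult_left_mono)
        have "C * norm e \<le> (\<bar>C\<bar> + 1) * norm e" by (intro mult_right_mono) auto
        then show "norm (S e) \<le> (\<bar>C\<bar> + 1) * norm e" using C[OF eM] by linarith
      qed simp
      also have "\<dots> = (norm (\<phi> w - \<mu>) * (\<bar>C\<bar> + 1)) * norm e" by simp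
      also have "\<dots> < 1 * norm e"
      proof (rule mult_strict_right_mono)
        show "norm (\<phi> w - \<mu>) * (\<bar>C\<bar> + 1) < 1" using close by (simp add: dist_norm pos_less_divide_eq)
      qed (use e in simp)
      finally show False by simp
    qed
  qed
qed

end
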